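(* Fix an integer $d\ge1$ and $\delta$ with $1<\delta<2$. For $\beta>0$ let $\lambda=\beta^{\delta/d}$, $W=[0,\lambda]^d$ (so $\mathrm{Vol}(W)=\beta^\delta$) and $\kappa=\beta^{1-\delta}$ (so that $\beta=\kappa\lambda^d$). Let $A$ be the hard-sphere event, i.e. the set of finite configurations in $W$ in which any two distinct points are at Euclidean distance greater than $1$, and let $p^*=\mathbb P(\boldsymbol X\in A)$, where $\boldsymbol X$ is a homogeneous Poisson point process on $W$ of intensity $\kappa$. Let $\widehat Y$ be the conditional Monte Carlo estimator and $\widetilde Y$ the importance sampling estimator with maximal blocking regions, as defined in the context. Then, as $\beta\to\infty$: (i) $\widetilde Y$ is logarithmically efficient, i.e. $\displaystyle\limsup_{\beta\to\infty}\frac{\mathrm{Var}_\mu(\widetilde Y)}{(p^* )^{2-\varepsilon}}=0$ for every $\varepsilon>0$. (ii) $\widehat Y$ has neither bounded relative error nor logarithmic efficiency; i.e. $\displaystyle\limsup_{\beta\to\infty}\frac{\mathrm{Var}_\rho(\widehat Y)}{(p^* )^{2}}=\infty$, and it is not the case that $\displaystyle\limsup_{\beta\to\infty}\frac{\mathrm{Var}_\rho(\widehat Y)}{(p^* )^{2-\varepsilon}}=0$ for every $\varepsilon>0$.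
   Context: $q_n=e^{-\beta}\beta^n/n!$ for $n\in\mathbb Z_+=\{0,1,2,\dots\}$, and $\boldsymbol X_n=\{X_1,\dots,X_n\}$ with $\boldsymbol X_0=\varnothing$. Under $\rho$, $X_1,X_2,\dots$ are i.i.d. uniform on $W$. Blocking regions: for a configuration $\boldsymbol x$ in $W$, the maximal blocking region is $B(\boldsymbol x)=\{y\in W:\ \|y-x\|\le 1\text{ for some }x\in\boldsymbol x\}$, with $B(\varnothing)=\varnothing$. Under $\mu$, points are generated sequentially: given $X_1,\dots,X_{n-1}$, the point $X_n$ is uniformly distributed on $W\setminus B(\boldsymbol X_{n-1})$; the procedure stops when the blocking region covers $W$ (up to a null set), and $\mathbb I(\boldsymbol X_n\in A)L(\boldsymbol X_n)=0$ for $n$ beyond stopping. The weight is $$L(\boldsymbol X_n)=\prod_{i=0}^{n-1}\Big(1-\frac{\mathrm{Vol}(B(\boldsymbol X_i))}{\mathrm{Vol}(W)}\Big),\qquad L(\boldsymbol X_0)=1.$$ Estimators (both unbiased for $p^*$): - $\widehat Y=\sum_{n\in\mathbb Z_+}q_n\,\mathbb I(\boldsymbol X_n\in A)$ with points generated under $\rho$; - $\widetilde Y=\sum_{n\in\mathbb Z_+}q_n\,\mathbb I(\boldsymbol X_n\in A)\,L(\boldsymbol X_n)$ with points generated under $\mu$. Subscripts $\rho,\mu$ indicate the law of the points used. A family of estimators $Z_\beta$ with means $\mathbb E[Z_\beta]\to0$ has bounded relative error if $\limsup_{\beta\to\infty}\mathrm{Var}(Z_\beta)/\mathbb E[Z_\beta]^2<\infty$,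 and is logarithmically efficient if $\limsup_{\beta\to\infty}\mathrm{Var}(Z_\beta)/\mathbb E[Z_\beta]^{2-\varepsilon}=0$ for each $\varepsilon>0$. *)

theory Defs
  imports "HOL-Probability.Probability"
begin

text \<open>Volume of \<open>window \<delta> \<beta>\<close> is \<open>\<beta> powr \<delta>\<close>, for \<open>\<beta> > 0\<close>; the dimension is \<open>CARD('d)\<close>.\<close>

definition window :: "real \<Rightarrow> real \<Rightarrow> (real ^ 'd) set" where
  "window \<delta> \<beta> = cbox 0 (\<chi> i. \<beta> powr (\<delta> / real CARD('d)))"

definition hard_sphere :: "'a::euclidean_space set \<Rightarrow> 'a set set" where
  "hard_sphere W = {S. finite S \<and> S \<subseteq> W \<and> (\<forall>x\<in>S. \<forall>y\<in>S. x \<noteq> y \<longrightarrow> dist x y > 1)}"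

text \<open>
  \<open>X\<close> is a homogeneous Poisson point process on \<open>W\<close> with intensity \<open>\<kappa>\<close>: a random finite subset
  of \<open>W\<close> whose counts on Borel subsets of \<open>W\<close> are Poisson with parameter \<open>\<kappa>\<close> times the volume,
  and are independent on disjoint sets.  (The Poisson probabilities are written out because
  \<open>poisson_pmf\<close> is only specified for a positive parameter, whereas null sets give parameter 0.)
\<close>

definition poisson_process ::
  "'w measure \<Rightarrow> ('w \<Rightarrow> 'a::euclidean_space set) \<Rightarrow> 'a set \<Rightarrow> real \<Rightarrow> bool" where
  "poisson_process M X W \<kappa> \<longleftrightarrow>
     prob_space M \<and>
     (\<forall>\<omega>\<in>space M. finite (X \<omega>) \<and> X \<omega> \<subseteq> W) \<and>
     (\<forall>B. B \<in> sets borel \<and> B \<subseteq> W \<longrightarrow>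
        (\<lambda>\<omega>. card (X \<omega> \<inter> B)) \<in> measurable M (count_space UNIV) \<and>
        (\<forall>k. measure M {\<omega>\<in>space M. card (X \<omega> \<inter> B) = k} =
               exp (- (\<kappa> * measure lborel B)) * (\<kappa> * measure lborel B) ^ k / fact k)) \<and>
     (\<forall>(I :: nat set) B. finite I \<and> (\<forall>i\<in>I. B i \<in> sets borel \<and> B i \<subseteq> W) \<and> disjoint_family_on B I \<longrightarrow>
        prob_space.indep_vars M (\<lambda>_. count_space UNIV) (\<lambda>i \<omega>. card (X \<omega> \<inter> B i)) I)"

text \<open>
  Points are indexed from 0: a sequence \<open>x :: nat \<Rightarrow> 'a\<close> stands for \<open>X\<^sub>1, X\<^sub>2, \<dots>\<close> with
  \<open>X\<^sub>n = x (n - 1)\<close>, and the configuration \<open>{X\<^sub>1, \<dots>, X\<^sub>n}\<close> is \<open>x ` {..<n}\<close>.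
\<close>

definition iid_law :: "'a::euclidean_space set \<Rightarrow> (nat \<Rightarrow> 'a) measure" where
  "iid_law W = PiM UNIV (\<lambda>_. uniform_measure lborel W)"

definition blocking :: "'a::euclidean_space set \<Rightarrow> 'a set \<Rightarrow> 'a set" where
  "blocking W S = {y\<in>W. \<exists>x\<in>S. norm (y - x) \<le> 1}"

text \<open>
  Conditional law of the next point given the first \<open>n\<close>.  Once the blocking region covers \<open>W\<close> up
  to a null set, generation has stopped; the sequence is then continued in an arbitrary way (here:
  uniformly on \<open>W\<close>).  The continuation never matters, since the likelihood weight below is then 0
  for all later indices.
\<close>

definition sequential_kernel ::
  "'a::euclidean_space set \<Rightarrow> nat \<Rightarrow> (nat \<Rightarrow> 'a) \<Rightarrow> 'a measure" where
  "sequential_kernel W n x =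
     (if emeasure lborel (W - blocking W (x ` {..<n})) = 0 then uniform_measure lborel W
      else uniform_measure lborel (W - blocking W (x ` {..<n})))"

text \<open>
  The law on sequences with these successive conditional laws (Ionescu-Tulcea theorem).  Its
  hypotheses are checked in \<open>Ionescu_Tulcea_sequential\<close> below.
\<close>

definition sequential_law :: "'a::euclidean_space set \<Rightarrow> (nat \<Rightarrow> 'a) measure" where
  "sequential_law W =
     projective_family.lim UNIV (Ionescu_Tulcea.CI (sequential_kernel W) (\<lambda>_. borel)) (\<lambda>_. borel)"

definition weight :: "'a::euclidean_space set \<Rightarrow> (nat \<Rightarrow> 'a) \<Rightarrow> nat \<Rightarrow> real" where
  "weight W x n =
     (\<Prod>i<n. 1 - measure lborel (blocking W (x ` {..<i})) / measure lborel W)"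

definition poisson_weight :: "real \<Rightarrow> nat \<Rightarrow> real" where
  "poisson_weight \<beta> n = exp (- \<beta>) * \<beta> ^ n / fact n"

definition cmc_estimator :: "'a::euclidean_space set \<Rightarrow> real \<Rightarrow> (nat \<Rightarrow> 'a) \<Rightarrow> real" where
  "cmc_estimator W \<beta> x =
     (\<Sum>n. poisson_weight \<beta> n * indicator (hard_sphere W) (x ` {..<n}))"

definition blocking_estimator :: "'a::euclidean_space set \<Rightarrow> real \<Rightarrow> (nat \<Rightarrow> 'a) \<Rightarrow> real" where
  "blocking_estimator W \<beta> x =
     (\<Sum>n. poisson_weight \<beta> n * indicator (hard_sphere W) (x ` {..<n}) * weight W x n)"

text \<open>
  \<open>bounded_relative_error\<close> and \<open>logarithmically_efficient\<close> only state the condition on the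
  variance; they are meant for families satisfying \<open>vanishing_mean\<close>.
\<close>

definition vanishing_mean :: "(real \<Rightarrow> 'w measure) \<Rightarrow> (real \<Rightarrow> 'w \<Rightarrow> real) \<Rightarrow> bool" where
  "vanishing_mean M Z \<longleftrightarrow> ((\<lambda>\<beta>. prob_space.expectation (M \<beta>) (Z \<beta>)) \<longlongrightarrow> 0) at_top"

definition bounded_relative_error ::
  "(real \<Rightarrow> 'w measure) \<Rightarrow> (real \<Rightarrow> 'w \<Rightarrow> real) \<Rightarrow> bool" where
  "bounded_relative_error M Z \<longleftrightarrow>
     Limsup at_top (\<lambda>\<beta>. ereal (prob_space.variance (M \<beta>) (Z \<beta>) /
       (prob_space.expectation (M \<beta>) (Z \<beta>))\<^sup>2)) < \<infinity>"

definition logarithmically_efficient ::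
  "(real \<Rightarrow> 'w measure) \<Rightarrow> (real \<Rightarrow> 'w \<Rightarrow> real) \<Rightarrow> bool" where
  "logarithmically_efficient M Z \<longleftrightarrow>
     (\<forall>\<epsilon>>0. Limsup at_top (\<lambda>\<beta>. ereal (prob_space.variance (M \<beta>) (Z \<beta>) /
       prob_space.expectation (M \<beta>) (Z \<beta>) powr (2 - \<epsilon>))) = 0)"

lemma emeasure_unblocked_measurable:
  fixes W A :: "'a::euclidean_space set" and n :: nat
  assumes [measurable]: "W \<in> sets borel" "A \<in> sets borel"
  shows "(\<lambda>x. emeasure lborel ((W - blocking W (x ` {..<n})) \<inter> A))
           \<in> borel_measurable (PiM {0..<n} (\<lambda>_. borel))"
proof -
  let ?P = "PiM {0..<n} (\<lambda>_. borel :: 'a measure)"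
  let ?Q = "{p \<in> space (?P \<Otimes>\<^sub>M lborel). snd p \<in> W \<and> snd p \<in> A \<and>
              (\<forall>i\<in>{0..<n}. 1 < norm (snd p - fst p i))}"
  have "(\<lambda>p. fst p i) \<in> borel_measurable (?P \<Otimes>\<^sub>M lborel)" if "i \<in> {0..<n}" for i
    by (rule measurable_compose[OF measurable_fst measurable_component_singleton[OF that]])
  then have [measurable]: "Measurable.pred (?P \<Otimes>\<^sub>M lborel) (\<lambda>p. \<forall>i\<in>{0..<n}. 1 < norm (snd p - fst p i))"
    by (intro pred_intros_finite borel_measurable_pred_less borel_measurable_const
          borel_measurable_norm borel_measurable_diff) auto
  have "?Q \<in> sets (?P \<Otimes>\<^sub>M lborel)"
    by measurable
  then have "(\<lambda>x. emeasure lborel (Pair x -` ?Q)) \<in> borel_measurable ?P"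
    by (rule lborel.measurable_emeasure_Pair)
  moreover have "Pair x -` ?Q = (W - blocking W (x ` {..<n})) \<inter> A" if "x \<in> space ?P" for x
    using that by (auto simp: blocking_def space_pair_measure not_le Ball_def Bex_def linorder_not_less[symmetric])
  ultimately show ?thesis
    by (subst measurable_cong[where g = "\<lambda>x. emeasure lborel (Pair x -` ?Q)"]) auto
qed

lemma blocking_finite_measurable:
  assumes "W \<in> sets borel" "finite S"
  shows "blocking W S \<in> sets borel"
proof -
  have "blocking W S = W \<inter> (\<Union>x\<in>S. cball x 1)"
    by (auto simp: blocking_def dist_norm norm_minus_commute)
  with assms show ?thesis
    by (simp add: borel_closed closed_UN sets.Int)
qed

lemma prob_space_sequential_kernel:
  fixes W :: "'a::euclidean_space set"
  assumes W: "W \<in> sets borel" "emeasure lborel W \<noteq> 0" "emeasure lborel W \<noteq> \<infinity>"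
  shows "prob_space (sequential_kernel W n x)"
proof -
  have "emeasure lborel (W - blocking W (x ` {..<n})) \<noteq> \<infinity>"
    using emeasure_mono[of "W - blocking W (x ` {..<n})" W lborel] W by (auto simp: top_unique)
  with W show ?thesis
    by (auto simp: sequential_kernel_def intro!: prob_space_uniform_measure)
qed

lemma Ionescu_Tulcea_sequential:
  fixes W :: "'a::euclidean_space set"
  assumes W: "W \<in> sets borel" "emeasure lborel W \<noteq> 0" "emeasure lborel W \<noteq> \<infinity>"
  shows "Ionescu_Tulcea (sequential_kernel W) (\<lambda>_. borel)"
proof (rule Ionescu_Tulcea.intro, goal_cases)
  case (1 n)
  let ?P = "PiM {0..<n} (\<lambda>_. borel :: 'a measure)"
  define F where "F x = W - blocking W (x ` {..<n})" for x :: "nat \<Rightarrow> 'a"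
  have F_sets: "F x \<in> sets borel" for x
    unfolding F_def using blocking_finite_measurable[OF W(1), of "x ` {..<n}"] W(1) by auto
  have kernel: "sequential_kernel W n x =
      (if emeasure lborel (F x) = 0 then uniform_measure lborel W
       else uniform_measure lborel (F x))" for x
    by (simp add: sequential_kernel_def F_def)
  have meas_F: "(\<lambda>x. emeasure lborel (F x \<inter> A)) \<in> borel_measurable ?P" if "A \<in> sets borel" for A
    unfolding F_def by (rule emeasure_unblocked_measurable[OF W(1) that])
  have meas_F': "(\<lambda>x. emeasure lborel (F x)) \<in> borel_measurable ?P"
    using meas_F[of UNIV] by simp
  show ?case
  proof (rule measurable_subprob_algebra)
    show "subprob_space (sequential_kernel W n x)" for x
      by (intro prob_space_imp_subprob_space prob_space_sequential_kernel W)
    show "sets (sequential_kernel W n x) = sets borel" for x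
      by (simp add: kernel)
    fix A :: "'a set" assume A: "A \<in> sets borel"
    note [measurable] = meas_F[OF A] meas_F'
    have "emeasure (sequential_kernel W n x) A =
        (if emeasure lborel (F x) = 0 then emeasure lborel (W \<inter> A) / emeasure lborel W
         else emeasure lborel (F x \<inter> A) / emeasure lborel (F x))" for x
      using A W F_sets[of x] by (simp add: kernel)
    then show "(\<lambda>x. emeasure (sequential_kernel W n x) A) \<in> borel_measurable ?P"
      by simp
  qed
next
  case 2
  show ?case by (rule prob_space_sequential_kernel[OF W])
qed

end

theory Submission
  imports Defs "HOL-Real_Asymp.Real_Asymp"
begin

text \<open>
  Let \<open>v\<close> be the volume of the unit ball and \<open>a = v \<beta> powr (2 - \<delta>) / 2\<close>.  All four quantities
  \<open>p\<^sup>*\<close>, \<open>E Ytilde\<close>, \<open>E Yhat\<^sup>2\<close> and \<open>sqrt (E Ytilde\<^sup>2)\<close> equal \<open>exp (- (1 + o(1)) a)\<close>, so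
  that \<open>Ytilde\<close> is logarithmically efficient whereas \<open>E Yhat\<^sup>2\<close> is much larger than \<open>(p\<^sup>*)\<^sup>2\<close>.

  The lower bounds come from \<open>Vol (B(X\<^sub>i)) \<le> i v\<close>, applied with \<open>n\<close> slightly above \<open>\<beta>\<close>.  For the
  upper bounds call a point bad if it lies within 1 of the boundary of the window or within 2 of an
  earlier point.  The unit balls around the good points are disjoint and contained in the window,
  so \<open>Vol (B(X\<^sub>i))\<close> is at least \<open>v\<close> times the number of good points among the first \<open>i\<close>.  Under
  either law a new point is bad with conditional probability tending to 0, so that among the
  first \<open>n \<approx> \<beta>\<close> points more than \<open>\<epsilon> n\<close> are bad only with probability \<open>exp (- c \<beta>)\<close>, with \<open>c\<close> as
  large as desired, and this is negligible compared with \<open>exp (- a)\<close>, since \<open>2 - \<delta> < 1\<close>.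
  The same holds for the probability that the Poisson number of points deviates from \<open>\<beta>\<close> by a
  constant factor.

  The identity \<open>p\<^sup>* = E Yhat\<close> holds because the void probabilities of a Poisson process agree with
  those of a Poisson number of independent uniform points, and void probabilities determine the
  law of the set of grid points to which the configuration is rounded.
\<close>

section \<open>Sampling one point at a time\<close>

text \<open>The exponent \<open>a\<close> comes from the product of \<open>1 - i v / Vol W\<close>
  over \<open>i < n\<close>, which is about \<open>exp (- n^2 v / (2 Vol W))\<close>; put
  \<open>n\<close> near \<beta> and \<open>Vol W = \<beta> powr \<delta>\<close>. The two estimators
  differ in where the randomness sits. \<open>Yhat\<close> is essentially the indicator of a rare
  event, and squaring an indicator does not change its mean, so the second moment decays at rate
  \<open>a\<close> and not \<open>2 a\<close>. Under the sequential law the hard-sphere condition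
  holds by construction and the rarity is carried by the weight, which is nearly deterministic, so
  its square decays at rate \<open>2 a\<close>. The condition \<delta> > 1 enters through
  \<open>n / Vol W\<close>, of order \<open>\<beta> powr (1 - \<delta>)\<close>, which tends to 0:
  this permits exchanging \<open>1 - x\<close> and \<open>exp (- x)\<close> and makes bad points
  rare. The condition \<delta> < 2 makes \<open>a\<close> tend to infinity, so that constant factors
  are absorbed. The obstacle is the upper bound: overlaps and the boundary make
  \<open>Vol (B(X\<^sub>i))\<close> depend on the whole past. Badness is therefore judged against
  the past only, and exponential moments are propagated one draw at a time, which needs no
  independence and works for both laws.\<close>

abbreviation seq_space :: "(nat \<Rightarrow> 'a::euclidean_space) measure" where
  "seq_space \<equiv> PiM UNIV (\<lambda>_. borel)"

definition prefix_determined :: "nat \<Rightarrow> ((nat \<Rightarrow> 'a) \<Rightarrow> 'b) \<Rightarrow> bool" where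
  "prefix_determined n f \<longleftrightarrow> (\<forall>x y. (\<forall>i<n. x i = y i) \<longrightarrow> f x = f y)"

text \<open>A common interface for both laws. \<open>step\<close> lets coordinate \<open>n\<close>
  be overwritten by a fresh draw from \<open>K n x\<close>. The restriction to functions of the
  first \<open>Suc n\<close> coordinates matters: under the sequential law the later points depend
  on the overwritten one, so the modified sequence no longer has law \<open>M\<close> beyond
  \<open>n\<close>.\<close>

locale sequential_sampling =
  fixes W :: "'a::euclidean_space set"
    and M :: "(nat \<Rightarrow> 'a) measure"
    and K :: "nat \<Rightarrow> (nat \<Rightarrow> 'a) \<Rightarrow> 'a measure"
  assumes W_borel [measurable]: "W \<in> sets borel"
    and W_pos: "emeasure lborel W \<noteq> 0"
    and W_fin: "emeasure lborel W \<noteq> \<infinity>"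
    and sets_M [measurable_cong]: "sets M = sets seq_space"
    and prob_M: "prob_space M"
    and sets_K [measurable_cong]: "sets (K n x) = sets borel"
    and prob_K: "prob_space (K n x)"
    and step: "\<And>n f. f \<in> borel_measurable seq_space \<Longrightarrow> prefix_determined (Suc n) f \<Longrightarrow>
      (\<integral>\<^sup>+x. f x \<partial>M) = (\<integral>\<^sup>+x. \<integral>\<^sup>+y. f (x(n := y)) \<partial>K n x \<partial>M)"

text \<open>Resampling one coordinate leaves a product measure invariant.\<close>

lemma sequential_sampling_iid:
  fixes W :: "'a::euclidean_space set"
  assumes W: "W \<in> sets borel" "emeasure lborel W \<noteq> 0" "emeasure lborel W \<noteq> \<infinity>"
  shows "sequential_sampling W (iid_law W) (\<lambda>_ _. uniform_measure lborel W)"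
proof (rule sequential_sampling.intro)
  let ?U = "uniform_measure lborel W"
  have U: "prob_space ?U"
    using W by (intro prob_space_uniform_measure) auto
  interpret U: prob_space ?U by fact
  show s: "sets (iid_law W) = sets seq_space"
    by (auto simp: iid_law_def intro!: sets_PiM_cong)
  show P: "prob_space (iid_law W)"
    unfolding iid_law_def by (intro prob_space_PiM U)
  interpret P: prob_space "iid_law W" by fact
  fix n and f :: "(nat \<Rightarrow> 'a) \<Rightarrow> ennreal" assume f: "f \<in> borel_measurable seq_space"
  have f': "f \<in> borel_measurable (iid_law W)"
    using f by (simp add: measurable_cong_sets[OF s refl])
  have up: "(\<lambda>(x, X). X(n := x)) \<in> measurable (?U \<Otimes>\<^sub>M iid_law W) (iid_law W)"
    unfolding iid_law_def split_beta
    by (rule measurable_fun_upd[where J=UNIV]) auto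
  \<comment> \<open>The library fact adjoins a coordinate \<open>n\<close> to an index set; with
    \<open>UNIV\<close> nothing is adjoined, and it becomes invariance under overwriting.\<close>
  have "(\<integral>\<^sup>+x. f x \<partial>iid_law W) = (\<integral>\<^sup>+x. f x \<partial>distr (?U \<Otimes>\<^sub>M iid_law W) (iid_law W) (\<lambda>(x, X). X(n := x)))"
    using distr_pair_PiM_eq_PiM[of UNIV "\<lambda>_. ?U" n] U by (simp add: iid_law_def)
  also have "\<dots> = (\<integral>\<^sup>+z. f ((snd z)(n := fst z)) \<partial>(?U \<Otimes>\<^sub>M iid_law W))"
    using up f' by (subst nn_integral_distr) (auto simp: split_beta)
  also have "\<dots> = (\<integral>\<^sup>+x. \<integral>\<^sup>+y. f (x(n := y)) \<partial>?U \<partial>iid_law W)"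
  proof -
    interpret pair_sigma_finite ?U "iid_law W" ..
    have "(\<lambda>z. f ((snd z)(n := fst z))) \<in> borel_measurable (?U \<Otimes>\<^sub>M iid_law W)"
      using measurable_compose[OF up f'] by (simp add: split_beta)
    then show ?thesis
      by (subst nn_integral_snd[symmetric]) auto
  qed
  finally show "(\<integral>\<^sup>+x. f x \<partial>iid_law W) = (\<integral>\<^sup>+x. \<integral>\<^sup>+y. f (x(n := y)) \<partial>?U \<partial>iid_law W)" .
qed (use W in \<open>auto intro!: prob_space_uniform_measure\<close>)

text \<open>The limit measure restricted to the first \<open>n\<close> coordinates is
  \<open>IT.C 0 n\<close>, and \<open>IT.C 0 (Suc n)\<close> is \<open>IT.C 0 n\<close> followed by
  one draw from the kernel. A function of the first \<open>Suc n\<close> coordinates sees only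
  this.\<close>

lemma sequential_sampling_sequential:
  fixes W :: "'a::euclidean_space set"
  assumes W: "W \<in> sets borel" "emeasure lborel W \<noteq> 0" "emeasure lborel W \<noteq> \<infinity>"
  shows "sequential_sampling W (sequential_law W) (sequential_kernel W)"
proof (rule sequential_sampling.intro)
  let ?K = "sequential_kernel W"
  interpret IT: Ionescu_Tulcea ?K "\<lambda>_. borel"
    by (rule Ionescu_Tulcea_sequential[OF W])
  show s: "sets (sequential_law W) = sets seq_space"
    unfolding sequential_law_def by simp
  have restr: "distr (sequential_law W) (PiM {0..<n} (\<lambda>_. borel)) (\<lambda>x. restrict x {0..<n})
      = IT.C 0 n (\<lambda>_. undefined)" for n
  proof -
    have "IT.CI {0..<n} = IT.C 0 n (\<lambda>_. undefined)"
    proof (rule measure_eqI)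
      show "sets (IT.CI {0..<n}) = sets (IT.C 0 n (\<lambda>_. undefined))"
        by (simp add: IT.CI_def IT.sets_C)
      fix A assume "A \<in> sets (IT.CI {0..<n})"
      then have A: "A \<in> sets (PiM {0..<n} (\<lambda>_. borel))"
        by (simp add: IT.CI_def)
      show "IT.CI {0..<n} A = IT.C 0 n (\<lambda>_. undefined) A"
        using A sets.sets_into_space[OF A]
        by (subst IT.emeasure_CI[where n=n]) (auto simp: prod_emb_id space_PiM)
    qed
    then show ?thesis
      unfolding sequential_law_def by (simp add: IT.distr_lim)
  qed
  show P: "prob_space (sequential_law W)"
  \<comment> \<open>The total mass is read off the marginal on the empty set of coordinates.\<close>
  proof (rule prob_space_distrD)
    show "(\<lambda>x. restrict x {0..<0::nat}) \<in> measurable (sequential_law W) (PiM {0..<0} (\<lambda>_. borel))"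
      unfolding measurable_cong_sets[OF s refl] by (auto intro!: measurable_restrict_subset)
    show "prob_space (distr (sequential_law W) (PiM {0..<0} (\<lambda>_. borel)) (\<lambda>x. restrict x {0..<0}))"
      unfolding restr by (rule IT.prob_space_C) simp
  qed
  show sK: "sets (?K n x) = sets borel" for n x
    by (auto simp: sequential_kernel_def)
  show "prob_space (?K n x)" for n x
    by (rule prob_space_sequential_kernel[OF W])
  fix n and f :: "(nat \<Rightarrow> 'a) \<Rightarrow> ennreal"
  assume f: "f \<in> borel_measurable seq_space" and pf: "prefix_determined (Suc n) f"
  \<comment> \<open>Elements of the finite products are \<open>undefined\<close> off the prefix;
    padding by 0 moves them measurably into \<open>seq_space\<close>, where \<open>f\<close> can be
    evaluated. The padding is invisible to \<open>f\<close> by \<open>pf\<close>.\<close>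
  define e :: "nat \<Rightarrow> (nat \<Rightarrow> 'a) \<Rightarrow> nat \<Rightarrow> 'a" where "e m x i = (if i < m then x i else 0)" for m x i
  define g where "g x = f (e (Suc n) x)" for x
  have g[measurable]: "g \<in> borel_measurable (PiM {0..<Suc n} (\<lambda>_. borel))"
  proof -
    have "e (Suc n) \<in> measurable (PiM {0..<Suc n} (\<lambda>_. borel)) seq_space"
    proof (rule measurable_PiM_single')
      show "(\<lambda>x. e (Suc n) x i) \<in> borel_measurable (PiM {0..<Suc n} (\<lambda>_. borel))" for i
        by (cases "i < Suc n") (auto simp: e_def)
    qed auto
    from measurable_compose[OF this f] show ?thesis by (simp add: g_def[abs_def])
  qed
  have gr: "g (restrict x {0..<Suc n}) = f x" for x
    using pf unfolding g_def prefix_determined_def by (auto simp: e_def)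
  have meas_r: "(\<lambda>x. restrict x {0..<m::nat}) \<in> measurable (sequential_law W) (PiM {0..<m} (\<lambda>_. borel))" for m
    unfolding measurable_cong_sets[OF s refl] by (auto intro!: measurable_restrict_subset)
  let ?u = "\<lambda>_::nat. undefined :: 'a"
  have u: "?u \<in> space (PiM {0..<0} (\<lambda>_. borel))" by (simp add: space_PiM)
  have "(\<integral>\<^sup>+x. f x \<partial>sequential_law W) = (\<integral>\<^sup>+x. g (restrict x {0..<Suc n}) \<partial>sequential_law W)"
    by (simp only: gr)
  also have "\<dots> = (\<integral>\<^sup>+x. g x \<partial>IT.C 0 (Suc n) ?u)"
    by (subst restr[symmetric], subst nn_integral_distr[OF meas_r]) auto
  also have "\<dots> = (\<integral>\<^sup>+x. \<integral>\<^sup>+y. g y \<partial>IT.eP n x \<partial>IT.C 0 n ?u)"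
    using IT.measurable_eP[of n] IT.sets_C[OF u, of n]
    by (simp, subst nn_integral_bind[where B="PiM {0..<Suc n} (\<lambda>_. borel)"])
      (auto cong: measurable_cong_sets)
  also have "\<dots> = (\<integral>\<^sup>+x. \<integral>\<^sup>+y. g (x(n := y)) \<partial>?K n x \<partial>IT.C 0 n ?u)"
    by (intro nn_integral_cong IT.nn_integral_eP) (auto simp: IT.space_C[OF u])
  also have "\<dots> = (\<integral>\<^sup>+x. \<integral>\<^sup>+y. g ((restrict x {0..<n})(n := y)) \<partial>?K n (restrict x {0..<n}) \<partial>sequential_law W)"
  proof -
    have "(\<lambda>x. \<integral>\<^sup>+y. g y \<partial>IT.eP n x) \<in> borel_measurable (PiM {0..<n} (\<lambda>_. borel))"
      by (rule measurable_compose[OF IT.measurable_eP nn_integral_measurable_subprob_algebra]) simp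
    then have "(\<lambda>x. \<integral>\<^sup>+y. g (x(n := y)) \<partial>?K n x) \<in> borel_measurable (PiM {0..<n} (\<lambda>_. borel))"
      by (subst measurable_cong[where g="\<lambda>x. \<integral>\<^sup>+y. g y \<partial>IT.eP n x"])
        (auto simp: IT.nn_integral_eP)
    then have "(\<lambda>x. \<integral>\<^sup>+y. g (x(n := y)) \<partial>?K n x) \<in> borel_measurable
        (distr (sequential_law W) (PiM {0..<n} (\<lambda>_. borel)) (\<lambda>x. restrict x {0..<n}))"
      by simp
    from nn_integral_distr[OF meas_r this] show ?thesis
      by (simp only: restr)
  qed
  also have "\<dots> = (\<integral>\<^sup>+x. \<integral>\<^sup>+y. f (x(n := y)) \<partial>?K n x \<partial>sequential_law W)"
  proof (intro nn_integral_cong)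
    fix x :: "nat \<Rightarrow> 'a"
    \<comment> \<open>The kernel reads the past only through the set of its first \<open>n\<close>
      points.\<close>
    have "restrict x {0..<n} ` {..<n} = x ` {..<n}" by auto
    then have k: "?K n (restrict x {0..<n}) = ?K n x"
      by (simp add: sequential_kernel_def)
    have "g ((restrict x {0..<n})(n := y)) = f (x(n := y))" for y
      unfolding g_def using pf by (auto simp: e_def prefix_determined_def)
    then show "(\<integral>\<^sup>+y. g ((restrict x {0..<n})(n := y)) \<partial>?K n (restrict x {0..<n})) =
        (\<integral>\<^sup>+y. f (x(n := y)) \<partial>?K n x)"
      by (simp add: k)
  qed
  finally show "(\<integral>\<^sup>+x. f x \<partial>sequential_law W) = (\<integral>\<^sup>+x. \<integral>\<^sup>+y. f (x(n := y)) \<partial>?K n x \<partial>sequential_law W)" .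
qed (use W in auto)

section \<open>Bad points and the volume of the blocking region\<close>

text \<open>Comparison with earlier points only makes badness known at the moment of the draw. It
  still separates any two good points by more than 2, since the later one was compared with the
  earlier one. \<open>U\<close> will be a set of points whose unit balls lie in the window.\<close>

definition bad_step :: "'a::euclidean_space set \<Rightarrow> (nat \<Rightarrow> 'a) \<Rightarrow> nat \<Rightarrow> bool" where
  "bad_step U x j \<longleftrightarrow> x j \<notin> U \<or> (\<exists>k<j. dist (x j) (x k) \<le> 2)"

definition bad_count :: "'a::euclidean_space set \<Rightarrow> (nat \<Rightarrow> 'a) \<Rightarrow> nat \<Rightarrow> nat" where
  "bad_count U x n = card {j. j < n \<and> bad_step U x j}"

lemma bad_count_mono: "m \<le> n \<Longrightarrow> bad_count U x m \<le> bad_count U x n"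
  unfolding bad_count_def by (intro card_mono) auto

lemma bad_step_fun_upd: "j < n \<Longrightarrow> bad_step U (x(n := y)) j = bad_step U x j"
  unfolding bad_step_def by (intro arg_cong2[where f="(\<or>)"] ex_cong1) auto

lemma bad_count_fun_upd: "m \<le> n \<Longrightarrow> bad_count U (x(n := y)) m = bad_count U x m"
  unfolding bad_count_def by (intro arg_cong[where f=card] Collect_cong) (auto simp: bad_step_fun_upd)

lemma bad_count_prefix: "prefix_determined n (\<lambda>x. bad_count U x n)"
  unfolding prefix_determined_def bad_count_def bad_step_def
  by (auto intro!: arg_cong[where f=card])

lemma bad_step_fun_upd_same:
  "bad_step U (x(n := y)) n \<longleftrightarrow> y \<in> {y. y \<notin> U \<or> (\<exists>k<n. dist y (x k) \<le> 2)}"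
  by (auto simp: bad_step_def)

text \<open>Configurations are sets, so repeating an earlier point does no harm; hence the premise
  that \<open>y\<close> differs from \<open>x i\<close>.\<close>

lemma hard_sphere_Suc:
  "(x(n := y)) ` {..<Suc n} \<in> hard_sphere W \<longleftrightarrow>
     x ` {..<n} \<in> hard_sphere W \<and> y \<in> W \<and> (\<forall>i<n. y \<noteq> x i \<longrightarrow> 1 < dist y (x i))"
proof -
  have "(x(n := y)) ` {..<Suc n} = insert y (x ` {..<n})"
    by (auto simp: lessThan_Suc)
  then show ?thesis
    by (auto simp: hard_sphere_def dist_commute)
qed

lemma hard_sphere_antimono: "T \<in> hard_sphere W \<Longrightarrow> S \<subseteq> T \<Longrightarrow> S \<in> hard_sphere W"
  by (auto simp: hard_sphere_def finite_subset)

lemma measurable_bad_step [measurable]: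
  assumes [measurable]: "U \<in> sets borel"
  shows "Measurable.pred seq_space (\<lambda>x. bad_step U x j)"
  unfolding bad_step_def by measurable

lemma measurable_hard_sphere [measurable]:
  assumes [measurable]: "W \<in> sets borel"
  shows "Measurable.pred seq_space (\<lambda>x. x ` {..<n} \<in> hard_sphere W)"
proof -
  \<comment> \<open>Distinctness is written as nonzero distance, a condition whose measurability is
    automatic.\<close>
  have *: "x ` {..<n} \<in> hard_sphere W \<longleftrightarrow> (\<forall>i\<in>{..<n}. x i \<in> W) \<and>
      (\<forall>i\<in>{..<n}. \<forall>j\<in>{..<n}. dist (x i) (x j) \<noteq> 0 \<longrightarrow> 1 < dist (x i) (x j))" for x :: "nat \<Rightarrow> 'a"
    by (auto simp: hard_sphere_def)
  show ?thesis
    unfolding * by measurable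
qed

lemma bad_count_power: "s ^ bad_count U x n = (\<Prod>j<n. if bad_step U x j then s else 1)" for s :: "'a::comm_monoid_mult"
proof -
  have "{j. j < n \<and> bad_step U x j} = {..<n} \<inter> {j. bad_step U x j}" by auto
  then show ?thesis
    by (simp add: bad_count_def prod.If_cases)
qed

lemma measurable_bad_count [measurable]:
  assumes [measurable]: "U \<in> sets borel"
  shows "(\<lambda>x. bad_count U x n) \<in> measurable seq_space (count_space UNIV)"
proof -
  have "bad_count U x n = (\<Sum>j<n. if bad_step U x j then 1 else 0)" for x
  proof -
    have "{j. j < n \<and> bad_step U x j} = {..<n} \<inter> {j. bad_step U x j}" by auto
    then show ?thesis by (simp add: bad_count_def sum.If_cases)
  qed
  then show ?thesis by simp
qed

lemma measure_blocking_le: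
  fixes W :: "'a::euclidean_space set"
  assumes "finite S" "W \<in> sets borel"
  shows "measure lborel (blocking W S) \<le> card S * unit_ball_vol (real DIM('a))"
proof -
  have "measure lborel (blocking W S) \<le> measure lborel (\<Union>x\<in>S. cball x 1)"
  proof (rule measure_mono_fmeasurable)
    show "blocking W S \<subseteq> (\<Union>x\<in>S. cball x 1)"
      by (auto simp: blocking_def dist_norm norm_minus_commute)
    show "blocking W S \<in> sets lborel" using blocking_finite_measurable[OF assms(2,1)] by simp
    show "(\<Union>x\<in>S. cball x 1) \<in> fmeasurable lborel"
      using assms(1) by (intro fmeasurable.finite_UN) (auto intro: fmeasurable_compact)
  qed
  also have "\<dots> \<le> (\<Sum>x\<in>S. measure lborel (cball x 1))"
    by (intro measure_UNION_le assms) auto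
  also have "\<dots> = card S * unit_ball_vol (real DIM('a))"
    by (simp add: content_cball)
  finally show ?thesis .
qed

context sequential_sampling begin

sublocale prob_space M by (rule prob_M)

lemma W_fmeasurable: "W \<in> fmeasurable lborel"
  using W_fin by (auto simp: fmeasurable_def top.not_eq_extremum)

lemma measure_W_pos: "0 < measure lborel W"
  using W_pos W_fin by (simp add: measure_def enn2real_positive_iff top.not_eq_extremum zero_less_iff_neq_zero)

lemma emeasure_W: "emeasure lborel W = ennreal (measure lborel W)"
  using W_fin by (simp add: emeasure_eq_ennreal_measure)

lemma blocking_sets [measurable]: "blocking W (x ` {..<n}) \<in> sets borel" for n :: nat
  by (rule blocking_finite_measurable) auto

lemma blocking_subset: "blocking W S \<subseteq> W"
  by (auto simp: blocking_def)

lemma measure_unblocked: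
  "measure lborel (W - blocking W (x ` {..<n})) = measure lborel W - measure lborel (blocking W (x ` {..<n}))" for n :: nat
  by (intro measure_Diff blocking_subset) (use W_fin in auto)

lemma measure_blocking_prefix_le:
  "measure lborel (blocking W (x ` {..<n})) \<le> real n * unit_ball_vol (real DIM('a))" for n :: nat
proof -
  have "card (x ` {..<n}) \<le> n" using card_image_le[of "{..<n}" x] by simp
  then show ?thesis
    using measure_blocking_le[of "x ` {..<n}" W]
    by (smt (verit, best) W_borel finite_imageI finite_lessThan mult_right_mono of_nat_le_iff unit_ball_vol_nonneg of_nat_0_le_iff)
qed

lemma measure_blocking_ge:
  assumes U: "\<And>y. y \<in> U \<Longrightarrow> cball y 1 \<subseteq> W"
  shows "unit_ball_vol (real DIM('a)) * (real n - real (bad_count U x n)) \<le> measure lborel (blocking W (x ` {..<n}))"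
proof -
  let ?v = "unit_ball_vol (real DIM('a))"
  define G where "G = {j. j < n \<and> \<not> bad_step U x j}"
  have [simp]: "finite G" by (auto simp: G_def)
  have "card G = n - bad_count U x n"
  proof -
    have "G = {..<n} - {j. j < n \<and> bad_step U x j}" by (auto simp: G_def)
    then show ?thesis by (simp add: bad_count_def card_Diff_subset subset_eq)
  qed
  then have "?v * (real n - real (bad_count U x n)) \<le> ?v * real (card G)"
    by (intro mult_left_mono) auto
  also have "\<dots> = (\<Sum>j\<in>G. measure lborel (cball (x j) 1))"
    by (simp add: content_cball)
  also have "\<dots> = measure lborel (\<Union>j\<in>G. cball (x j) 1)"
  proof (rule measure_UNION'[symmetric])
    have *: "disjnt (cball (x i) 1) (cball (x j) 1)" if "i \<in> G" "j \<in> G" "i < j" for i j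
    proof -
      have "2 < dist (x j) (x i)" using that by (auto simp: G_def bad_step_def not_le)
      then have "dist (x i) z \<le> 1 \<Longrightarrow> dist (x j) z \<le> 1 \<Longrightarrow> False" for z
        using dist_triangle[of "x j" "x i" z] by (auto simp: dist_commute)
      then show ?thesis by (auto simp: disjnt_def)
    qed
    show "pairwise (\<lambda>i j. disjnt (cball (x i) 1) (cball (x j) 1)) G"
      unfolding pairwise_def using * disjnt_sym by (metis nat_neq_iff)
  qed (auto intro: fmeasurable_compact)
  also have "\<dots> \<le> measure lborel (blocking W (x ` {..<n}))"
  proof (rule measure_mono_fmeasurable)
    show "(\<Union>j\<in>G. cball (x j) 1) \<subseteq> blocking W (x ` {..<n})"
    proof
      fix z assume "z \<in> (\<Union>j\<in>G. cball (x j) 1)"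
      then obtain j where j: "j \<in> G" "z \<in> cball (x j) 1" by auto
      then have "z \<in> W" using U[of "x j"] by (auto simp: G_def bad_step_def)
      with j show "z \<in> blocking W (x ` {..<n})"
        by (auto simp: blocking_def dist_norm norm_minus_commute G_def)
    qed
    show "blocking W (x ` {..<n}) \<in> fmeasurable lborel"
      by (rule fmeasurableI2[OF W_fmeasurable blocking_subset]) simp
    show "(\<Union>j\<in>G. cball (x j) 1) \<in> sets lborel"
      using \<open>finite G\<close> by (intro sets.finite_UN) auto
  qed
  finally show ?thesis .
qed

text \<open>Obtained by complement from the measurability of the unblocked volume, which is known on
  finite prefixes and is pulled back along restriction.\<close>

lemma measurable_measure_blocking [measurable]:
  "(\<lambda>x. measure lborel (blocking W (x ` {..<n}))) \<in> borel_measurable seq_space" for n :: nat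
proof -
  have r: "(\<lambda>x. restrict x {0..<n}) \<in> measurable seq_space (PiM {0..<n} (\<lambda>_. borel :: 'a measure))"
    by (rule measurable_restrict_subset) simp
  have im: "restrict x {0..<n} ` {..<n} = x ` {..<n}" for x :: "nat \<Rightarrow> 'a" by auto
  have "(\<lambda>x. emeasure lborel (W - blocking W (x ` {..<n}))) \<in> borel_measurable seq_space"
    using measurable_compose[OF r emeasure_unblocked_measurable[OF W_borel, of UNIV]]
    by (simp add: im)
  then have "(\<lambda>x. measure lborel W - enn2real (emeasure lborel (W - blocking W (x ` {..<n})))) \<in> borel_measurable seq_space"
    by measurable
  then show ?thesis
    unfolding measure_def[symmetric] measure_unblocked by simp
qed

lemma measurable_weight [measurable]: "(\<lambda>x. weight W x n) \<in> borel_measurable seq_space"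
  unfolding weight_def by measurable

lemma weight_factor_bounds:
  "0 \<le> 1 - measure lborel (blocking W (x ` {..<n})) / measure lborel W"
  "1 - measure lborel (blocking W (x ` {..<n})) / measure lborel W \<le> 1" for n :: nat
proof -
  have "measure lborel (blocking W (x ` {..<n})) \<le> measure lborel W"
    by (rule measure_mono_fmeasurable[OF blocking_subset _ W_fmeasurable]) simp
  then show "0 \<le> 1 - measure lborel (blocking W (x ` {..<n})) / measure lborel W"
    using measure_W_pos by simp
qed simp

lemma weight_nonneg: "0 \<le> weight W x n"
  unfolding weight_def by (intro prod_nonneg ballI weight_factor_bounds)

lemma weight_antimono: "m \<le> n \<Longrightarrow> weight W x n \<le> weight W x m"
proof (induction rule: dec_induct)
  case (step k)
  have "weight W x (Suc k) \<le> weight W x k * 1"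
    unfolding weight_def prod.lessThan_Suc
    by (intro mult_left_mono weight_factor_bounds prod_nonneg ballI)
  then show ?case using step by simp
qed simp

lemma weight_le_1: "weight W x n \<le> 1"
  using weight_antimono[of 0 n x] by (simp add: weight_def)

lemma weight_ge:
  assumes "real n * unit_ball_vol (real DIM('a)) \<le> measure lborel W"
  shows "(\<Prod>i<n. 1 - real i * unit_ball_vol (real DIM('a)) / measure lborel W) \<le> weight W x n"
  unfolding weight_def
proof (intro prod_mono conjI)
  fix i assume "i \<in> {..<n}"
  then have "real i * unit_ball_vol (real DIM('a)) \<le> real n * unit_ball_vol (real DIM('a))"
    by (intro mult_right_mono) auto
  with assms have "real i * unit_ball_vol (real DIM('a)) \<le> measure lborel W" by linarith
  then show "0 \<le> 1 - real i * unit_ball_vol (real DIM('a)) / measure lborel W"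
    using measure_W_pos by simp
  show "1 - real i * unit_ball_vol (real DIM('a)) / measure lborel W
      \<le> 1 - measure lborel (blocking W (x ` {..<i})) / measure lborel W"
    using measure_blocking_prefix_le[of x i] measure_W_pos by (simp add: divide_right_mono)
qed

lemma bad_count_tail:
  fixes r \<epsilon> :: real
  assumes [measurable]: "U \<in> sets borel" and r: "0 < r" "r \<le> 1"
    and K: "\<And>n x. n < N \<Longrightarrow> emeasure (K n x) {y. y \<notin> U \<or> (\<exists>k<n. dist y (x k) \<le> 2)} \<le> ennreal r"
  shows "prob {x \<in> space M. \<epsilon> * real N < real (bad_count U x N)} \<le> (2 * r powr \<epsilon>) ^ N"
proof -
  txt \<open>Chernoff bound: the factor \<open>s = 1 / r\<close> per bad point at most doubles the mean in each step.\<close>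
  define s where "s = 1 / r"
  have s: "s \<ge> 1" "s > 0" "s * r = 1" using r by (auto simp: s_def)
  have *: "n \<le> N \<Longrightarrow> (\<integral>\<^sup>+x. ennreal (s ^ bad_count U x n) \<partial>M) \<le> ennreal (2 ^ n)" for n
  proof (induction n)
    case 0
    then show ?case by (simp add: bad_count_def emeasure_space_1)
  next
    case (Suc n)
    have "(\<integral>\<^sup>+x. ennreal (s ^ bad_count U x (Suc n)) \<partial>M) =
        (\<integral>\<^sup>+x. \<integral>\<^sup>+y. ennreal (s ^ bad_count U (x(n := y)) (Suc n)) \<partial>K n x \<partial>M)"
    proof (rule step)
      show "prefix_determined (Suc n) (\<lambda>x. ennreal (s ^ bad_count U x (Suc n)))"
        using bad_count_prefix[of "Suc n" U] unfolding prefix_determined_def by metis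
      show "(\<lambda>x. ennreal (s ^ bad_count U x (Suc n))) \<in> borel_measurable seq_space"
        by measurable
    qed
    also have "\<dots> \<le> (\<integral>\<^sup>+x. ennreal (s ^ bad_count U x n) * 2 \<partial>M)"
    proof (rule nn_integral_mono)
      fix x
      let ?B = "{y. y \<notin> U \<or> (\<exists>k<n. dist y (x k) \<le> 2)}"
      have B[measurable]: "?B \<in> sets borel" by measurable
      have "(\<integral>\<^sup>+y. ennreal (s ^ bad_count U (x(n := y)) (Suc n)) \<partial>K n x)
          \<le> (\<integral>\<^sup>+y. ennreal (s ^ bad_count U x n) * (1 + ennreal s * indicator ?B y) \<partial>K n x)"
      proof (rule nn_integral_mono)
        fix y
        have "s ^ bad_count U (x(n := y)) (Suc n) = s ^ bad_count U (x(n := y)) n * (if bad_step U (x(n := y)) n then s else 1)"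
          by (simp only: bad_count_power prod.lessThan_Suc)
        also have "\<dots> = s ^ bad_count U x n * (if y \<in> ?B then s else 1)"
          unfolding bad_step_fun_upd_same by (simp add: bad_count_fun_upd)
        finally show "ennreal (s ^ bad_count U (x(n := y)) (Suc n)) \<le> ennreal (s ^ bad_count U x n) * (1 + ennreal s * indicator ?B y)"
          using s by (auto simp: ennreal_mult split: split_indicator intro!: mult_left_mono)
      qed
      also have "\<dots> = ennreal (s ^ bad_count U x n) * (1 + ennreal s * emeasure (K n x) ?B)"
        using B by (simp add: nn_integral_cmult nn_integral_add prob_space.emeasure_space_1[OF prob_K] measurable_cong_sets[OF sets_K refl] del: ennreal_power)
      also have "\<dots> \<le> ennreal (s ^ bad_count U x n) * (1 + ennreal s * ennreal r)"
        using K[of n x] Suc.prems by (intro mult_left_mono add_left_mono) auto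
      also have "1 + ennreal s * ennreal r = 2"
        using s r by (simp flip: ennreal_mult)
      finally show "(\<integral>\<^sup>+y. ennreal (s ^ bad_count U (x(n := y)) (Suc n)) \<partial>K n x) \<le> ennreal (s ^ bad_count U x n) * 2" .
    qed
    also have "\<dots> = (\<integral>\<^sup>+x. ennreal (s ^ bad_count U x n) \<partial>M) * 2"
      by (rule nn_integral_multc) measurable
    also have "\<dots> \<le> ennreal (2 ^ n) * 2"
      using Suc by (intro mult_right_mono) auto
    also have "\<dots> = ennreal (2 ^ Suc n)"
      by (simp add: ennreal_mult' flip: ennreal_numeral) (simp add: mult.commute)
    finally show ?case .
  qed
  let ?E = "{x \<in> space M. \<epsilon> * real N < real (bad_count U x N)}"
  have "ennreal (s powr (\<epsilon> * real N)) * emeasure M ?E = (\<integral>\<^sup>+x. ennreal (s powr (\<epsilon> * real N)) * indicator ?E x \<partial>M)"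
    by (rule nn_integral_cmult_indicator[symmetric]) measurable
  also have "\<dots> \<le> (\<integral>\<^sup>+x. ennreal (s ^ bad_count U x N) \<partial>M)"
  proof (rule nn_integral_mono)
    fix x
    have "x \<in> ?E \<Longrightarrow> s powr (\<epsilon> * real N) \<le> s powr (real (bad_count U x N))"
      using s by (intro powr_mono) auto
    then show "ennreal (s powr (\<epsilon> * real N)) * indicator ?E x \<le> ennreal (s ^ bad_count U x N)"
      using s by (auto simp: powr_realpow split: split_indicator intro!: ennreal_leI)
  qed
  also have "\<dots> \<le> ennreal (2 ^ N)" by (rule *) simp
  finally have "s powr (\<epsilon> * real N) * prob ?E \<le> 2 ^ N"
    by (simp add: emeasure_eq_measure ennreal_mult[symmetric] del: ennreal_power)
  then have "prob ?E \<le> 2 ^ N * r powr (\<epsilon> * real N)"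
    using r by (simp add: s_def powr_divide field_simps)
  also have "r powr (\<epsilon> * real N) = (r powr \<epsilon>) ^ N"
    using r by (simp add: powr_powr[symmetric] powr_realpow)
  finally show ?thesis by (simp add: power_mult_distrib)
qed

end

lemma sum_lessThan_real: "(\<Sum>i<N. real i) = real N * (real N - 1) / 2"
  by (induction N) (auto simp: field_simps)

lemma measurable_indicator_hard_sphere [measurable]:
  assumes [measurable]: "W \<in> sets borel"
  shows "(\<lambda>x. indicator (hard_sphere W) (x ` {..<n}) :: ennreal) \<in> borel_measurable seq_space"
    and "(\<lambda>x. indicator (hard_sphere W) (x ` {..<n}) :: real) \<in> borel_measurable seq_space"
  unfolding indicator_def by measurable

section \<open>Survival of the hard-sphere condition under one more draw\<close>

context sequential_sampling begin

text \<open>The positions of the next point that keep a hard-sphere configuration hard-sphere. They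
  include earlier points themselves wherever a repetition is harmless, so this set can exceed the
  complement of the blocking region, but only by finitely many points.\<close>

definition extensions :: "nat \<Rightarrow> (nat \<Rightarrow> 'a) \<Rightarrow> 'a set" where
  "extensions n x = {y \<in> W. \<forall>i<n. y \<noteq> x i \<longrightarrow> 1 < dist y (x i)}"

lemma extensions_sets [measurable]: "extensions n x \<in> sets borel"
proof -
  have "extensions n x = {y \<in> W. \<forall>i\<in>{..<n}. dist y (x i) \<noteq> 0 \<longrightarrow> 1 < dist y (x i)}"
    by (auto simp: extensions_def)
  also have "\<dots> \<in> sets borel" by measurable
  finally show ?thesis .
qed

lemma unblocked_subset_extensions: "W - blocking W (x ` {..<n}) \<subseteq> extensions n x"
  by (force simp: extensions_def blocking_def dist_norm)

lemma emeasure_extensions: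
  "emeasure lborel (extensions n x) = emeasure lborel (W - blocking W (x ` {..<n}))"
proof -
  have eq: "extensions n x = (W - blocking W (x ` {..<n})) \<union> (extensions n x \<inter> x ` {..<n})"
  proof
    show "extensions n x \<subseteq> (W - blocking W (x ` {..<n})) \<union> (extensions n x \<inter> x ` {..<n})"
      by (force simp: extensions_def blocking_def dist_norm)
  qed (use unblocked_subset_extensions in auto)
  have "emeasure lborel (x ` {..<n}) = 0"
    by (intro emeasure_lborel_countable countable_finite) simp
  moreover have "x ` {..<n} \<in> sets borel"
    by (intro borel_closed finite_imp_closed) simp
  ultimately have "extensions n x \<inter> x ` {..<n} \<in> null_sets lborel"
    by (intro null_set_Int1) auto
  then show ?thesis
    by (subst eq, intro emeasure_Un_null_set) auto
qed

text \<open>Given the first \<open>n\<close> points, the condition survives exactly if the new point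
  falls into \<open>extensions n x\<close>, and \<open>g\<close> is already fixed. The survival
  probability will be a factor of \<open>weight\<close> under the uniform kernel and 1 under the
  sequential kernel.\<close>

lemma nn_integral_hard_sphere_Suc:
  assumes g [measurable]: "g \<in> borel_measurable seq_space" and pg: "prefix_determined n g"
  shows "(\<integral>\<^sup>+x. indicator (hard_sphere W) (x ` {..<Suc n}) * g x \<partial>M) =
    (\<integral>\<^sup>+x. indicator (hard_sphere W) (x ` {..<n}) * g x * emeasure (K n x) (extensions n x) \<partial>M)"
proof -
  have "(\<integral>\<^sup>+x. indicator (hard_sphere W) (x ` {..<Suc n}) * g x \<partial>M) =
    (\<integral>\<^sup>+x. \<integral>\<^sup>+y. indicator (hard_sphere W) ((x(n := y)) ` {..<Suc n}) * g (x(n := y)) \<partial>K n x \<partial>M)"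
  proof (rule step)
    show "prefix_determined (Suc n) (\<lambda>x. indicator (hard_sphere W) (x ` {..<Suc n}) * g x)"
      unfolding prefix_determined_def
    proof (intro allI impI)
      fix x y :: "nat \<Rightarrow> 'a" assume *: "\<forall>i<Suc n. x i = y i"
      then have "x ` {..<Suc n} = y ` {..<Suc n}" by (intro image_cong) auto
      moreover have "g x = g y" using pg * by (auto simp: prefix_determined_def)
      ultimately show "indicator (hard_sphere W) (x ` {..<Suc n}) * g x = indicator (hard_sphere W) (y ` {..<Suc n}) * g y"
        by simp
    qed
  qed measurable
  also have "\<dots> = (\<integral>\<^sup>+x. \<integral>\<^sup>+y. indicator (hard_sphere W) (x ` {..<n}) * g x * indicator (extensions n x) y \<partial>K n x \<partial>M)"
  proof (intro nn_integral_cong)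
    fix x y
    have "g (x(n := y)) = g x" using pg by (auto simp: prefix_determined_def)
    then show "indicator (hard_sphere W) ((x(n := y)) ` {..<Suc n}) * g (x(n := y)) =
        indicator (hard_sphere W) (x ` {..<n}) * g x * indicator (extensions n x) y"
      unfolding indicator_def hard_sphere_Suc by (auto simp: extensions_def)
  qed
  also have "\<dots> = (\<integral>\<^sup>+x. indicator (hard_sphere W) (x ` {..<n}) * g x * emeasure (K n x) (extensions n x) \<partial>M)"
    by (intro nn_integral_cong nn_integral_cmult_indicator) (simp add: sets_K)
  finally show ?thesis .
qed

lemma emeasure_hard_sphere:
  "emeasure M {x \<in> space M. x ` {..<n} \<in> hard_sphere W} = (\<integral>\<^sup>+x. indicator (hard_sphere W) (x ` {..<n}) \<partial>M)"
proof -
  have "{x \<in> space M. x ` {..<n} \<in> hard_sphere W} \<in> sets M" by measurable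
  from nn_integral_indicator[OF this] show ?thesis
    by (subst (asm) nn_integral_cong[where v="\<lambda>x. indicator (hard_sphere W) (x ` {..<n})"])
      (auto split: split_indicator)
qed

text \<open>Identifies the factors of \<open>weight\<close> as the conditional survival
  probabilities under uniform sampling, which is why \<open>weight\<close> acts as a likelihood
  ratio.\<close>

lemma uniform_extensions:
  "emeasure (uniform_measure lborel W) (extensions n x) =
    ennreal (1 - measure lborel (blocking W (x ` {..<n})) / measure lborel W)"
proof -
  have "emeasure (uniform_measure lborel W) (extensions n x) = emeasure lborel (W \<inter> extensions n x) / emeasure lborel W"
    by simp
  also have "W \<inter> extensions n x = extensions n x" by (auto simp: extensions_def)
  also have "emeasure lborel (extensions n x) = ennreal (measure lborel (W - blocking W (x ` {..<n})))"
    unfolding emeasure_extensions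
    by (rule emeasure_eq_ennreal_measure)
      (use emeasure_mono[of "W - blocking W (x ` {..<n})" W lborel] W_fin in \<open>auto simp: top_unique\<close>)
  also have "\<dots> / emeasure lborel W = ennreal (measure lborel (W - blocking W (x ` {..<n})) / measure lborel W)"
    unfolding emeasure_W by (intro divide_ennreal measure_W_pos measure_nonneg)
  finally show ?thesis
    using measure_W_pos by (simp add: measure_unblocked diff_divide_distrib)
qed

text \<open>By the union bound on the blocked volume, draw \<open>n\<close> survives with
  conditional probability at least \<open>1 - n v / V\<close>, whatever the past; \<open>N\<close>
  keeps all these factors nonnegative.\<close>

lemma prob_hard_sphere_ge:
  assumes K: "\<And>n x. K n x = uniform_measure lborel W"
    and N: "real N * unit_ball_vol (real DIM('a)) \<le> measure lborel W"
  shows "(\<Prod>i<N. 1 - real i * unit_ball_vol (real DIM('a)) / measure lborel W)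
    \<le> prob {x \<in> space M. x ` {..<N} \<in> hard_sphere W}"
proof -
  let ?v = "unit_ball_vol (real DIM('a))" and ?V = "measure lborel W"
  have "n \<le> N \<Longrightarrow> ennreal (\<Prod>i<n. 1 - real i * ?v / ?V) \<le> emeasure M {x \<in> space M. x ` {..<n} \<in> hard_sphere W}" for n
  proof (induction n)
    case 0
    then show ?case by (simp add: hard_sphere_def emeasure_space_1)
  next
    case (Suc n)
    have "real n * ?v \<le> real N * ?v" using Suc.prems by (intro mult_right_mono) auto
    with N have "real n * ?v \<le> ?V" by linarith
    then have pos: "0 \<le> 1 - real n * ?v / ?V" using measure_W_pos by simp
    have "ennreal (\<Prod>i<Suc n. 1 - real i * ?v / ?V) = ennreal (\<Prod>i<n. 1 - real i * ?v / ?V) * ennreal (1 - real n * ?v / ?V)"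
      using pos by (simp add: ennreal_mult'')
    also have "\<dots> \<le> emeasure M {x \<in> space M. x ` {..<n} \<in> hard_sphere W} * ennreal (1 - real n * ?v / ?V)"
      using Suc by (intro mult_right_mono) auto
    also have "\<dots> = (\<integral>\<^sup>+x. indicator (hard_sphere W) (x ` {..<n}) * ennreal (1 - real n * ?v / ?V) \<partial>M)"
      unfolding emeasure_hard_sphere by (rule nn_integral_multc[symmetric]) measurable
    also have "\<dots> \<le> (\<integral>\<^sup>+x. indicator (hard_sphere W) (x ` {..<n}) * 1 * emeasure (K n x) (extensions n x) \<partial>M)"
      unfolding K uniform_extensions
      using measure_blocking_prefix_le[of _ n] measure_W_pos
      by (intro nn_integral_mono) (auto intro!: mult_left_mono ennreal_leI divide_right_mono)
    also have "\<dots> = (\<integral>\<^sup>+x. indicator (hard_sphere W) (x ` {..<Suc n}) * 1 \<partial>M)"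
      by (rule nn_integral_hard_sphere_Suc[symmetric]) (auto simp: prefix_determined_def)
    also have "\<dots> = emeasure M {x \<in> space M. x ` {..<Suc n} \<in> hard_sphere W}"
      unfolding emeasure_hard_sphere by simp
    finally show ?case .
  qed
  from this[of N] show ?thesis
    by (simp add: emeasure_eq_measure)
qed

text \<open>The strict volume bound keeps the unblocked region of positive volume for the first
  \<open>N\<close> draws. Generation has not stopped, and each draw lands in the unblocked region
  almost surely.\<close>

lemma AE_hard_sphere:
  assumes K: "\<And>n x. K n x = sequential_kernel W n x"
    and N: "real N * unit_ball_vol (real DIM('a)) < measure lborel W"
  shows "AE x in M. x ` {..<N} \<in> hard_sphere W"
proof -
  let ?v = "unit_ball_vol (real DIM('a))" and ?V = "measure lborel W"
  have "n \<le> N \<Longrightarrow> emeasure M {x \<in> space M. x ` {..<n} \<in> hard_sphere W} = 1" for n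
  proof (induction n)
    case 0
    then show ?case by (simp add: hard_sphere_def emeasure_space_1)
  next
    case (Suc n)
    have "real n * ?v \<le> real N * ?v" using Suc.prems by (intro mult_right_mono) auto
    then have pos: "0 < measure lborel (W - blocking W (x ` {..<n}))" for x
      using N measure_blocking_prefix_le[of x n] unfolding measure_unblocked by linarith
    have K1: "emeasure (K n x) (extensions n x) = 1" for x
    proof -
      let ?F = "W - blocking W (x ` {..<n})"
      have F: "emeasure lborel ?F \<noteq> 0" "emeasure lborel ?F \<noteq> \<infinity>"
        using pos[of x] emeasure_mono[of ?F W lborel] W_fin by (auto simp: measure_def top_unique)
      have "emeasure (K n x) (extensions n x) = emeasure lborel (?F \<inter> extensions n x) / emeasure lborel ?F"
        using F by (simp add: K sequential_kernel_def)
      also have "?F \<inter> extensions n x = ?F"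
        using unblocked_subset_extensions by auto
      also have "emeasure lborel ?F / emeasure lborel ?F = 1"
        using F by (simp add: ennreal_divide_self top.not_eq_extremum)
      finally show ?thesis .
    qed
    have "emeasure M {x \<in> space M. x ` {..<Suc n} \<in> hard_sphere W} = (\<integral>\<^sup>+x. indicator (hard_sphere W) (x ` {..<Suc n}) * 1 \<partial>M)"
      unfolding emeasure_hard_sphere by simp
    also have "\<dots> = (\<integral>\<^sup>+x. indicator (hard_sphere W) (x ` {..<n}) * 1 * emeasure (K n x) (extensions n x) \<partial>M)"
      by (rule nn_integral_hard_sphere_Suc) (auto simp: prefix_determined_def)
    also have "\<dots> = emeasure M {x \<in> space M. x ` {..<n} \<in> hard_sphere W}"
      unfolding emeasure_hard_sphere K1 by simp
    finally show ?case using Suc by simp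
  qed
  from this[of N] have "prob {x \<in> space M. x ` {..<N} \<in> hard_sphere W} = 1"
    by (simp add: emeasure_eq_measure)
  then show ?thesis
    by (subst (asm) prob_Collect_eq_1) auto
qed

section \<open>Upper bounds when few points are bad\<close>

context
  fixes U :: "'a set"
  assumes U_ball: "\<And>y. y \<in> U \<Longrightarrow> cball y 1 \<subseteq> W"
    and U_borel [measurable]: "U \<in> sets borel"
begin

text \<open>The count of bad points is nondecreasing, so its bound at \<open>N\<close> serves for
  all earlier indices.\<close>

lemma sum_good_ge:
  assumes "real (bad_count U x N) \<le> \<epsilon> * real N"
  shows "real N * (real N - 1) / 2 - \<epsilon> * (real N)\<^sup>2 \<le> (\<Sum>i<N. real i - real (bad_count U x i))"
proof -
  have "(\<Sum>i<N. real (bad_count U x i)) \<le> (\<Sum>i<N. \<epsilon> * real N)"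
    using assms bad_count_mono[of _ N U x] by (intro sum_mono) (smt (verit, best) lessThan_iff less_imp_le of_nat_mono)
  then show ?thesis
    by (simp add: sum_subtractf sum_lessThan_real power2_eq_square mult_ac)
qed

lemma weight_factor_le:
  "1 - measure lborel (blocking W (x ` {..<n})) / measure lborel W
    \<le> exp (- (unit_ball_vol (real DIM('a)) / measure lborel W * (real n - real (bad_count U x n))))"
proof -
  have "unit_ball_vol (real DIM('a)) / measure lborel W * (real n - real (bad_count U x n))
      \<le> measure lborel (blocking W (x ` {..<n})) / measure lborel W"
    using measure_blocking_ge[OF U_ball, where n=n and x=x] measure_W_pos
    by (simp add: divide_right_mono)
  moreover have "1 - t \<le> exp (- t)" for t :: real
    using exp_ge_add_one_self[of "-t"] by simp
  ultimately show ?thesis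
    by (smt (verit, best) exp_le_cancel_iff)
qed

text \<open>A pathwise bound: on sequences with few bad points the weight lies below a deterministic
  number.\<close>

lemma weight_le:
  assumes "real (bad_count U x N) \<le> \<epsilon> * real N"
  shows "weight W x N \<le> exp (- (unit_ball_vol (real DIM('a)) / measure lborel W *
    (real N * (real N - 1) / 2 - \<epsilon> * (real N)\<^sup>2)))"
proof -
  let ?a = "unit_ball_vol (real DIM('a)) / measure lborel W"
  have "weight W x N \<le> (\<Prod>i<N. exp (- (?a * (real i - real (bad_count U x i)))))"
    unfolding weight_def by (intro prod_mono conjI weight_factor_bounds weight_factor_le)
  also have "\<dots> = exp (- (?a * (\<Sum>i<N. real i - real (bad_count U x i))))"
    by (simp add: exp_sum[symmetric] sum_negf sum_distrib_left)
  also have "\<dots> \<le> exp (- (?a * (real N * (real N - 1) / 2 - \<epsilon> * (real N)\<^sup>2)))"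
    using mult_left_mono[OF sum_good_ge[OF assms], of ?a] by simp
  finally show ?thesis .
qed

lemma prob_hard_sphere_good_le:
  fixes \<epsilon> :: real
  assumes K: "\<And>n x. K n x = uniform_measure lborel W"
  shows "prob {x \<in> space M. x ` {..<N} \<in> hard_sphere W \<and> real (bad_count U x N) \<le> \<epsilon> * real N}
    \<le> exp (- (unit_ball_vol (real DIM('a)) / measure lborel W * (real N * (real N - 1) / 2 - \<epsilon> * (real N)\<^sup>2)))"
proof -
  define a where "a = unit_ball_vol (real DIM('a)) / measure lborel W"
  have a: "a \<ge> 0" by (simp add: a_def)
  txt \<open>\<open>Z\<close>, killed when the hard-sphere condition fails, is a supermartingale: passing from \<open>n\<close> to
    \<open>Suc n\<close> multiplies its conditional mean by \<open>exp t (1 - Vol B / Vol W)\<close>, where \<open>t \<le> Vol B / Vol W\<close>.\<close>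
  define Z where "Z n x = ennreal (exp (a * (\<Sum>i<n. real i - real (bad_count U x i))))" for n x
  have Z_meas [measurable]: "Z n \<in> borel_measurable seq_space" for n
    unfolding Z_def by measurable
  \<comment> \<open>\<open>Z (Suc n)\<close> sums over \<open>i \<le> n\<close>, and the
    \<open>i\<close>-th term looks at the first \<open>i\<close> points only. So \<open>Z\<close> is
    one step ahead of the draw and can be taken out of the inner integral.\<close>
  have Z_prefix: "prefix_determined n (Z (Suc n))" for n
    unfolding prefix_determined_def
  proof (intro allI impI)
    fix x y :: "nat \<Rightarrow> 'a" assume "\<forall>i<n. x i = y i"
    then have "bad_count U x i = bad_count U y i" if "i < Suc n" for i
      using that bad_count_prefix[of i U] by (auto simp: prefix_determined_def)
    then show "Z (Suc n) x = Z (Suc n) y"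
      unfolding Z_def by simp
  qed
  have *: "(\<integral>\<^sup>+x. indicator (hard_sphere W) (x ` {..<n}) * Z n x \<partial>M) \<le> 1" for n
  proof (induction n)
    case 0
    then show ?case
      by (simp add: hard_sphere_def Z_def emeasure_space_1)
  next
    case (Suc n)
    have "(\<integral>\<^sup>+x. indicator (hard_sphere W) (x ` {..<Suc n}) * Z (Suc n) x \<partial>M) =
        (\<integral>\<^sup>+x. indicator (hard_sphere W) (x ` {..<n}) * Z (Suc n) x * emeasure (K n x) (extensions n x) \<partial>M)"
      by (rule nn_integral_hard_sphere_Suc[OF Z_meas Z_prefix])
    also have "\<dots> \<le> (\<integral>\<^sup>+x. indicator (hard_sphere W) (x ` {..<n}) * Z n x \<partial>M)"
      unfolding K uniform_extensions
    proof (rule nn_integral_mono)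
      fix x
      let ?t = "a * (real n - real (bad_count U x n))" and ?f = "1 - measure lborel (blocking W (x ` {..<n})) / measure lborel W"
      have "Z (Suc n) x = Z n x * ennreal (exp ?t)"
        by (simp add: Z_def distrib_left exp_add ennreal_mult)
      moreover have "ennreal (exp ?t) * ennreal ?f \<le> ennreal (exp ?t) * ennreal (exp (- ?t))"
        unfolding a_def by (intro mult_left_mono ennreal_leI weight_factor_le) simp
      moreover have "ennreal (exp ?t) * ennreal (exp (- ?t)) = 1"
        by (simp flip: ennreal_mult add: exp_minus)
      ultimately have "Z (Suc n) x * ennreal ?f \<le> Z n x * 1"
        by (simp only: mult.assoc) (intro mult_left_mono; simp)
      then show "indicator (hard_sphere W) (x ` {..<n}) * Z (Suc n) x * ennreal ?f \<le> indicator (hard_sphere W) (x ` {..<n}) * Z n x"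
        by (auto split: split_indicator)
    qed
    finally show ?case using Suc by simp
  qed
  let ?E = "{x \<in> space M. x ` {..<N} \<in> hard_sphere W \<and> real (bad_count U x N) \<le> \<epsilon> * real N}"
  let ?c = "real N * (real N - 1) / 2 - \<epsilon> * (real N)\<^sup>2"
  have "ennreal (exp (a * ?c)) * emeasure M ?E = (\<integral>\<^sup>+x. ennreal (exp (a * ?c)) * indicator ?E x \<partial>M)"
    by (rule nn_integral_cmult_indicator[symmetric]) measurable
  also have "\<dots> \<le> (\<integral>\<^sup>+x. indicator (hard_sphere W) (x ` {..<N}) * Z N x \<partial>M)"
  proof (rule nn_integral_mono)
    fix x
    have "x \<in> ?E \<Longrightarrow> ennreal (exp (a * ?c)) \<le> Z N x"
      unfolding Z_def using mult_left_mono[OF sum_good_ge a, of x N \<epsilon>] by (intro ennreal_leI) auto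
    then show "ennreal (exp (a * ?c)) * indicator ?E x \<le> indicator (hard_sphere W) (x ` {..<N}) * Z N x"
      by (auto split: split_indicator)
  qed
  also have "\<dots> \<le> 1" by (rule *)
  finally have "exp (a * ?c) * prob ?E \<le> 1"
    by (simp add: emeasure_eq_measure ennreal_mult[symmetric])
  then show ?thesis
    unfolding a_def[symmetric] by (simp add: exp_minus field_simps)
qed

lemma measure_bad_le:
  "measure lborel (W \<inter> {y. y \<notin> U \<or> (\<exists>k<n. dist y (x k) \<le> 2)})
    \<le> measure lborel (W - U) + real n * (2 ^ DIM('a) * unit_ball_vol (real DIM('a)))"
proof -
  let ?A = "W \<inter> (\<Union>k\<in>{..<n}. cball (x k) 2)"
  have "W \<inter> {y. y \<notin> U \<or> (\<exists>k<n. dist y (x k) \<le> 2)} \<subseteq> (W - U) \<union> (\<Union>k\<in>{..<n}. cball (x k) 2)"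
    by (auto simp: dist_commute)
  then have "measure lborel (W \<inter> {y. y \<notin> U \<or> (\<exists>k<n. dist y (x k) \<le> 2)})
      \<le> measure lborel ((W - U) \<union> (\<Union>k\<in>{..<n}. cball (x k) 2))"
  proof (rule measure_mono_fmeasurable)
    have "W - U \<in> fmeasurable lborel" by (rule fmeasurableI2[OF W_fmeasurable]) auto
    moreover have "(\<Union>k\<in>{..<n}. cball (x k) 2) \<in> fmeasurable lborel"
      by (intro fmeasurable.finite_UN) (auto intro: fmeasurable_compact)
    ultimately show "(W - U) \<union> (\<Union>k\<in>{..<n}. cball (x k) 2) \<in> fmeasurable lborel"
      by (rule fmeasurable.Un)
  qed simp
  also have "\<dots> \<le> measure lborel (W - U) + measure lborel (\<Union>k\<in>{..<n}. cball (x k) 2)"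
    by (rule measure_Un_le) auto
  also have "measure lborel (\<Union>k\<in>{..<n}. cball (x k) 2) \<le> (\<Sum>k<n. measure lborel (cball (x k) 2))"
    by (rule measure_UNION_le) auto
  also have "\<dots> = real n * (2 ^ DIM('a) * unit_ball_vol (real DIM('a)))"
    by (simp add: content_cball mult_ac)
  finally show ?thesis by simp
qed

text \<open>The next point is uniform on \<open>W\<close> or on its unblocked part. By
  \<open>half\<close> the latter has at least half the volume, so every event has at most twice its
  probability under the uniform law on \<open>W\<close>. This is the factor 2 in the hypothesis on
  \<open>r\<close>.\<close>

lemma bad_prob_le:
  assumes K: "\<And>n x. K n x = uniform_measure lborel W \<or> K n x = sequential_kernel W n x"
    and half: "2 * real N * unit_ball_vol (real DIM('a)) \<le> measure lborel W"
    and r: "2 * (measure lborel (W - U) + real N * (2 ^ DIM('a) * unit_ball_vol (real DIM('a)))) \<le> r * measure lborel W"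
    and n: "n < N"
  shows "emeasure (K n x) {y. y \<notin> U \<or> (\<exists>k<n. dist y (x k) \<le> 2)} \<le> ennreal r"
proof -
  let ?B = "{y. y \<notin> U \<or> (\<exists>k<n. dist y (x k) \<le> 2)}" and ?V = "measure lborel W"
  define v where "v = unit_ball_vol (real DIM('a))"
  have v: "v \<ge> 0" by (simp add: v_def)
  have B [measurable]: "?B \<in> sets borel" by measurable
  have nv: "real n * (c * v) \<le> real N * (c * v)" if "c \<ge> 0" for c
    using n v that by (intro mult_right_mono mult_nonneg_nonneg) auto
  have WB: "2 * measure lborel (W \<inter> ?B) \<le> r * ?V"
  proof -
    have "real n * (2 ^ DIM('a) * v) \<le> real N * (2 ^ DIM('a) * v)" by (rule nv) simp
    with measure_bad_le[of n x] r[unfolded distrib_left] show ?thesis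
      unfolding v_def by linarith
  qed
  have fin: "F \<in> fmeasurable lborel" if "F \<subseteq> W" "F \<in> sets borel" for F
    using fmeasurableI2[OF W_fmeasurable that(1)] that by simp
  have unif: "emeasure (uniform_measure lborel F) ?B \<le> ennreal r"
    if F: "F \<subseteq> W" "F \<in> sets borel" "?V \<le> 2 * measure lborel F" for F
  proof -
    have pos: "0 < measure lborel F" using F(3) measure_W_pos by linarith
    have "emeasure (uniform_measure lborel F) ?B = emeasure lborel (F \<inter> ?B) / emeasure lborel F"
      using F by simp
    also have "\<dots> = ennreal (measure lborel (F \<inter> ?B) / measure lborel F)"
      using fin[OF F(1,2)] fin[of "F \<inter> ?B"] F pos
      by (subst (1 2) emeasure_eq_measure2) (auto simp: divide_ennreal)
    also have "\<dots> \<le> ennreal r"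
    proof (rule ennreal_leI)
      have "measure lborel (F \<inter> ?B) \<le> measure lborel (W \<inter> ?B)"
        using F by (intro measure_mono_fmeasurable fin) auto
      then have "2 * measure lborel (F \<inter> ?B) \<le> r * ?V"
        using WB by linarith
      moreover have "r \<ge> 0"
        using WB measure_W_pos measure_nonneg[of lborel "W \<inter> ?B"]
        by (smt (verit, best) zero_le_mult_iff)
      ultimately have "2 * measure lborel (F \<inter> ?B) \<le> r * (2 * measure lborel F)"
        using F(3) by (meson mult_left_mono order_trans)
      then show "measure lborel (F \<inter> ?B) / measure lborel F \<le> r"
        using pos by (simp add: field_simps)
    qed
    finally show ?thesis .
  qed
  have "?V \<le> 2 * measure lborel (W - blocking W (x ` {..<n}))"
  proof -
    have "real n * unit_ball_vol (real DIM('a)) \<le> real N * unit_ball_vol (real DIM('a))"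
      using n by (intro mult_right_mono) auto
    then show ?thesis
      unfolding measure_unblocked right_diff_distrib
      using measure_blocking_prefix_le[of x n] half unfolding mult.assoc by linarith
  qed
  \<comment> \<open>Positive unblocked volume excludes the stopped branch of
    \<open>sequential_kernel\<close>.\<close>
  moreover from this have "emeasure lborel (W - blocking W (x ` {..<n})) \<noteq> 0"
    using measure_W_pos by (auto simp: measure_def)
  ultimately show ?thesis
    using K[of n x] unif[of W] unif[of "W - blocking W (x ` {..<n})"] measure_W_pos
    by (auto simp: sequential_kernel_def)
qed

end

end

section \<open>Void probabilities determine the hard-sphere probability\<close>

lemma poisson_weight_nonneg: "0 \<le> \<beta> \<Longrightarrow> 0 \<le> poisson_weight \<beta> n"
  by (simp add: poisson_weight_def)

text \<open>The generating function of the Poisson law. It gives the total mass at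
  \<open>t = 1\<close>, the void probabilities for \<open>t\<close> in the unit interval, and both
  Chernoff bounds.\<close>

lemma poisson_weight_power_sums: "(\<lambda>n. poisson_weight \<beta> n * t ^ n) sums exp (\<beta> * (t - 1))"
proof -
  have "(\<lambda>n. exp (- \<beta>) * ((\<beta> * t) ^ n /\<^sub>R fact n)) sums (exp (- \<beta>) * exp (\<beta> * t))"
    by (intro sums_mult exp_converges)
  moreover have "exp (- \<beta>) * exp (\<beta> * t) = exp (\<beta> * (t - 1))"
    by (simp add: exp_add[symmetric] algebra_simps)
  moreover have "exp (- \<beta>) * ((\<beta> * t) ^ n /\<^sub>R fact n) = poisson_weight \<beta> n * t ^ n" for n
    by (simp add: poisson_weight_def power_mult_distrib divide_inverse mult_ac)
  ultimately show ?thesis by simp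
qed

lemma poisson_weight_sums: "poisson_weight \<beta> sums 1"
  using poisson_weight_power_sums[of \<beta> 1] by simp

text \<open>\<open>g\<close> prescribes the probability that a region contains no point. No
  measurable structure on configurations is chosen; measurability is asked of the void events
  alone.\<close>

definition void_law ::
  "'w measure \<Rightarrow> ('w \<Rightarrow> 'a::euclidean_space set) \<Rightarrow> 'a set \<Rightarrow> ('a set \<Rightarrow> real) \<Rightarrow> bool" where
  "void_law M X W g \<longleftrightarrow> prob_space M \<and> (\<forall>\<omega>\<in>space M. finite (X \<omega>) \<and> X \<omega> \<subseteq> W) \<and>
    (\<forall>B. B \<in> sets borel \<and> B \<subseteq> W \<longrightarrow>
      {\<omega>\<in>space M. X \<omega> \<inter> B = {}} \<in> sets M \<and> measure M {\<omega>\<in>space M. X \<omega> \<inter> B = {}} = g B)"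

lemma void_lawD:
  assumes "void_law M X W g"
  shows "prob_space M" "\<And>\<omega>. \<omega> \<in> space M \<Longrightarrow> finite (X \<omega>)" "\<And>\<omega>. \<omega> \<in> space M \<Longrightarrow> X \<omega> \<subseteq> W"
    "\<And>B. B \<in> sets borel \<Longrightarrow> B \<subseteq> W \<Longrightarrow> {\<omega>\<in>space M. X \<omega> \<inter> B = {}} \<in> sets M"
    "\<And>B. B \<in> sets borel \<Longrightarrow> B \<subseteq> W \<Longrightarrow> measure M {\<omega>\<in>space M. X \<omega> \<inter> B = {}} = g B"
  using assms by (auto simp: void_law_def)

text \<open>The image stays within \<open>J\<close> exactly if the region that \<open>h\<close> maps
  outside \<open>J\<close> is void.\<close>

lemma void_law_image_subset:
  fixes h :: "'a::euclidean_space \<Rightarrow> 'b::euclidean_space"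
  assumes X: "void_law M X W g" and W: "W \<in> sets borel" and h: "h \<in> borel_measurable borel" "finite (h ` W)"
  shows "{\<omega>\<in>space M. h ` X \<omega> \<subseteq> J} \<in> sets M"
    and "measure M {\<omega>\<in>space M. h ` X \<omega> \<subseteq> J} = g {x\<in>W. h x \<notin> J}"
proof -
  have "{x\<in>W. h x \<notin> J} = W \<inter> h -` (h ` W - J)" by auto
  moreover have "closed (h ` W - J)" using h(2) by (intro finite_imp_closed) auto
  then have "W \<inter> h -` (h ` W - J) \<in> sets borel"
    using measurable_sets_borel[OF h(1), of "h ` W - J"] W by (intro sets.Int) auto
  ultimately have B: "{x\<in>W. h x \<notin> J} \<in> sets borel" by simp
  have eq: "{\<omega>\<in>space M. h ` X \<omega> \<subseteq> J} = {\<omega>\<in>space M. X \<omega> \<inter> {x\<in>W. h x \<notin> J} = {}}"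
    using void_lawD(3)[OF X] by blast
  show "{\<omega>\<in>space M. h ` X \<omega> \<subseteq> J} \<in> sets M"
    unfolding eq by (rule void_lawD(4)[OF X B]) auto
  show "measure M {\<omega>\<in>space M. h ` X \<omega> \<subseteq> J} = g {x\<in>W. h x \<notin> J}"
    unfolding eq by (rule void_lawD(5)[OF X B]) auto
qed

lemma void_law_image_eq_sets:
  fixes h :: "'a::euclidean_space \<Rightarrow> 'b::euclidean_space"
  assumes X: "void_law M X W g" and W: "W \<in> sets borel" and h: "h \<in> borel_measurable borel" "finite (h ` W)"
    and J: "finite J"
  shows "{\<omega>\<in>space M. h ` X \<omega> = J} \<in> sets M"
proof -
  have "{\<omega>\<in>space M. h ` X \<omega> = J} = {\<omega>\<in>space M. h ` X \<omega> \<subseteq> J} - (\<Union>j\<in>J. {\<omega>\<in>space M. h ` X \<omega> \<subseteq> J - {j}})"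
    by auto
  also have "\<dots> \<in> sets M"
    using J by (intro sets.Diff sets.finite_UN void_law_image_subset(1)[OF X W h]) auto
  finally show ?thesis .
qed

lemma void_law_image_Collect:
  fixes h :: "'a::euclidean_space \<Rightarrow> 'b::euclidean_space"
  assumes X: "void_law M X W g" and W: "W \<in> sets borel" and h: "h \<in> borel_measurable borel" "finite (h ` W)"
  shows "{\<omega>\<in>space M. R (h ` X \<omega>)} \<in> sets M"
    and "measure M {\<omega>\<in>space M. R (h ` X \<omega>)} = (\<Sum>J | J \<in> Pow (h ` W) \<and> R J. measure M {\<omega>\<in>space M. h ` X \<omega> = J})"
proof -
  interpret prob_space M by (rule void_lawD(1)[OF X])
  let ?I = "{J \<in> Pow (h ` W). R J}"
  have fin: "finite ?I" using h(2) by auto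
  have finJ: "finite J" if "J \<in> ?I" for J using that h(2) by (auto intro: finite_subset)
  have eq: "{\<omega>\<in>space M. R (h ` X \<omega>)} = (\<Union>J\<in>?I. {\<omega>\<in>space M. h ` X \<omega> = J})"
  proof -
    have "h ` X \<omega> \<in> Pow (h ` W)" if "\<omega> \<in> space M" for \<omega>
      using void_lawD(3)[OF X that] by auto
    then show ?thesis by blast
  qed
  show "{\<omega>\<in>space M. R (h ` X \<omega>)} \<in> sets M"
    unfolding eq by (intro sets.finite_UN fin void_law_image_eq_sets[OF X W h] finJ)
  show "measure M {\<omega>\<in>space M. R (h ` X \<omega>)} = (\<Sum>J | J \<in> Pow (h ` W) \<and> R J. measure M {\<omega>\<in>space M. h ` X \<omega> = J})"
    unfolding eq
  proof (rule finite_measure_finite_Union[OF fin])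
    show "(\<lambda>J. {\<omega>\<in>space M. h ` X \<omega> = J}) ` ?I \<subseteq> sets M"
      using void_law_image_eq_sets[OF X W h finJ] by blast
    show "disjoint_family_on (\<lambda>J. {\<omega>\<in>space M. h ` X \<omega> = J}) ?I"
      unfolding disjoint_family_on_def by blast
  qed
qed

text \<open>Moebius inversion over the subsets of a finite set, by induction on the cardinality: the
  void probability is the sum of the probabilities of all images \<open>K\<close> contained in
  \<open>J\<close>, and the proper subsets are known already.\<close>

lemma void_law_image_eq_unique:
  fixes h :: "'a::euclidean_space \<Rightarrow> 'b::euclidean_space"
  assumes X: "void_law M X W g" and X': "void_law M' X' W g"
    and W: "W \<in> sets borel" and h: "h \<in> borel_measurable borel" "finite (h ` W)"
  shows "J \<subseteq> h ` W \<Longrightarrow> measure M {\<omega>\<in>space M. h ` X \<omega> = J} = measure M' {\<omega>\<in>space M'. h ` X' \<omega> = J}"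
proof (induction "card J" arbitrary: J rule: less_induct)
  case less
  have fin: "finite J" using less.prems h(2) by (rule finite_subset)
  have sub: "{K. K \<in> Pow (h ` W) \<and> K \<subseteq> J} = insert J {K. K \<subset> J}"
    using less.prems by auto
  have fin': "finite {K. K \<subset> J}" using fin by (auto intro: finite_subset[of _ "Pow J"])
  have "measure M {\<omega>\<in>space M. h ` X \<omega> = J} + (\<Sum>K | K \<subset> J. measure M {\<omega>\<in>space M. h ` X \<omega> = K})
      = g {x\<in>W. h x \<notin> J}"
    using void_law_image_Collect(2)[OF X W h, of "\<lambda>K. K \<subseteq> J"] void_law_image_subset(2)[OF X W h, of J] fin'
    unfolding sub by simp
  moreover have "measure M' {\<omega>\<in>space M'. h ` X' \<omega> = J} + (\<Sum>K | K \<subset> J. measure M' {\<omega>\<in>space M'. h ` X' \<omega> = K})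
      = g {x\<in>W. h x \<notin> J}"
    using void_law_image_Collect(2)[OF X' W h, of "\<lambda>K. K \<subseteq> J"] void_law_image_subset(2)[OF X' W h, of J] fin'
    unfolding sub by simp
  moreover have "(\<Sum>K | K \<subset> J. measure M {\<omega>\<in>space M. h ` X \<omega> = K}) = (\<Sum>K | K \<subset> J. measure M' {\<omega>\<in>space M'. h ` X' \<omega> = K})"
    using less.prems fin by (intro sum.cong refl less.hyps psubset_card_mono) auto
  ultimately show ?case by linarith
qed

section \<open>Rounding configurations to a grid\<close>

definition grid_round :: "nat \<Rightarrow> 'a::euclidean_space \<Rightarrow> 'a" where
  "grid_round k x = (\<Sum>b\<in>Basis. (real_of_int \<lfloor>real (Suc k) * (x \<bullet> b)\<rfloor> / real (Suc k)) *\<^sub>R b)"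

lemma grid_round_measurable [measurable]: "grid_round k \<in> borel_measurable borel"
  unfolding grid_round_def by measurable

lemma finite_grid_round:
  assumes "bounded W"
  shows "finite (grid_round k ` (W :: 'a::euclidean_space set))"
proof -
  obtain C where C: "\<And>x. x \<in> W \<Longrightarrow> norm x \<le> C" using assms by (auto simp: bounded_iff)
  \<comment> \<open>Rounding factors through the integer vector of floors, and on a bounded set
    these vectors lie in a finite box.\<close>
  let ?F = "\<lambda>x. \<lambda>b\<in>Basis. \<lfloor>real (Suc k) * (x \<bullet> b)\<rfloor>"
  let ?m = "\<lfloor>- (real (Suc k) * C)\<rfloor>" and ?n = "\<lfloor>real (Suc k) * C\<rfloor>"
  have "?F ` W \<subseteq> (\<Pi>\<^sub>E b\<in>Basis. {?m..?n})"
  proof safe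
    fix x b assume x: "x \<in> W" and b: "b \<in> (Basis :: 'a set)"
    have "\<bar>x \<bullet> b\<bar> \<le> C" using Basis_le_norm[OF b, of x] C[OF x] by linarith
    then have "real (Suc k) * \<bar>x \<bullet> b\<bar> \<le> real (Suc k) * C" by (rule mult_left_mono) simp
    then have "\<bar>real (Suc k) * (x \<bullet> b)\<bar> \<le> real (Suc k) * C" by (simp only: abs_mult abs_of_nat)
    then have "- (real (Suc k) * C) \<le> real (Suc k) * (x \<bullet> b) \<and> real (Suc k) * (x \<bullet> b) \<le> real (Suc k) * C"
      by linarith
    then show "?F x b \<in> {?m..?n}"
      using b by (auto intro!: floor_mono)
  qed auto
  then have "finite (?F ` W)"
    by (rule finite_subset) (intro finite_PiE finite_Basis finite_atLeastAtMost_int)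
  moreover have "grid_round k ` W = (\<lambda>z. \<Sum>b\<in>Basis. (real_of_int (z b) / real (Suc k)) *\<^sub>R b) ` ?F ` W"
    by (auto simp: grid_round_def image_image intro!: image_cong sum.cong)
  ultimately show ?thesis by simp
qed

lemma dist_grid_round: "dist (grid_round k x) (x :: 'a::euclidean_space) \<le> real DIM('a) / real (Suc k)"
proof -
  have "norm (grid_round k x - x) \<le> (\<Sum>b\<in>Basis. \<bar>(grid_round k x - x) \<bullet> b\<bar>)"
    by (rule norm_le_l1)
  also have "\<dots> \<le> (\<Sum>b\<in>(Basis::'a set). 1 / real (Suc k))"
  proof (intro sum_mono)
    fix b :: 'a assume b: "b \<in> Basis"
    let ?y = "real (Suc k) * (x \<bullet> b)"
    have "(grid_round k x - x) \<bullet> b = (real_of_int \<lfloor>?y\<rfloor> - ?y) / real (Suc k)"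
      using b by (simp add: grid_round_def inner_diff_left diff_divide_distrib del: of_nat_Suc)
    moreover have "\<bar>real_of_int \<lfloor>?y\<rfloor> - ?y\<bar> \<le> 1" by linarith
    ultimately show "\<bar>(grid_round k x - x) \<bullet> b\<bar> \<le> 1 / real (Suc k)"
      by (simp add: abs_divide divide_right_mono del: of_nat_Suc)
  qed
  also have "\<dots> = real DIM('a) / real (Suc k)" by simp
  finally show ?thesis by (simp add: dist_norm)
qed

text \<open>The slack in the distance bounds the rounding error of both points, so pairs at distance exactly 1 count as
  close on every grid.\<close>

definition grid_close :: "nat \<Rightarrow> 'a::euclidean_space set \<Rightarrow> bool" where
  "grid_close k J \<longleftrightarrow> (\<exists>u\<in>J. \<exists>w\<in>J. u \<noteq> w \<and> dist u w \<le> 1 + 2 * (real DIM('a) / real (Suc k)))"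

text \<open>A finite configuration has a least positive gap, and a least excess over 1 among the
  distances above 1. Once the mesh is small against both, rounding neither merges points nor
  misjudges a pair.\<close>

lemma eventually_grid_close:
  fixes S W :: "'a::euclidean_space set"
  assumes "finite S" "S \<subseteq> W"
  shows "\<forall>\<^sub>F k in sequentially. grid_close k (grid_round k ` S) \<longleftrightarrow> S \<notin> hard_sphere W"
proof -
  define e where "e k = real DIM('a) / real (Suc k)" for k
  have e0: "e \<longlonglongrightarrow> 0"
    unfolding e_def by (rule LIMSEQ_Suc) (rule lim_const_over_n)
  have le: "dist (grid_round k x) (grid_round k y) \<le> dist x y + 2 * e k" for k and x y :: 'a
    using dist_triangle[of "grid_round k x" "grid_round k y" x] dist_triangle[of x "grid_round k y" y]
      dist_grid_round[of k x] dist_grid_round[of k y] by (simp add: e_def dist_commute)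
  have ge: "dist x y \<le> dist (grid_round k x) (grid_round k y) + 2 * e k" for k and x y :: 'a
    using dist_triangle[of x y "grid_round k x"] dist_triangle[of "grid_round k x" y "grid_round k y"]
      dist_grid_round[of k x] dist_grid_round[of k y] by (simp add: e_def dist_commute)
  have conv: "\<forall>\<^sub>F k in sequentially. e k < c" if "c > 0" for c
    using order_tendstoD(2)[OF e0 that] .
  \<comment> \<open>Rounding changes a distance by at most \<open>2 * e k\<close>. Hence the first
    condition keeps distinct points distinct; in the second, this error and the slack
    \<open>2 * e k\<close> in \<open>grid_close\<close> add up to \<open>4 * e k\<close>.\<close>
  have ev: "\<forall>\<^sub>F k in sequentially. \<forall>x\<in>S. \<forall>y\<in>S. x \<noteq> y \<longrightarrow>
      2 * e k < dist x y \<and> (1 < dist x y \<longrightarrow> 4 * e k < dist x y - 1)"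
  proof (intro eventually_ball_finite assms(1) ballI)
    fix x y
    show "\<forall>\<^sub>F k in sequentially. x \<noteq> y \<longrightarrow> 2 * e k < dist x y \<and> (1 < dist x y \<longrightarrow> 4 * e k < dist x y - 1)"
    proof (cases "x = y")
      case False
      then have "\<forall>\<^sub>F k in sequentially. e k < dist x y / 2" by (intro conv) simp
      moreover have "\<forall>\<^sub>F k in sequentially. 1 < dist x y \<longrightarrow> e k < (dist x y - 1) / 4"
        using conv[of "(dist x y - 1) / 4"] by (cases "1 < dist x y") (auto elim: eventually_mono)
      ultimately show ?thesis
        by eventually_elim auto
    qed simp
  qed
  then show ?thesis
  proof eventually_elim
    case (elim k)
    show ?case
    proof
      assume "grid_close k (grid_round k ` S)"
      then obtain x y where xy: "x \<in> S" "y \<in> S" "grid_round k x \<noteq> grid_round k y"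
        "dist (grid_round k x) (grid_round k y) \<le> 1 + 2 * e k"
        by (auto simp: grid_close_def e_def)
      then have "x \<noteq> y" by auto
      have "dist x y \<le> 1 + 4 * e k" using ge[of x y k] xy(4) by linarith
      then have "\<not> 1 < dist x y" using elim xy(1,2) \<open>x \<noteq> y\<close> by force
      then show "S \<notin> hard_sphere W" using xy(1,2) \<open>x \<noteq> y\<close> by (auto simp: hard_sphere_def)
    next
      assume "S \<notin> hard_sphere W"
      then obtain x y where xy: "x \<in> S" "y \<in> S" "x \<noteq> y" "dist x y \<le> 1"
        using assms by (auto simp: hard_sphere_def not_less)
      then have "2 * e k < dist x y" using elim by auto
      then have "grid_round k x \<noteq> grid_round k y" using ge[of x y k] by auto
      moreover have "dist (grid_round k x) (grid_round k y) \<le> 1 + 2 * e k" using le[of k x y] xy(4) by linarith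
      ultimately show "grid_close k (grid_round k ` S)"
        using xy(1,2) by (auto simp: grid_close_def e_def)
    qed
  qed
qed

text \<open>The indicators of the grid events converge pointwise to that of the hard-sphere event.
  This yields the measurability of the latter and, by dominated convergence, its
  probability.\<close>

lemma void_law_hard_sphere_LIMSEQ:
  assumes X: "void_law M X W g" and W: "W \<in> sets borel" "bounded W"
  shows "{\<omega>\<in>space M. X \<omega> \<in> hard_sphere W} \<in> sets M"
    and "(\<lambda>k. measure M {\<omega>\<in>space M. \<not> grid_close k (grid_round k ` X \<omega>)})
      \<longlonglongrightarrow> measure M {\<omega>\<in>space M. X \<omega> \<in> hard_sphere W}"
proof -
  interpret prob_space M by (rule void_lawD(1)[OF X])
  define s :: "nat \<Rightarrow> _ \<Rightarrow> real" where "s k = indicator {\<omega>\<in>space M. \<not> grid_close k (grid_round k ` X \<omega>)}" for k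
  define f :: "_ \<Rightarrow> real" where "f = indicator {\<omega>\<in>space M. X \<omega> \<in> hard_sphere W}"
  have E: "{\<omega>\<in>space M. \<not> grid_close k (grid_round k ` X \<omega>)} \<in> sets M" for k
    by (rule void_law_image_Collect(1)[OF X W(1) _ finite_grid_round[OF W(2)]]) measurable
  then have s: "s k \<in> borel_measurable M" for k by (simp add: s_def)
  have lim: "(\<lambda>k. s k \<omega>) \<longlonglongrightarrow> f \<omega>" if "\<omega> \<in> space M" for \<omega>
    by (rule tendsto_eventually)
      (use eventually_grid_close[OF void_lawD(2,3)[OF X that]] that in
        \<open>auto elim!: eventually_mono simp: s_def f_def split: split_indicator\<close>)
  then have f: "f \<in> borel_measurable M"
    by (rule borel_measurable_LIMSEQ_real[OF _ s])
  then have "f -` {1} \<inter> space M \<in> sets M" by (rule measurable_sets) simp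
  also have "f -` {1} \<inter> space M = {\<omega>\<in>space M. X \<omega> \<in> hard_sphere W}"
    by (auto simp: f_def split: split_indicator_asm)
  finally show H: "{\<omega>\<in>space M. X \<omega> \<in> hard_sphere W} \<in> sets M" .
  have "(\<lambda>k. integral\<^sup>L M (s k)) \<longlonglongrightarrow> integral\<^sup>L M f"
    by (rule integral_dominated_convergence[where w="\<lambda>_. 1"])
      (use f s lim in \<open>auto simp: s_def split: split_indicator\<close>)
  then show "(\<lambda>k. measure M {\<omega>\<in>space M. \<not> grid_close k (grid_round k ` X \<omega>)})
      \<longlonglongrightarrow> measure M {\<omega>\<in>space M. X \<omega> \<in> hard_sphere W}"
    using H E by (simp add: s_def f_def)
qed

lemma void_law_hard_sphere_unique:
  assumes X: "void_law M X W g" and X': "void_law M' X' W g" and W: "W \<in> sets borel" "bounded W"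
  shows "measure M {\<omega>\<in>space M. X \<omega> \<in> hard_sphere W} = measure M' {\<omega>\<in>space M'. X' \<omega> \<in> hard_sphere W}"
proof (rule LIMSEQ_unique)
  show "(\<lambda>k. measure M {\<omega>\<in>space M. \<not> grid_close k (grid_round k ` X \<omega>)})
      \<longlonglongrightarrow> measure M {\<omega>\<in>space M. X \<omega> \<in> hard_sphere W}"
    by (rule void_law_hard_sphere_LIMSEQ[OF X W])
  have "measure M {\<omega>\<in>space M. \<not> grid_close k (grid_round k ` X \<omega>)} =
      measure M' {\<omega>\<in>space M'. \<not> grid_close k (grid_round k ` X' \<omega>)}" for k
    using void_law_image_eq_unique[OF X X' W(1) grid_round_measurable finite_grid_round[OF W(2)]]
    unfolding void_law_image_Collect(2)[OF X W(1) grid_round_measurable finite_grid_round[OF W(2)], of "\<lambda>J. \<not> grid_close k J" k]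
      void_law_image_Collect(2)[OF X' W(1) grid_round_measurable finite_grid_round[OF W(2)], of "\<lambda>J. \<not> grid_close k J" k]
    by (intro sum.cong) auto
  then show "(\<lambda>k. measure M {\<omega>\<in>space M. \<not> grid_close k (grid_round k ` X \<omega>)})
      \<longlonglongrightarrow> measure M' {\<omega>\<in>space M'. X' \<omega> \<in> hard_sphere W}"
    using void_law_hard_sphere_LIMSEQ(2)[OF X' W] by simp
qed

section \<open>Equal void probabilities of the Poisson process and of Poisson many uniform
  points\<close>

lemma void_law_poisson_process:
  assumes "poisson_process M X W \<kappa>"
  shows "void_law M X W (\<lambda>B. exp (- (\<kappa> * measure lborel B)))"
proof -
  have P: "prob_space M" and X: "\<And>\<omega>. \<omega> \<in> space M \<Longrightarrow> finite (X \<omega>) \<and> X \<omega> \<subseteq> W"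
    and cnt: "\<And>B. B \<in> sets borel \<Longrightarrow> B \<subseteq> W \<Longrightarrow> (\<lambda>\<omega>. card (X \<omega> \<inter> B)) \<in> measurable M (count_space UNIV)"
    "\<And>B k. B \<in> sets borel \<Longrightarrow> B \<subseteq> W \<Longrightarrow> measure M {\<omega>\<in>space M. card (X \<omega> \<inter> B) = k} =
               exp (- (\<kappa> * measure lborel B)) * (\<kappa> * measure lborel B) ^ k / fact k"
    using assms unfolding poisson_process_def by simp_all
  show ?thesis
    unfolding void_law_def
  proof (intro conjI ballI allI impI P; (elim conjE)?)
    fix B :: "'b set" assume B: "B \<in> sets borel" "B \<subseteq> W"
    have eq: "{\<omega>\<in>space M. X \<omega> \<inter> B = {}} = {\<omega>\<in>space M. card (X \<omega> \<inter> B) = 0}"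
      using X by (auto simp: card_eq_0_iff)
    show "{\<omega>\<in>space M. X \<omega> \<inter> B = {}} \<in> sets M"
      unfolding eq using cnt(1)[OF B] by measurable
    show "measure M {\<omega>\<in>space M. X \<omega> \<inter> B = {}} = exp (- (\<kappa> * measure lborel B))"
      unfolding eq cnt(2)[OF B] by simp
  qed (use X in auto)
qed

text \<open>Under \<open>iid_law W\<close> the points lie in \<open>W\<close> only almost surely, but \<open>void_law\<close> asks for it
  everywhere: hence the intersection with \<open>W\<close>.\<close>

definition mixed_process :: "'a::euclidean_space set \<Rightarrow> nat \<times> (nat \<Rightarrow> 'a) \<Rightarrow> 'a set" where
  "mixed_process W = (\<lambda>(n, x). x ` {..<n} \<inter> W)"

definition mixed_law :: "'a::euclidean_space set \<Rightarrow> real \<Rightarrow> (nat \<times> (nat \<Rightarrow> 'a)) measure" where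
  "mixed_law W \<beta> = measure_pmf (poisson_pmf \<beta>) \<Otimes>\<^sub>M iid_law W"

lemma
  assumes \<beta>: "0 < \<beta>" and P: "prob_space (iid_law W)"
    and Q: "\<And>n. {x \<in> space (iid_law W). Q n x} \<in> sets (iid_law W)"
  shows mixed_law_sets: "{p \<in> space (mixed_law W \<beta>). Q (fst p) (snd p)} \<in> sets (mixed_law W \<beta>)"
    and emeasure_mixed_law: "emeasure (mixed_law W \<beta>) {p \<in> space (mixed_law W \<beta>). Q (fst p) (snd p)} =
      (\<Sum>n. ennreal (poisson_weight \<beta> n) * emeasure (iid_law W) {x \<in> space (iid_law W). Q n x})"
proof -
  interpret prob_space "iid_law W" by fact
  have s: "sets (mixed_law W \<beta>) = sets (count_space UNIV \<Otimes>\<^sub>M iid_law W)"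
    unfolding mixed_law_def by (intro sets_pair_measure_cong) auto
  have "Measurable.pred (count_space UNIV \<Otimes>\<^sub>M iid_law W) (\<lambda>p. Q (fst p) (snd p))"
    by (rule measurable_pair_measure_countable1) (use Q in \<open>auto simp: pred_def\<close>)
  then show *: "{p \<in> space (mixed_law W \<beta>). Q (fst p) (snd p)} \<in> sets (mixed_law W \<beta>)"
    unfolding s sets_eq_imp_space_eq[OF s] by (simp add: pred_def)
  have "Pair n -` {p \<in> space (mixed_law W \<beta>). Q (fst p) (snd p)} = {x \<in> space (iid_law W). Q n x}" for n
    by (auto simp: mixed_law_def space_pair_measure)
  then show "emeasure (mixed_law W \<beta>) {p \<in> space (mixed_law W \<beta>). Q (fst p) (snd p)} =
      (\<Sum>n. ennreal (poisson_weight \<beta> n) * emeasure (iid_law W) {x \<in> space (iid_law W). Q n x})"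
    using *[unfolded mixed_law_def] unfolding mixed_law_def
    by (simp add: emeasure_pair_measure_alt nn_integral_measure_pmf nn_integral_count_space_nat
        pmf_poisson[OF \<beta>] poisson_weight_def mult_ac)
qed

text \<open>Given \<open>n\<close> points, the region \<open>B\<close> is void with probability
  \<open>?t ^ n\<close>, where \<open>?t\<close> is the volume fraction outside \<open>B\<close>;
  averaging over the Poisson number evaluates the generating function at \<open>?t\<close>.\<close>

lemma void_law_mixed:
  fixes W :: "'a::euclidean_space set"
  assumes W: "W \<in> sets borel" "emeasure lborel W \<noteq> 0" "emeasure lborel W \<noteq> \<infinity>" and \<beta>: "0 < \<beta>"
  shows "void_law (mixed_law W \<beta>) (mixed_process W) W (\<lambda>B. exp (- (\<beta> / measure lborel W * measure lborel B)))"
  unfolding void_law_def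
proof (intro conjI ballI allI impI; (elim conjE)?)
  let ?U = "uniform_measure lborel W"
  interpret S: sequential_sampling W "iid_law W" "\<lambda>_ _. ?U"
    by (rule sequential_sampling_iid[OF W])
  have U: "prob_space ?U" using W by (intro prob_space_uniform_measure) auto
  interpret U: prob_space ?U by fact
  interpret PP: product_prob_space "\<lambda>_::nat. ?U" UNIV ..
  interpret N: prob_space "measure_pmf (poisson_pmf \<beta>)" by (rule prob_space_measure_pmf)
  interpret pair_prob_space "measure_pmf (poisson_pmf \<beta>)" "iid_law W" ..
  show "prob_space (mixed_law W \<beta>)"
    unfolding mixed_law_def by unfold_locales
  fix B :: "'a set" assume B: "B \<in> sets borel" "B \<subseteq> W"
  let ?t = "1 - measure lborel B / measure lborel W"
  have eqn: "{x \<in> space (iid_law W). x ` {..<n} \<inter> W \<inter> B = {}} = {x \<in> space (iid_law W). \<forall>i\<in>{..<n}. x i \<in> - B}" for n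
    using B by auto
  have m: "measure lborel B \<le> measure lborel W"
    using B W by (intro measure_mono_fmeasurable S.W_fmeasurable) auto
  have "emeasure ?U (- B) = emeasure lborel (W - B) / emeasure lborel W"
    using B W by (simp add: Diff_eq)
  also have "emeasure lborel (W - B) = ennreal (measure lborel W - measure lborel B)"
  proof -
    have "measure lborel (W - B) = measure lborel W - measure lborel B"
      using B W by (intro measure_Diff) auto
    moreover have "emeasure lborel (W - B) \<noteq> top"
      using emeasure_mono[of "W - B" W lborel] W by (auto simp: top_unique)
    ultimately show ?thesis by (simp add: emeasure_eq_ennreal_measure)
  qed
  also have "\<dots> / emeasure lborel W = ennreal ((measure lborel W - measure lborel B) / measure lborel W)"
    unfolding S.emeasure_W using m S.measure_W_pos by (intro divide_ennreal) auto
  finally have Ut: "emeasure ?U (- B) = ennreal ?t"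
    using S.measure_W_pos by (simp add: diff_divide_distrib)
  have t0: "0 \<le> ?t" using m S.measure_W_pos by simp
  have sets_n: "{x \<in> space (iid_law W). x ` {..<n} \<inter> W \<inter> B = {}} \<in> sets (iid_law W)" for n
    unfolding eqn using B by measurable
  have em: "emeasure (iid_law W) {x \<in> space (iid_law W). x ` {..<n} \<inter> W \<inter> B = {}} = ennreal (?t ^ n)" for n
    unfolding eqn unfolding iid_law_def
    by (subst PP.emeasure_PiM_Collect) (use B Ut t0 in \<open>auto simp: ennreal_power\<close>)
  have eq: "{\<omega> \<in> space (mixed_law W \<beta>). mixed_process W \<omega> \<inter> B = {}} =
      {p \<in> space (mixed_law W \<beta>). (\<lambda>n x. x ` {..<n} \<inter> W \<inter> B = {}) (fst p) (snd p)}"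
    by (auto simp: mixed_process_def split_beta)
  show "{\<omega> \<in> space (mixed_law W \<beta>). mixed_process W \<omega> \<inter> B = {}} \<in> sets (mixed_law W \<beta>)"
    unfolding eq by (rule mixed_law_sets[OF \<beta> S.prob_M, where Q="\<lambda>n x. x ` {..<n} \<inter> W \<inter> B = {}", OF sets_n])
  have "emeasure (mixed_law W \<beta>) {\<omega> \<in> space (mixed_law W \<beta>). mixed_process W \<omega> \<inter> B = {}} =
      (\<Sum>n. ennreal (poisson_weight \<beta> n * ?t ^ n))"
    unfolding eq emeasure_mixed_law[OF \<beta> S.prob_M, where Q="\<lambda>n x. x ` {..<n} \<inter> W \<inter> B = {}", OF sets_n] em
    using \<beta> t0 by (simp add: ennreal_mult poisson_weight_nonneg)
  also have "\<dots> = ennreal (exp (\<beta> * (?t - 1)))"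
    by (rule suminf_ennreal_eq[OF _ poisson_weight_power_sums])
      (use \<beta> t0 in \<open>simp add: poisson_weight_nonneg\<close>)
  finally show "measure (mixed_law W \<beta>) {\<omega> \<in> space (mixed_law W \<beta>). mixed_process W \<omega> \<inter> B = {}} =
      exp (- (\<beta> / measure lborel W * measure lborel B))"
    by (simp add: measure_def)
qed (auto simp: mixed_process_def)

section \<open>Poisson-weighted sums of sequences in the unit interval, and Poisson tails\<close>

lemma estimator_summable:
  assumes "0 \<le> \<beta>" "\<And>n. 0 \<le> c n" "\<And>n. c n \<le> (1::real)"
  shows "summable (\<lambda>n. poisson_weight \<beta> n * c n)"
proof (rule summable_comparison_test')
  show "summable (poisson_weight \<beta>)" using poisson_weight_sums by (rule sums_summable)
  show "norm (poisson_weight \<beta> n * c n) \<le> poisson_weight \<beta> n" if "0 \<le> n" for n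
    using assms poisson_weight_nonneg[of \<beta> n] by (simp add: abs_mult mult_left_le)
qed

lemma estimator_nonneg:
  assumes "0 \<le> \<beta>" "\<And>n. 0 \<le> c n" "\<And>n. c n \<le> (1::real)"
  shows "0 \<le> (\<Sum>n. poisson_weight \<beta> n * c n)"
  using assms by (intro suminf_nonneg estimator_summable mult_nonneg_nonneg poisson_weight_nonneg)

lemma estimator_le_1:
  assumes "0 \<le> \<beta>" "\<And>n. 0 \<le> c n" "\<And>n. c n \<le> (1::real)"
  shows "(\<Sum>n. poisson_weight \<beta> n * c n) \<le> 1"
proof -
  have "(\<Sum>n. poisson_weight \<beta> n * c n) \<le> (\<Sum>n. poisson_weight \<beta> n)"
    using assms sums_summable[OF poisson_weight_sums]
    by (intro suminf_le estimator_summable) (auto intro!: mult_left_le poisson_weight_nonneg)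
  then show ?thesis using sums_unique[OF poisson_weight_sums, of \<beta>] by simp
qed

text \<open>Both estimators are Poisson averages of a nonincreasing sequence \<open>c\<close>.
  Cutting at a single index \<open>N\<close> gives this bound and its companion
  \<open>estimator_le\<close>: terms below \<open>N\<close> are at least \<open>c N\<close>, terms
  from \<open>N\<close> on at most \<open>c N\<close>.\<close>

lemma estimator_ge:
  assumes "0 \<le> \<beta>" "\<And>n. 0 \<le> c n" "\<And>n. c n \<le> (1::real)" and dec: "\<And>m n. m \<le> n \<Longrightarrow> c n \<le> c m"
  shows "(\<Sum>n<N. poisson_weight \<beta> n) * c N \<le> (\<Sum>n. poisson_weight \<beta> n * c n)"
proof -
  have "(\<Sum>n<N. poisson_weight \<beta> n) * c N \<le> (\<Sum>n<N. poisson_weight \<beta> n * c n)"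
    unfolding sum_distrib_right using assms by (intro sum_mono mult_left_mono poisson_weight_nonneg dec) auto
  also have "\<dots> \<le> (\<Sum>n. poisson_weight \<beta> n * c n)"
    using assms by (intro sum_le_suminf estimator_summable) (auto intro!: mult_nonneg_nonneg poisson_weight_nonneg)
  finally show ?thesis .
qed

lemma estimator_le:
  assumes "0 \<le> \<beta>" "\<And>n. 0 \<le> c n" "\<And>n. c n \<le> (1::real)" and dec: "\<And>m n. m \<le> n \<Longrightarrow> c n \<le> c m"
  shows "(\<Sum>n. poisson_weight \<beta> n * c n) \<le> (\<Sum>n<N. poisson_weight \<beta> n) + c N"
proof -
  let ?d = "\<lambda>n. if n < N then 1 else 0 :: real"
  have s: "summable (\<lambda>n. poisson_weight \<beta> n * ?d n)"
    using assms(1) by (intro estimator_summable) auto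
  have "(\<Sum>n. poisson_weight \<beta> n * c n) \<le> (\<Sum>n. poisson_weight \<beta> n * ?d n + poisson_weight \<beta> n * c N)"
  proof (rule suminf_le)
    fix n
    have "c n \<le> ?d n + c N" using assms(2)[of N] assms(3)[of n] dec[of N n] by auto
    then show "poisson_weight \<beta> n * c n \<le> poisson_weight \<beta> n * ?d n + poisson_weight \<beta> n * c N"
      using poisson_weight_nonneg[OF assms(1), of n] by (metis distrib_left mult_left_mono)
  qed (use assms s sums_summable[OF poisson_weight_sums] in \<open>auto intro!: estimator_summable summable_add summable_mult2\<close>)
  also have "\<dots> = (\<Sum>n. poisson_weight \<beta> n * ?d n) + (\<Sum>n. poisson_weight \<beta> n * c N)"
    by (intro suminf_add[symmetric] s summable_mult2 sums_summable[OF poisson_weight_sums])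
  also have "(\<Sum>n. poisson_weight \<beta> n * ?d n) = (\<Sum>n<N. poisson_weight \<beta> n * ?d n)"
    by (rule suminf_finite) auto
  also have "\<dots> = (\<Sum>n<N. poisson_weight \<beta> n)" by simp
  also have "(\<Sum>n. poisson_weight \<beta> n * c N) = c N"
    using sums_unique[OF sums_mult2[OF poisson_weight_sums, of \<beta> "c N"]] by simp
  finally show ?thesis .
qed

text \<open>The Chernoff bound is \<open>estimator_ge\<close> for the nonincreasing sequence
  \<open>t ^ n\<close>.\<close>

lemma poisson_lower_tail:
  assumes "0 < t" "t \<le> 1" "0 \<le> \<beta>"
  shows "(\<Sum>n<N. poisson_weight \<beta> n) \<le> exp (\<beta> * (t - 1)) / t ^ N"
proof -
  have "(\<Sum>n<N. poisson_weight \<beta> n) * t ^ N \<le> (\<Sum>n. poisson_weight \<beta> n * t ^ n)"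
    using assms by (intro estimator_ge) (auto intro: power_le_one power_decreasing)
  also have "\<dots> = exp (\<beta> * (t - 1))"
    using sums_unique[OF poisson_weight_power_sums] by simp
  finally show ?thesis using assms by (simp add: field_simps)
qed

text \<open>For \<open>t \<ge> 1\<close> the powers increase, so the generating function is compared
  with its own tail, where \<open>t ^ n\<close> is at least \<open>t ^ N\<close>.\<close>

lemma poisson_upper_tail:
  assumes "1 \<le> t" "0 \<le> \<beta>"
  shows "1 - exp (\<beta> * (t - 1)) / t ^ N \<le> (\<Sum>n<N. poisson_weight \<beta> n)"
proof -
  have "t ^ N * (\<Sum>n. poisson_weight \<beta> (n + N)) = (\<Sum>n. t ^ N * poisson_weight \<beta> (n + N))"
    by (intro suminf_mult[symmetric] summable_ignore_initial_segment sums_summable[OF poisson_weight_sums])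
  also have "\<dots> \<le> (\<Sum>n. poisson_weight \<beta> (n + N) * t ^ (n + N))"
    using assms
    by (intro suminf_le summable_mult summable_ignore_initial_segment[of "\<lambda>n. poisson_weight \<beta> n * t ^ n"]
        summable_ignore_initial_segment sums_summable[OF poisson_weight_power_sums] sums_summable[OF poisson_weight_sums])
      (auto simp: mult.commute[of _ "poisson_weight _ _"] intro!: mult_left_mono poisson_weight_nonneg power_increasing)
  also have "\<dots> \<le> (\<Sum>n. poisson_weight \<beta> n * t ^ n)"
    using suminf_split_initial_segment[OF sums_summable[OF poisson_weight_power_sums], of \<beta> t N] assms
    by (simp add: sum_nonneg poisson_weight_nonneg)
  also have "\<dots> = exp (\<beta> * (t - 1))"
    using sums_unique[OF poisson_weight_power_sums] by simp
  finally have "(\<Sum>n. poisson_weight \<beta> (n + N)) \<le> exp (\<beta> * (t - 1)) / t ^ N"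
    using assms by (simp add: field_simps)
  moreover have "(\<Sum>n. poisson_weight \<beta> n) = (\<Sum>n. poisson_weight \<beta> (n + N)) + (\<Sum>n<N. poisson_weight \<beta> n)"
    by (rule suminf_split_initial_segment[OF sums_summable[OF poisson_weight_sums]])
  ultimately show ?thesis using sums_unique[OF poisson_weight_sums, of \<beta>] by simp
qed

lemma poisson_weight_sum_le_1: "0 \<le> \<beta> \<Longrightarrow> (\<Sum>n<N. poisson_weight \<beta> n) \<le> 1"
  using estimator_ge[of \<beta> "\<lambda>_. 1" N] sums_unique[OF poisson_weight_sums, of \<beta>] by simp

text \<open>Void probabilities allow replacing the Poisson process by a Poisson number of uniform
  points; summing over that number and exchanging sum and integral produces the estimator.\<close>

lemma poisson_hard_sphere_eq_expectation:
  fixes W :: "'a::euclidean_space set"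
  assumes X: "poisson_process M X W \<kappa>"
    and W: "W \<in> sets borel" "bounded W" "emeasure lborel W \<noteq> 0" "emeasure lborel W \<noteq> \<infinity>"
    and \<beta>: "0 < \<beta>" "\<beta> = \<kappa> * measure lborel W"
  shows "measure M {\<omega> \<in> space M. X \<omega> \<in> hard_sphere W} = prob_space.expectation (iid_law W) (cmc_estimator W \<beta>)"
proof -
  interpret S: sequential_sampling W "iid_law W" "\<lambda>_ _. uniform_measure lborel W"
    by (rule sequential_sampling_iid[OF W(1,3,4)])
  have U: "prob_space (uniform_measure lborel W)" using W by (intro prob_space_uniform_measure) auto
  let ?I = "\<lambda>n x. indicator (hard_sphere W) (x ` {..<n}) :: real"
  have "\<kappa> = \<beta> / measure lborel W" using \<beta> S.measure_W_pos by simp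
  then have "measure M {\<omega> \<in> space M. X \<omega> \<in> hard_sphere W} =
      measure (mixed_law W \<beta>) {\<omega> \<in> space (mixed_law W \<beta>). mixed_process W \<omega> \<in> hard_sphere W}"
    using void_law_hard_sphere_unique[OF void_law_poisson_process[OF X] _ W(1,2)] void_law_mixed[OF W(1,3,4) \<beta>(1)]
    by simp
  also have "\<dots> = enn2real (\<integral>\<^sup>+x. ennreal (cmc_estimator W \<beta> x) \<partial>iid_law W)"
  proof -
    \<comment> \<open>\<open>mixed_process\<close> cuts configurations to \<open>W\<close>. Almost
      every sequence stays in \<open>W\<close>, so dropping the cut changes no probability.\<close>
    let ?Q = "\<lambda>n x. x ` {..<n} \<inter> W \<in> hard_sphere W"
    have Qsets: "{x \<in> space (iid_law W). ?Q n x} \<in> sets (iid_law W)" for n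
    proof -
      have *: "?Q n x \<longleftrightarrow> (\<forall>i\<in>{..<n}. \<forall>j\<in>{..<n}. x i \<in> W \<and> x j \<in> W \<and> dist (x i) (x j) \<noteq> 0 \<longrightarrow> 1 < dist (x i) (x j))"
        for x :: "nat \<Rightarrow> 'a" by (auto simp: hard_sphere_def)
      show ?thesis unfolding * by measurable
    qed
    have "AE x in iid_law W. x i \<in> W" for i
      unfolding iid_law_def
      by (rule AE_PiM_component) (use U W in \<open>auto simp: AE_uniform_measureI\<close>)
    then have AEW: "AE x in iid_law W. \<forall>i. x i \<in> W" by (simp add: AE_all_countable)
    have AEQ: "AE x in iid_law W. ?Q n x \<longleftrightarrow> x ` {..<n} \<in> hard_sphere W" for n
      using AEW
    proof eventually_elim
      case (elim x)
      then have "x ` {..<n} \<inter> W = x ` {..<n}" by auto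
      then show ?case by simp
    qed
    have "emeasure (mixed_law W \<beta>) {p \<in> space (mixed_law W \<beta>). ?Q (fst p) (snd p)} =
      (\<Sum>n. ennreal (poisson_weight \<beta> n) * emeasure (iid_law W) {x \<in> space (iid_law W). ?Q n x})"
      by (rule emeasure_mixed_law[OF \<beta>(1) S.prob_M Qsets])
    also have "\<dots> = (\<Sum>n. ennreal (poisson_weight \<beta> n) * (\<integral>\<^sup>+x. indicator (hard_sphere W) (x ` {..<n}) \<partial>iid_law W))"
    proof (intro suminf_cong arg_cong2[where f="(*)"] refl)
      fix n
      have "emeasure (iid_law W) {x \<in> space (iid_law W). ?Q n x} = emeasure (iid_law W) {x \<in> space (iid_law W). x ` {..<n} \<in> hard_sphere W}"
        by (rule emeasure_eq_AE) (use AEQ[of n] Qsets[of n] in auto)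
      then show "emeasure (iid_law W) {x \<in> space (iid_law W). ?Q n x} = (\<integral>\<^sup>+x. indicator (hard_sphere W) (x ` {..<n}) \<partial>iid_law W)"
        by (simp only: S.emeasure_hard_sphere)
    qed
    also have "\<dots> = (\<Sum>n. \<integral>\<^sup>+x. ennreal (poisson_weight \<beta> n) * indicator (hard_sphere W) (x ` {..<n}) \<partial>iid_law W)"
      by (intro suminf_cong nn_integral_cmult[symmetric]) measurable
    also have "\<dots> = (\<integral>\<^sup>+x. (\<Sum>n. ennreal (poisson_weight \<beta> n) * indicator (hard_sphere W) (x ` {..<n})) \<partial>iid_law W)"
      by (rule nn_integral_suminf[symmetric]) measurable
    also have "\<dots> = (\<integral>\<^sup>+x. ennreal (cmc_estimator W \<beta> x) \<partial>iid_law W)"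
    proof (intro nn_integral_cong)
      fix x :: "nat \<Rightarrow> 'a"
      have "(\<Sum>n. ennreal (poisson_weight \<beta> n) * indicator (hard_sphere W) (x ` {..<n})) = (\<Sum>n. ennreal (poisson_weight \<beta> n * ?I n x))"
        by (intro suminf_cong) (auto split: split_indicator)
      also have "\<dots> = ennreal (cmc_estimator W \<beta> x)"
        unfolding cmc_estimator_def
        by (intro suminf_ennreal2 estimator_summable) (use \<beta> in \<open>auto simp: poisson_weight_nonneg\<close>)
      finally show "(\<Sum>n. ennreal (poisson_weight \<beta> n) * indicator (hard_sphere W) (x ` {..<n})) = ennreal (cmc_estimator W \<beta> x)" .
    qed
    finally show ?thesis
      by (simp add: measure_def mixed_process_def split_beta)
  qed
  also have "\<dots> = prob_space.expectation (iid_law W) (cmc_estimator W \<beta>)"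
  proof (rule integral_eq_nn_integral[symmetric])
    show "cmc_estimator W \<beta> \<in> borel_measurable (iid_law W)"
      unfolding cmc_estimator_def by measurable
    show "AE x in iid_law W. 0 \<le> cmc_estimator W \<beta> x"
      unfolding cmc_estimator_def using \<beta> by (intro AE_I2 estimator_nonneg) auto
  qed
  finally show ?thesis .
qed

section \<open>Moment bounds\<close>

context sequential_sampling begin

lemma indicator_hard_sphere_antimono:
  "m \<le> n \<Longrightarrow> indicator (hard_sphere W) (x ` {..<n}) \<le> (indicator (hard_sphere W) (x ` {..<m}) :: real)" for m n :: nat
proof -
  assume "m \<le> n"
  then have "x ` {..<m} \<subseteq> x ` {..<n}" by (intro image_mono) auto
  then show ?thesis
    using hard_sphere_antimono[of "x ` {..<n}" W "x ` {..<m}"] by (auto split: split_indicator)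
qed

lemma measurable_estimators [measurable]:
  "cmc_estimator W \<beta> \<in> borel_measurable seq_space"
  "blocking_estimator W \<beta> \<in> borel_measurable seq_space"
  unfolding cmc_estimator_def blocking_estimator_def by measurable

lemma blocking_estimator_alt:
  "blocking_estimator W \<beta> x = (\<Sum>n. poisson_weight \<beta> n * (indicator (hard_sphere W) (x ` {..<n}) * weight W x n))"
  by (simp add: blocking_estimator_def mult.assoc)

lemma cmc_estimator_bounds:
  assumes "0 \<le> \<beta>"
  shows "0 \<le> cmc_estimator W \<beta> x" "cmc_estimator W \<beta> x \<le> 1"
    "(\<Sum>n<N. poisson_weight \<beta> n) * indicator (hard_sphere W) (x ` {..<N}) \<le> cmc_estimator W \<beta> x"
    "cmc_estimator W \<beta> x \<le> (\<Sum>n<N. poisson_weight \<beta> n) + indicator (hard_sphere W) (x ` {..<N})"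
  unfolding cmc_estimator_def
  by (intro estimator_nonneg estimator_le_1 estimator_ge estimator_le assms indicator_hard_sphere_antimono;
      simp add: indicator_le_1)+

lemma blocking_estimator_bounds:
  assumes "0 \<le> \<beta>"
  shows "0 \<le> blocking_estimator W \<beta> x" "blocking_estimator W \<beta> x \<le> 1"
    "(\<Sum>n<N. poisson_weight \<beta> n) * (indicator (hard_sphere W) (x ` {..<N}) * weight W x N) \<le> blocking_estimator W \<beta> x"
    "blocking_estimator W \<beta> x \<le> (\<Sum>n<N. poisson_weight \<beta> n) + weight W x N"
proof -
  let ?c = "\<lambda>n. indicator (hard_sphere W) (x ` {..<n}) * weight W x n :: real"
  have c: "0 \<le> ?c n" "?c n \<le> 1" "?c n \<le> weight W x n" for n
    using weight_nonneg[of x n] weight_le_1[of x n] by (auto split: split_indicator)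
  have dec: "?c n \<le> ?c m" if "m \<le> n" for m n
    using that by (intro mult_mono indicator_hard_sphere_antimono weight_antimono weight_nonneg) auto
  show "0 \<le> blocking_estimator W \<beta> x" "blocking_estimator W \<beta> x \<le> 1"
    "(\<Sum>n<N. poisson_weight \<beta> n) * ?c N \<le> blocking_estimator W \<beta> x"
    unfolding blocking_estimator_alt
    by (intro estimator_nonneg estimator_le_1 estimator_ge assms c dec; assumption)+
  have "blocking_estimator W \<beta> x \<le> (\<Sum>n<N. poisson_weight \<beta> n) + ?c N"
    unfolding blocking_estimator_alt by (intro estimator_le assms c dec)
  then show "blocking_estimator W \<beta> x \<le> (\<Sum>n<N. poisson_weight \<beta> n) + weight W x N"
    using c(3)[of N] by linarith
qed

lemma integrable_unit_interval:
  assumes "f \<in> borel_measurable seq_space" "\<And>x. 0 \<le> f x" "\<And>x. f x \<le> (1::real)"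
  shows "integrable M f" "integrable M (\<lambda>x. (f x)\<^sup>2)"
proof -
  have m [measurable]: "f \<in> borel_measurable M"
    using assms(1) by (simp add: measurable_cong_sets[OF sets_M refl])
  show "integrable M f"
    by (rule integrable_const_bound[where B=1]) (use assms in auto)
  show "integrable M (\<lambda>x. (f x)\<^sup>2)"
    by (rule integrable_const_bound[where B=1]) (use assms in \<open>auto simp: power_le_one\<close>)
qed

lemma variance_unit_interval:
  assumes "f \<in> borel_measurable seq_space" "\<And>x. 0 \<le> f x" "\<And>x. f x \<le> (1::real)"
  shows "variance f = expectation (\<lambda>x. (f x)\<^sup>2) - (expectation f)\<^sup>2"
    and "expectation (\<lambda>x. (f x)\<^sup>2) \<le> expectation f"
    and "(expectation f)\<^sup>2 \<le> expectation (\<lambda>x. (f x)\<^sup>2)"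
    and "0 \<le> expectation f" and "variance f \<le> expectation (\<lambda>x. (f x)\<^sup>2)"
    and "0 \<le> variance f"
proof -
  note i = integrable_unit_interval[OF assms]
  show var: "variance f = expectation (\<lambda>x. (f x)\<^sup>2) - (expectation f)\<^sup>2"
    by (rule variance_eq[OF i])
  show "0 \<le> variance f" by (rule variance_positive)
  then show "(expectation f)\<^sup>2 \<le> expectation (\<lambda>x. (f x)\<^sup>2)"
    unfolding var by simp
  show "expectation (\<lambda>x. (f x)\<^sup>2) \<le> expectation f"
    by (intro integral_mono i) (simp add: power2_eq_square mult_left_le assms)
  show "0 \<le> expectation f" using assms(2) by (rule Bochner_Integration.integral_nonneg)
  show "variance f \<le> expectation (\<lambda>x. (f x)\<^sup>2)" unfolding var by simp
qed

lemmas cmc_moments = variance_unit_interval[OF measurable_estimators(1) cmc_estimator_bounds(1,2)]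
lemmas blocking_moments = variance_unit_interval[OF measurable_estimators(2) blocking_estimator_bounds(1,2)]

text \<open>If the first \<open>N\<close> points are hard-sphere, so is every shorter prefix, and
  the estimator is at least the Poisson mass below \<open>N\<close>. Squaring affects this mass but
  not the probability of the event, which is what ruins the relative error.\<close>

lemma cmc_second_moment_ge:
  assumes K: "\<And>n x. K n x = uniform_measure lborel W"
    and N: "real N * unit_ball_vol (real DIM('a)) \<le> measure lborel W" and \<beta>: "0 \<le> \<beta>"
  shows "(\<Sum>n<N. poisson_weight \<beta> n)\<^sup>2 * (\<Prod>i<N. 1 - real i * unit_ball_vol (real DIM('a)) / measure lborel W)
    \<le> expectation (\<lambda>x. (cmc_estimator W \<beta> x)\<^sup>2)"
proof -
  let ?T = "\<Sum>n<N. poisson_weight \<beta> n" and ?E = "{x \<in> space M. x ` {..<N} \<in> hard_sphere W}"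
  have T: "0 \<le> ?T" using \<beta> by (intro sum_nonneg poisson_weight_nonneg)
  have E: "?E \<in> sets M" by measurable
  have "?T\<^sup>2 * (\<Prod>i<N. 1 - real i * unit_ball_vol (real DIM('a)) / measure lborel W) \<le> ?T\<^sup>2 * prob ?E"
    by (intro mult_left_mono prob_hard_sphere_ge[OF K N]) simp
  also have "\<dots> = expectation (\<lambda>x. ?T\<^sup>2 * indicator ?E x)"
    using E by simp
  also have "\<dots> \<le> expectation (\<lambda>x. (cmc_estimator W \<beta> x)\<^sup>2)"
  proof (rule integral_mono)
    show "integrable M (\<lambda>x. ?T\<^sup>2 * indicator ?E x)"
      using E by (intro integrable_mult_right) (simp add: integrable_indicator_iff emeasure_eq_measure)
    show "integrable M (\<lambda>x. (cmc_estimator W \<beta> x)\<^sup>2)"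
      by (rule integrable_unit_interval[OF measurable_estimators(1) cmc_estimator_bounds(1,2)[OF \<beta>]])
    fix x assume "x \<in> space M"
    show "?T\<^sup>2 * indicator ?E x \<le> (cmc_estimator W \<beta> x)\<^sup>2"
      using cmc_estimator_bounds(3)[OF \<beta>, of N x] T
      by (cases "x \<in> ?E") (auto intro: power_mono)
  qed
  finally show ?thesis .
qed

text \<open>The hard-sphere condition holds almost surely here and the weight has a deterministic
  lower bound, so the bound is pathwise.\<close>

lemma blocking_mean_ge:
  assumes K: "\<And>n x. K n x = sequential_kernel W n x"
    and N: "real N * unit_ball_vol (real DIM('a)) < measure lborel W" and \<beta>: "0 \<le> \<beta>"
  shows "(\<Sum>n<N. poisson_weight \<beta> n) * (\<Prod>i<N. 1 - real i * unit_ball_vol (real DIM('a)) / measure lborel W)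
    \<le> expectation (blocking_estimator W \<beta>)"
proof -
  let ?T = "\<Sum>n<N. poisson_weight \<beta> n" and ?p = "\<Prod>i<N. 1 - real i * unit_ball_vol (real DIM('a)) / measure lborel W"
  have T: "0 \<le> ?T" using \<beta> by (intro sum_nonneg poisson_weight_nonneg)
  have "?T * ?p = expectation (\<lambda>_. ?T * ?p)" by (simp add: prob_space)
  also have "\<dots> \<le> expectation (blocking_estimator W \<beta>)"
  proof (rule integral_mono_AE)
    show "integrable M (blocking_estimator W \<beta>)"
      by (rule integrable_unit_interval[OF measurable_estimators(2) blocking_estimator_bounds(1,2)[OF \<beta>]])
    show "AE x in M. ?T * ?p \<le> blocking_estimator W \<beta> x"
      using AE_hard_sphere[OF K N]
    proof eventually_elim
      case (elim x)
      have "?T * ?p \<le> ?T * weight W x N"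
        using N by (intro mult_left_mono T weight_ge) simp
      with elim show ?case using blocking_estimator_bounds(3)[OF \<beta>, of N x] by simp
    qed
  qed simp
  finally show ?thesis .
qed

context
  fixes U :: "'a set" and r \<epsilon> :: real and N :: nat and \<beta> :: real
  assumes U_ball: "\<And>y. y \<in> U \<Longrightarrow> cball y 1 \<subseteq> W"
    and U_borel [measurable]: "U \<in> sets borel"
    and r: "0 < r" "r \<le> 1"
    and half: "2 * real N * unit_ball_vol (real DIM('a)) \<le> measure lborel W"
    and bad: "2 * (measure lborel (W - U) + real N * (2 ^ DIM('a) * unit_ball_vol (real DIM('a)))) \<le> r * measure lborel W"
    and \<beta>: "0 \<le> \<beta>"
begin

lemma cmc_mean_le:
  assumes K: "\<And>n x. K n x = uniform_measure lborel W"
  shows "expectation (cmc_estimator W \<beta>) \<le> (\<Sum>n<N. poisson_weight \<beta> n) +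
    exp (- (unit_ball_vol (real DIM('a)) / measure lborel W * (real N * (real N - 1) / 2 - \<epsilon> * (real N)\<^sup>2))) + (2 * r powr \<epsilon>) ^ N"
proof -
  let ?T = "\<Sum>n<N. poisson_weight \<beta> n"
  let ?G = "{x \<in> space M. x ` {..<N} \<in> hard_sphere W \<and> real (bad_count U x N) \<le> \<epsilon> * real N}"
  let ?B = "{x \<in> space M. \<epsilon> * real N < real (bad_count U x N)}"
  have G: "?G \<in> sets M" and B: "?B \<in> sets M" by measurable
  have "expectation (cmc_estimator W \<beta>) \<le> expectation (\<lambda>x. ?T + (indicator ?G x + indicator ?B x))"
  proof (rule integral_mono)
    show "integrable M (cmc_estimator W \<beta>)"
      by (rule integrable_unit_interval[OF measurable_estimators(1) cmc_estimator_bounds(1,2)[OF \<beta>]])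
    fix x assume "x \<in> space M"
    then show "cmc_estimator W \<beta> x \<le> ?T + (indicator ?G x + indicator ?B x)"
      using cmc_estimator_bounds(4)[OF \<beta>, of x N] by (auto split: split_indicator split_indicator_asm)
  qed (use G B in \<open>auto simp: emeasure_eq_measure\<close>)
  also have "\<dots> = ?T + (prob ?G + prob ?B)"
    using G B by (simp add: emeasure_eq_measure prob_space)
  finally show ?thesis
    using prob_hard_sphere_good_le[OF U_ball U_borel K, where N=N and \<epsilon>=\<epsilon>]
      bad_count_tail[OF U_borel r bad_prob_le[OF U_ball U_borel _ half bad], where N=N and \<epsilon>=\<epsilon>] K by simp
qed

text \<open>With few bad points the estimator lies below a deterministic value, which is squared as
  a whole; otherwise it is bounded by 1 and only the small probability of many bad points is
  paid.\<close>

lemma blocking_second_moment_le: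
  assumes K: "\<And>n x. K n x = sequential_kernel W n x"
  shows "expectation (\<lambda>x. (blocking_estimator W \<beta> x)\<^sup>2) \<le> ((\<Sum>n<N. poisson_weight \<beta> n) +
    exp (- (unit_ball_vol (real DIM('a)) / measure lborel W * (real N * (real N - 1) / 2 - \<epsilon> * (real N)\<^sup>2))))\<^sup>2 + (2 * r powr \<epsilon>) ^ N"
proof -
  let ?T = "\<Sum>n<N. poisson_weight \<beta> n"
  let ?A = "exp (- (unit_ball_vol (real DIM('a)) / measure lborel W * (real N * (real N - 1) / 2 - \<epsilon> * (real N)\<^sup>2)))"
  let ?B = "{x \<in> space M. \<epsilon> * real N < real (bad_count U x N)}"
  have B: "?B \<in> sets M" by measurable
  have T: "0 \<le> ?T" using \<beta> by (intro sum_nonneg poisson_weight_nonneg)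
  have "expectation (\<lambda>x. (blocking_estimator W \<beta> x)\<^sup>2) \<le> expectation (\<lambda>x. (?T + ?A)\<^sup>2 + indicator ?B x)"
  proof (rule integral_mono)
    show "integrable M (\<lambda>x. (blocking_estimator W \<beta> x)\<^sup>2)"
      by (rule integrable_unit_interval[OF measurable_estimators(2) blocking_estimator_bounds(1,2)[OF \<beta>]])
    fix x assume x: "x \<in> space M"
    show "(blocking_estimator W \<beta> x)\<^sup>2 \<le> (?T + ?A)\<^sup>2 + indicator ?B x"
    proof (cases "x \<in> ?B")
      case True
      have "(blocking_estimator W \<beta> x)\<^sup>2 \<le> 1"
        using blocking_estimator_bounds(1,2)[OF \<beta>, of x] by (intro power_le_one)
      also have "1 \<le> (?T + ?A)\<^sup>2 + (1::real)" by simp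
      finally show ?thesis using True by simp
    next
      case False
      then have "weight W x N \<le> ?A"
        using x by (intro weight_le[OF U_ball U_borel]) auto
      then have "blocking_estimator W \<beta> x \<le> ?T + ?A"
        using blocking_estimator_bounds(4)[OF \<beta>, of x N] by linarith
      then have "(blocking_estimator W \<beta> x)\<^sup>2 \<le> (?T + ?A)\<^sup>2"
        using blocking_estimator_bounds(1)[OF \<beta>, of x] by (intro power_mono)
      with False show ?thesis by simp
    qed
  qed (use B in \<open>auto simp: emeasure_eq_measure\<close>)
  also have "\<dots> = (?T + ?A)\<^sup>2 + prob ?B"
    using B by (simp add: emeasure_eq_measure prob_space)
  finally show ?thesis
    using bad_count_tail[OF U_borel r bad_prob_le[OF U_ball U_borel _ half bad], where N=N and \<epsilon>=\<epsilon>] K by simp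
qed

end

end

section \<open>The window and its boundary layer\<close>

definition inner_window :: "real \<Rightarrow> real \<Rightarrow> (real ^ 'd) set" where
  "inner_window \<delta> \<beta> = cbox (\<chi> i. 1) (\<chi> i. \<beta> powr (\<delta> / real CARD('d)) - 1)"

lemma window_borel: "window \<delta> \<beta> \<in> sets borel" "inner_window \<delta> \<beta> \<in> sets borel"
  by (auto simp: window_def inner_window_def)

lemma bounded_window: "bounded (window \<delta> \<beta>)"
  by (simp add: window_def bounded_cbox)

lemma content_cbox_const:
  fixes c d :: real
  assumes "c \<le> d"
  shows "measure lborel (cbox (\<chi> i. c) (\<chi> i. d) :: (real ^ 'd) set) = (d - c) ^ CARD('d)"
  using assms by (subst content_cbox_cart) (auto simp: interval_ne_empty_cart)

lemma measure_window:
  assumes "0 < \<beta>"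
  shows "measure lborel (window \<delta> \<beta> :: (real ^ 'd) set) = \<beta> powr \<delta>"
proof -
  have "(window \<delta> \<beta> :: (real ^ 'd) set) = cbox (\<chi> i. 0) (\<chi> i. \<beta> powr (\<delta> / real CARD('d)))"
    by (simp add: window_def zero_vec_def)
  then have "measure lborel (window \<delta> \<beta> :: (real ^ 'd) set) = (\<beta> powr (\<delta> / real CARD('d))) ^ CARD('d)"
    by (simp add: content_cbox_const)
  also have "\<dots> = (\<beta> powr (\<delta> / real CARD('d))) powr real CARD('d)"
    using assms by (simp add: powr_realpow)
  finally show ?thesis by (simp add: powr_powr)
qed

lemma emeasure_window:
  assumes "0 < \<beta>"
  shows "emeasure lborel (window \<delta> \<beta> :: (real ^ 'd) set) \<noteq> 0" "emeasure lborel (window \<delta> \<beta> :: (real ^ 'd) set) \<noteq> \<infinity>"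
proof -
  show "emeasure lborel (window \<delta> \<beta> :: (real ^ 'd) set) \<noteq> 0"
    using measure_window[OF assms, where 'd='d, of \<delta>] assms by (auto simp: measure_def)
  show "emeasure lborel (window \<delta> \<beta> :: (real ^ 'd) set) \<noteq> \<infinity>"
    using emeasure_lborel_cbox_finite by (simp add: window_def less_top[symmetric])
qed

lemma cball_inner_window:
  assumes "y \<in> inner_window \<delta> \<beta>"
  shows "cball y 1 \<subseteq> window \<delta> \<beta>"
proof
  fix z assume "z \<in> cball y 1"
  then have "norm (y - z) \<le> 1" by (simp add: dist_norm)
  then have "\<bar>y $ i - z $ i\<bar> \<le> 1" for i
    using component_le_norm_cart[of "y - z" i] by simp
  moreover have "1 \<le> y $ i" "y $ i \<le> \<beta> powr (\<delta> / real CARD('a)) - 1" for i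
    using assms by (auto simp: inner_window_def mem_box_cart)
  ultimately show "z \<in> window \<delta> \<beta>"
    unfolding window_def mem_box_cart by simp (smt (verit))
qed

lemma measure_window_boundary:
  assumes "0 < \<beta>" "2 \<le> \<beta> powr (\<delta> / real CARD('d))"
  shows "measure lborel (window \<delta> \<beta> - inner_window \<delta> \<beta> :: (real ^ 'd) set) =
    \<beta> powr \<delta> * (1 - (1 - 2 / \<beta> powr (\<delta> / real CARD('d))) ^ CARD('d))"
proof -
  let ?l = "\<beta> powr (\<delta> / real CARD('d))"
  have sub: "inner_window \<delta> \<beta> \<subseteq> (window \<delta> \<beta> :: (real ^ 'd) set)"
    using cball_inner_window by fastforce
  have "measure lborel (inner_window \<delta> \<beta> :: (real ^ 'd) set) = (?l - 2) ^ CARD('d)"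
    unfolding inner_window_def using assms by (subst content_cbox_const) (auto simp: algebra_simps)
  moreover have "(?l - 2) ^ CARD('d) = \<beta> powr \<delta> * (1 - 2 / ?l) ^ CARD('d)"
  proof -
    have "?l - 2 = ?l * (1 - 2 / ?l)" using assms by (simp add: field_simps)
    then have "(?l - 2) ^ CARD('d) = ?l ^ CARD('d) * (1 - 2 / ?l) ^ CARD('d)"
      by (simp add: power_mult_distrib)
    also have "?l ^ CARD('d) = \<beta> powr \<delta>"
      using assms by (simp add: powr_realpow[symmetric] powr_powr)
    finally show ?thesis .
  qed
  moreover have "measure lborel (window \<delta> \<beta> - inner_window \<delta> \<beta> :: (real ^ 'd) set) =
      measure lborel (window \<delta> \<beta> :: (real ^ 'd) set) - measure lborel (inner_window \<delta> \<beta> :: (real ^ 'd) set)"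
    by (intro measure_Diff sub) (use emeasure_window[OF assms(1)] window_borel in auto)
  ultimately show ?thesis
    by (simp add: measure_window[OF assms(1)] algebra_simps)
qed

section \<open>Asymptotic rates\<close>

lemma ln_less_minus_one: "0 < x \<Longrightarrow> x \<noteq> 1 \<Longrightarrow> ln x < x - 1" for x :: real
  using ln_le_minus_one[of x] ln_eq_minus_one[of x] by fastforce

text \<open>From \<open>ln (1 - x) \<ge> - x - 2 x^2\<close>: for small \<open>x\<close> the
  inequality \<open>1 - x \<le> exp (- x)\<close> can be reversed at the price of a factor
  \<open>1 + \<eta>\<close> in the exponent.\<close>

lemma exp_le_one_minus:
  fixes x \<eta> :: real
  assumes "0 \<le> x" "x \<le> 1 / 2" "2 * x \<le> \<eta>"
  shows "exp (- ((1 + \<eta>) * x)) \<le> 1 - x"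
proof -
  have "2 * x\<^sup>2 \<le> \<eta> * x"
    using assms mult_right_mono[of "2 * x" \<eta> x] by (simp add: power2_eq_square)
  then have "- ((1 + \<eta>) * x) \<le> - x - 2 * x\<^sup>2" by (simp add: algebra_simps)
  also have "\<dots> \<le> ln (1 - x)" by (rule ln_one_minus_pos_lower_bound[OF assms(1,2)])
  finally have "exp (- ((1 + \<eta>) * x)) \<le> exp (ln (1 - x))" by simp
  then show ?thesis using assms by simp
qed

lemma neg_exponent_small:
  fixes c \<delta> :: real
  assumes "1 < \<delta>" "0 < c"
  shows "\<forall>\<^sub>F \<beta> in at_top. \<beta> powr (1 - \<delta>) < c"
proof -
  have "((\<lambda>\<beta>::real. \<beta> powr (1 - \<delta>)) \<longlongrightarrow> 0) at_top"
    using assms by (intro tendsto_neg_powr filterlim_ident) auto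
  then show ?thesis using assms(2) by (rule order_tendstoD)
qed

lemma powr_2_minus: "0 < \<beta> \<Longrightarrow> \<beta> powr (2 - \<delta>) = \<beta>\<^sup>2 / \<beta> powr \<delta>" for \<beta> \<delta> :: real
  by (simp add: powr_diff powr_numeral)

lemma powr_1_minus: "0 < \<beta> \<Longrightarrow> \<beta> powr (1 - \<delta>) = \<beta> / \<beta> powr \<delta>" for \<beta> \<delta> :: real
  by (simp add: powr_diff)

lemma rate_at_top:
  fixes v \<delta> :: real
  assumes "\<delta> < 2" "0 < v"
  shows "filterlim (\<lambda>\<beta>. v * \<beta> powr (2 - \<delta>) / 2) at_top at_top"
proof -
  have "filterlim (\<lambda>\<beta>::real. \<beta> powr (2 - \<delta>)) at_top at_top"
    using assms by real_asymp
  then have "filterlim (\<lambda>\<beta>. v / 2 * \<beta> powr (2 - \<delta>)) at_top at_top"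
    by (rule filterlim_tendsto_pos_mult_at_top[OF tendsto_const, rotated]) (use assms in simp)
  then show ?thesis by (simp add: field_simps)
qed

lemma lower_rate:
  fixes v \<delta> \<theta> :: real
  assumes \<delta>: "1 < \<delta>" "\<delta> < 2" and v: "0 < v" and \<theta>: "0 < \<theta>"
  shows "\<forall>\<^sub>F \<beta> in at_top. \<exists>N. real N * v < \<beta> powr \<delta> \<and>
    exp (- ((1 + \<theta>) * (v * \<beta> powr (2 - \<delta>) / 2))) \<le>
      (\<Sum>n<N. poisson_weight \<beta> n)\<^sup>2 * (\<Prod>i<N. 1 - real i * v / \<beta> powr \<delta>)"
proof -
  \<comment> \<open>The losses multiply the exponent by
    \<open>(1 + \<epsilon>) * (1 + 2 * \<epsilon>)\<^sup>2\<close>, at most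
    \<open>1 + 17 * \<epsilon>\<close>, hence at most \<open>1 + \<theta> / 2\<close>. The remaining
    \<open>\<theta> / 2\<close> absorbs the constant factor 1/4.\<close>
  define \<epsilon> where "\<epsilon> = min \<theta> 1 / 34"
  have \<epsilon>: "0 < \<epsilon>" "\<epsilon> \<le> 1 / 34" "34 * \<epsilon> \<le> \<theta>" using \<theta> by (auto simp: \<epsilon>_def)
  \<comment> \<open>The Chernoff exponent of exceeding \<open>(1 + \<epsilon>) * \<beta>\<close>,
    for the parameter \<open>t = 1 + \<epsilon>\<close>; its positivity is the strict form of
    \<open>ln x \<le> x - 1\<close>.\<close>
  define c where "c = (1 + \<epsilon>) * ln (1 + \<epsilon>) - \<epsilon>"
  have "ln (1 / (1 + \<epsilon>)) < 1 / (1 + \<epsilon>) - 1"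
    using \<epsilon> by (intro ln_less_minus_one) (auto simp: field_simps)
  then have "\<epsilon> / (1 + \<epsilon>) < ln (1 + \<epsilon>)"
    using \<epsilon> by (simp add: ln_div field_simps)
  then have c: "0 < c" using \<epsilon> by (simp add: c_def field_simps)
  have E1: "\<forall>\<^sub>F \<beta> in at_top. 1 / \<epsilon> \<le> \<beta>" by (rule eventually_ge_at_top)
  have E2: "\<forall>\<^sub>F \<beta> in at_top. \<beta> powr (1 - \<delta>) < \<epsilon> / (2 * (1 + 2 * \<epsilon>) * v)"
    using \<epsilon> v by (intro neg_exponent_small \<delta>) simp
  have E3: "\<forall>\<^sub>F \<beta> in at_top. ln 2 / c \<le> \<beta>" by (rule eventually_ge_at_top)
  have E4: "\<forall>\<^sub>F \<beta> in at_top. ln 4 / (\<theta> / 2) \<le> v * \<beta> powr (2 - \<delta>) / 2"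
    using rate_at_top[OF \<delta>(2) v] unfolding filterlim_at_top by blast
  from E1 E2 E3 E4 show ?thesis
  proof eventually_elim
    case (elim \<beta>)
    define a where "a = v * \<beta> powr (2 - \<delta>) / 2"
    have "0 < 1 / \<epsilon>" using \<epsilon> by simp
    then have \<beta>: "0 < \<beta>" using elim(1) by linarith
    have \<beta>1: "1 \<le> \<epsilon> * \<beta>" using elim(1) \<epsilon> by (simp add: field_simps)
    \<comment> \<open>Slightly above the Poisson mean, so that at least half of the mass lies below
      \<open>N\<close>; by the choice of \<beta>, rounding up costs at most
      \<open>\<epsilon> * \<beta>\<close>.\<close>
    define N where "N = nat \<lceil>(1 + \<epsilon>) * \<beta>\<rceil>"
    have N1: "(1 + \<epsilon>) * \<beta> \<le> real N" unfolding N_def by linarith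
    have "real N \<le> (1 + \<epsilon>) * \<beta> + 1"
    proof -
      have "0 \<le> (1 + \<epsilon>) * \<beta>" using \<epsilon> \<beta> by simp
      then show ?thesis unfolding N_def by linarith
    qed
    then have N2: "real N \<le> (1 + 2 * \<epsilon>) * \<beta>" using \<beta>1 by (simp add: algebra_simps)
    let ?V = "\<beta> powr \<delta>"
    have V: "0 < ?V" using \<beta> by simp
    have "2 * (real N * v / ?V) \<le> 2 * ((1 + 2 * \<epsilon>) * \<beta> * v / ?V)"
      using N2 v V by (intro mult_left_mono divide_right_mono mult_right_mono) auto
    also have "\<dots> = 2 * (1 + 2 * \<epsilon>) * v * \<beta> powr (1 - \<delta>)"
      using \<beta> by (simp add: powr_1_minus)
    also have "\<dots> \<le> \<epsilon>"
    proof -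
      have "0 < 2 * (1 + 2 * \<epsilon>) * v" using \<epsilon> v by simp
      then have "\<beta> powr (1 - \<delta>) * (2 * (1 + 2 * \<epsilon>) * v) < \<epsilon>"
        using elim(2) by (simp only: pos_less_divide_eq)
      then show ?thesis by (simp only: mult.commute less_imp_le)
    qed
    finally have small: "2 * (real N * v / ?V) \<le> \<epsilon>" .
    then have "real N * v / ?V < 1" using \<epsilon> by linarith
    then have NV: "real N * v < ?V" using V by (simp add: field_simps)
    have T: "1 / 2 \<le> (\<Sum>n<N. poisson_weight \<beta> n)"
    proof -
      have "exp (\<beta> * ((1 + \<epsilon>) - 1)) / (1 + \<epsilon>) ^ N \<le> 1 / 2"
      proof -
        have "exp ((1 + \<epsilon>) * \<beta> * ln (1 + \<epsilon>)) \<le> exp (real N * ln (1 + \<epsilon>))"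
          using N1 \<epsilon> by (simp add: mult_right_mono)
        also have "\<dots> = (1 + \<epsilon>) ^ N"
          using \<epsilon> by (simp add: powr_def flip: powr_realpow)
        finally have "exp (\<beta> * \<epsilon>) / (1 + \<epsilon>) ^ N \<le> exp (\<beta> * \<epsilon>) / exp ((1 + \<epsilon>) * \<beta> * ln (1 + \<epsilon>))"
          using \<epsilon> by (intro divide_left_mono) auto
        also have "\<dots> = exp (- (c * \<beta>))"
          unfolding c_def by (simp add: exp_diff[symmetric] algebra_simps)
        also have "\<dots> \<le> exp (- ln 2)"
          using elim(3) c by (simp add: field_simps)
        also have "\<dots> = (1 / 2 :: real)" by (simp add: exp_minus)
        finally show ?thesis by simp
      qed
      then show ?thesis
        using poisson_upper_tail[of "1 + \<epsilon>" \<beta> N] \<epsilon> \<beta> by linarith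
    qed
    have h1: "exp (- ((1 + \<epsilon>) * (1 + 2 * \<epsilon>)\<^sup>2 * a)) \<le> (\<Prod>i<N. 1 - real i * v / ?V)"
    proof -
      have "(\<Sum>i<N. real i * v / ?V) \<le> (1 + 2 * \<epsilon>)\<^sup>2 * a"
      proof -
        have "(\<Sum>i<N. real i * v / ?V) = real N * (real N - 1) / 2 * (v / ?V)"
          by (simp add: sum_lessThan_real[symmetric] sum_distrib_right sum_divide_distrib)
        also have "\<dots> \<le> (real N)\<^sup>2 / 2 * (v / ?V)"
          using v V by (intro mult_right_mono) (auto simp: power2_eq_square field_simps)
        also have "\<dots> \<le> ((1 + 2 * \<epsilon>) * \<beta>)\<^sup>2 / 2 * (v / ?V)"
          using v V N2 by (intro mult_right_mono divide_right_mono power_mono) auto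
        also have "\<dots> = (1 + 2 * \<epsilon>)\<^sup>2 * a"
          using \<beta> by (simp add: a_def powr_2_minus power_mult_distrib mult_ac)
        finally show ?thesis .
      qed
      then have "(1 + \<epsilon>) * (\<Sum>i<N. real i * v / ?V) \<le> (1 + \<epsilon>) * ((1 + 2 * \<epsilon>)\<^sup>2 * a)"
        using \<epsilon> by (intro mult_left_mono) auto
      then have "exp (- ((1 + \<epsilon>) * (1 + 2 * \<epsilon>)\<^sup>2 * a)) \<le> exp (- ((1 + \<epsilon>) * (\<Sum>i<N. real i * v / ?V)))"
        by (simp add: mult.assoc)
      also have "\<dots> = (\<Prod>i<N. exp (- ((1 + \<epsilon>) * (real i * v / ?V))))"
        by (simp add: exp_sum[symmetric] sum_negf sum_distrib_left)
      also have "\<dots> \<le> (\<Prod>i<N. 1 - real i * v / ?V)"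
      proof (intro prod_mono conjI)
        fix i assume "i \<in> {..<N}"
        then have "real i * v / ?V \<le> real N * v / ?V"
          using v V by (intro divide_right_mono mult_right_mono) auto
        with small have i: "2 * (real i * v / ?V) \<le> \<epsilon>" by linarith
        moreover from i \<epsilon> have "real i * v / ?V \<le> 1 / 2" by linarith
        moreover have "0 \<le> real i * v / ?V" using v V by simp
        ultimately show "exp (- ((1 + \<epsilon>) * (real i * v / ?V))) \<le> 1 - real i * v / ?V"
          by (intro exp_le_one_minus)
      qed simp
      finally show ?thesis .
    qed
    have h2: "exp (- ((1 + \<theta>) * a)) \<le> 1 / 4 * exp (- ((1 + \<epsilon>) * (1 + 2 * \<epsilon>)\<^sup>2 * a))"
    proof -
      have a0: "0 \<le> a" using v by (simp add: a_def)
      have "(1 + \<epsilon>) * (1 + 2 * \<epsilon>)\<^sup>2 = 1 + \<epsilon> * (5 + 8 * \<epsilon> + 4 * (\<epsilon> * \<epsilon>))"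
        by (simp add: power2_eq_square algebra_simps)
      also have "\<epsilon> * (5 + 8 * \<epsilon> + 4 * (\<epsilon> * \<epsilon>)) \<le> \<epsilon> * 17"
      proof (rule mult_left_mono)
        have "\<epsilon> * \<epsilon> \<le> 1" using \<epsilon> by (intro mult_le_one) auto
        then show "5 + 8 * \<epsilon> + 4 * (\<epsilon> * \<epsilon>) \<le> 17" using \<epsilon> by linarith
      qed (use \<epsilon> in simp)
      finally have "(1 + \<epsilon>) * (1 + 2 * \<epsilon>)\<^sup>2 \<le> 1 + \<theta> / 2" using \<epsilon> by linarith
      then have "(1 + \<epsilon>) * (1 + 2 * \<epsilon>)\<^sup>2 * a \<le> (1 + \<theta> / 2) * a"
        using a0 by (rule mult_right_mono)
      moreover have "ln 4 \<le> \<theta> / 2 * a"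
        using elim(4) \<theta> unfolding a_def by (simp add: field_simps)
      ultimately have "- ((1 + \<theta>) * a) \<le> - ln 4 + - ((1 + \<epsilon>) * (1 + 2 * \<epsilon>)\<^sup>2 * a)"
        by (simp add: algebra_simps)
      then have "exp (- ((1 + \<theta>) * a)) \<le> exp (- ln 4 + - ((1 + \<epsilon>) * (1 + 2 * \<epsilon>)\<^sup>2 * a))"
        by simp
      also have "\<dots> = 1 / 4 * exp (- ((1 + \<epsilon>) * (1 + 2 * \<epsilon>)\<^sup>2 * a))"
        unfolding exp_add by (simp add: exp_minus)
      finally show ?thesis .
    qed
    have h3: "1 / 4 \<le> (\<Sum>n<N. poisson_weight \<beta> n)\<^sup>2"
      using power_mono[OF T, of 2] by (simp add: power2_eq_square)
    have "exp (- ((1 + \<theta>) * a)) \<le> (\<Sum>n<N. poisson_weight \<beta> n)\<^sup>2 * (\<Prod>i<N. 1 - real i * v / ?V)"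
      by (rule order_trans[OF h2 mult_mono[OF h3 h1]]) auto
    with NV show ?case unfolding a_def by blast
  qed
qed

text \<open>\<epsilon> and \<open>r\<close> are fixed before \<beta>, so that the window conditions
  for this \<open>r\<close> can be imposed afterwards for large \<beta>. The bound
  \<open>N \<le> \<beta>\<close> makes those conditions applicable.\<close>

lemma upper_rate:
  fixes v \<delta> \<theta> :: real
  assumes \<delta>: "1 < \<delta>" "\<delta> < 2" and v: "0 < v" and \<theta>: "0 < \<theta>" "\<theta> \<le> 1"
  obtains \<epsilon> r where "0 < \<epsilon>" "0 < r" "r \<le> 1"
    "\<forall>\<^sub>F \<beta> in at_top. \<exists>N. real N \<le> \<beta> \<and>
      (\<Sum>n<N. poisson_weight \<beta> n) + exp (- (v / \<beta> powr \<delta> * (real N * (real N - 1) / 2 - \<epsilon> * (real N)\<^sup>2))) + (2 * r powr \<epsilon>) ^ N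
        \<le> exp (- ((1 - \<theta>) * (v * \<beta> powr (2 - \<delta>) / 2))) \<and>
      ((\<Sum>n<N. poisson_weight \<beta> n) + exp (- (v / \<beta> powr \<delta> * (real N * (real N - 1) / 2 - \<epsilon> * (real N)\<^sup>2))))\<^sup>2 + (2 * r powr \<epsilon>) ^ N
        \<le> exp (- (2 * (1 - \<theta>) * (v * \<beta> powr (2 - \<delta>) / 2)))"
proof -
  \<comment> \<open>The main exponent loses at most the factor
    \<open>1 - 8 * \<epsilon> = 1 - \<theta> / 2\<close>.\<close>
  define \<epsilon> where "\<epsilon> = \<theta> / 16"
  have \<epsilon>: "0 < \<epsilon>" "\<epsilon> \<le> 1 / 16" using \<theta> by (auto simp: \<epsilon>_def)
  \<comment> \<open>Chosen so that \<open>2 * r powr \<epsilon> = exp (- 1)\<close>, which turns the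
    probability of many bad points into \<open>exp (- N)\<close>.\<close>
  define r where "r = (exp (- 1) / 2) powr (1 / \<epsilon>)"
  have r0: "0 < r" by (simp add: r_def)
  have r1: "r \<le> 1"
  proof -
    have "exp (- 1) \<le> (2::real)" by (rule order_trans[of _ 1]) auto
    then show ?thesis unfolding r_def using \<epsilon> by (intro powr_le1) auto
  qed
  have r\<epsilon>: "2 * r powr \<epsilon> = exp (- 1)" using \<epsilon> by (simp add: r_def powr_powr)
  define c0 where "c0 = \<epsilon> + (1 - \<epsilon>) * ln (1 - \<epsilon>)"
  have "ln (1 / (1 - \<epsilon>)) < 1 / (1 - \<epsilon>) - 1"
    using \<epsilon> by (intro ln_less_minus_one) (auto simp: field_simps)
  then have "- \<epsilon> / (1 - \<epsilon>) < ln (1 - \<epsilon>)"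
    using \<epsilon> by (simp add: ln_div field_simps)
  then have "0 < c0" using \<epsilon> by (simp add: c0_def field_simps)
  \<comment> \<open>The bound by \<open>c0\<close>, the Chernoff exponent of falling below
    \<open>(1 - \<epsilon>) * \<beta>\<close>, serves the Poisson tail; the bound by 1/2 serves the
    bad points, since \<open>N \<ge> \<beta> / 2\<close>.\<close>
  define c where "c = min c0 (1 / 2)"
  have c: "0 < c" "c \<le> c0" "c \<le> 1 / 2" using \<open>0 < c0\<close> by (auto simp: c_def)
  have E1: "\<forall>\<^sub>F \<beta> in at_top. 1 / \<epsilon> \<le> \<beta>" by (rule eventually_ge_at_top)
  \<comment> \<open>This amounts to \<open>2 * a \<le> c * \<beta>\<close>. The error terms must be
    below \<open>exp (- (2 * a))\<close>, not merely \<open>exp (- a)\<close>, because in the second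
    estimate they compete with the square of the main term.\<close>
  have E2: "\<forall>\<^sub>F \<beta> in at_top. \<beta> powr (1 - \<delta>) < c / v"
    using c v by (intro neg_exponent_small \<delta>) simp
  \<comment> \<open>The constant 5 is \<open>(1 + 1)^2 + 1\<close>: two terms inside the square and
    one outside, each measured against the main term.\<close>
  have E3: "\<forall>\<^sub>F \<beta> in at_top. ln 5 / (\<theta> / 2) \<le> v * \<beta> powr (2 - \<delta>) / 2"
    using rate_at_top[OF \<delta>(2) v] unfolding filterlim_at_top by blast
  from E1 E2 E3 have "\<forall>\<^sub>F \<beta> in at_top. \<exists>N. real N \<le> \<beta> \<and>
      (\<Sum>n<N. poisson_weight \<beta> n) + exp (- (v / \<beta> powr \<delta> * (real N * (real N - 1) / 2 - \<epsilon> * (real N)\<^sup>2))) + (2 * r powr \<epsilon>) ^ N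
        \<le> exp (- ((1 - \<theta>) * (v * \<beta> powr (2 - \<delta>) / 2))) \<and>
      ((\<Sum>n<N. poisson_weight \<beta> n) + exp (- (v / \<beta> powr \<delta> * (real N * (real N - 1) / 2 - \<epsilon> * (real N)\<^sup>2))))\<^sup>2 + (2 * r powr \<epsilon>) ^ N
        \<le> exp (- (2 * (1 - \<theta>) * (v * \<beta> powr (2 - \<delta>) / 2)))"
  proof eventually_elim
    case (elim \<beta>)
    define a where "a = v * \<beta> powr (2 - \<delta>) / 2"
    have a0: "0 \<le> a" using v by (simp add: a_def)
    have "0 < 1 / \<epsilon>" using \<epsilon> by simp
    then have \<beta>: "0 < \<beta>" using elim(1) by linarith
    have \<beta>1: "1 \<le> \<epsilon> * \<beta>" using elim(1) \<epsilon> by (simp add: field_simps)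
    define N where "N = nat \<lfloor>(1 - \<epsilon>) * \<beta>\<rfloor>"
    have "0 \<le> (1 - \<epsilon>) * \<beta>" using \<epsilon> \<beta> by simp
    then have N1: "real N \<le> (1 - \<epsilon>) * \<beta>" and "(1 - \<epsilon>) * \<beta> - 1 \<le> real N"
      unfolding N_def by linarith+
    then have N2: "(1 - 2 * \<epsilon>) * \<beta> \<le> real N" using \<beta>1 by (simp add: algebra_simps)
    have "(1 - \<epsilon>) * \<beta> \<le> 1 * \<beta>" using \<epsilon> \<beta> by (intro mult_right_mono) auto
    with N1 have N\<beta>: "real N \<le> \<beta>" by linarith
    have half: "1 / 2 * \<beta> \<le> (1 - 2 * \<epsilon>) * \<beta>" using \<epsilon> \<beta> by (intro mult_right_mono) auto
    have ac: "2 * a \<le> c * \<beta>"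
    proof -
      have "2 * a = v * \<beta> * \<beta> powr (1 - \<delta>)"
        using \<beta> by (simp add: a_def powr_1_minus powr_2_minus power2_eq_square)
      also have "\<dots> \<le> v * \<beta> * (c / v)" using elim(2) \<beta> v by (intro mult_left_mono) auto
      finally show ?thesis using v by (simp add: mult.commute)
    qed
    let ?T = "\<Sum>n<N. poisson_weight \<beta> n"
    let ?A = "exp (- (v / \<beta> powr \<delta> * (real N * (real N - 1) / 2 - \<epsilon> * (real N)\<^sup>2)))"
    let ?B = "(2 * r powr \<epsilon>) ^ N"
    have T0: "0 \<le> ?T" using \<beta> by (intro sum_nonneg poisson_weight_nonneg) simp
    have T: "?T \<le> exp (- (2 * a))"
    proof -
      have "exp ((1 - \<epsilon>) * \<beta> * ln (1 - \<epsilon>)) \<le> exp (real N * ln (1 - \<epsilon>))"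
      proof -
        have "ln (1 - \<epsilon>) \<le> 0" using \<epsilon> by simp
        with N1 show ?thesis by (simp add: mult_right_mono_neg)
      qed
      also have "\<dots> = (1 - \<epsilon>) ^ N"
        using \<epsilon> by (simp add: powr_def flip: powr_realpow)
      finally have "exp (\<beta> * ((1 - \<epsilon>) - 1)) / (1 - \<epsilon>) ^ N \<le> exp (\<beta> * ((1 - \<epsilon>) - 1)) / exp ((1 - \<epsilon>) * \<beta> * ln (1 - \<epsilon>))"
        using \<epsilon> by (intro divide_left_mono) auto
      also have "\<dots> = exp (- (c0 * \<beta>))"
        unfolding c0_def by (simp add: exp_diff[symmetric] algebra_simps)
      also have "\<dots> \<le> exp (- (2 * a))"
        using order_trans[OF ac mult_right_mono[OF c(2)]] \<beta> by simp
      finally show ?thesis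
        using poisson_lower_tail[of "1 - \<epsilon>" \<beta> N] \<epsilon> \<beta> by simp
    qed
    have B: "?B \<le> exp (- (2 * a))"
    proof -
      have "?B = exp (- real N)" unfolding r\<epsilon> by (simp add: exp_of_nat_mult[symmetric])
      also have "\<dots> \<le> exp (- (2 * a))"
      proof -
        have "c * \<beta> \<le> 1 / 2 * \<beta>" using c(3) \<beta> by (intro mult_right_mono) auto
        with ac half N2 have "2 * a \<le> real N" by linarith
        then show ?thesis by simp
      qed
      finally show ?thesis .
    qed
    have A: "?A \<le> exp (- ((1 - \<theta> / 2) * a))"
    proof -
      \<comment> \<open>This lets the linear term \<open>N / 2\<close> be absorbed into
        \<open>\<epsilon> * N^2\<close>.\<close>
      have "1 \<le> 2 * \<epsilon> * real N"
      proof -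
        have "1 \<le> 2 * \<epsilon> * (1 / 2 * \<beta>)" using \<beta>1 by simp
        also have "\<dots> \<le> 2 * \<epsilon> * real N" using \<epsilon> half N2 by (intro mult_left_mono) auto
        finally show ?thesis .
      qed
      then have "1 * real N \<le> 2 * \<epsilon> * real N * real N" by (rule mult_right_mono) simp
      then have "(1 - 4 * \<epsilon>) / 2 * (real N)\<^sup>2 \<le> real N * (real N - 1) / 2 - \<epsilon> * (real N)\<^sup>2"
        by (simp add: power2_eq_square field_simps)
      moreover have "(1 - 8 * \<epsilon>) / 2 * \<beta>\<^sup>2 \<le> (1 - 4 * \<epsilon>) / 2 * (real N)\<^sup>2"
      proof -
        have "(1 - 4 * \<epsilon>) * \<beta>\<^sup>2 \<le> (1 - 2 * \<epsilon>)\<^sup>2 * \<beta>\<^sup>2"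
          by (intro mult_right_mono) (auto simp: power2_eq_square algebra_simps)
        also have "\<dots> \<le> (real N)\<^sup>2"
          unfolding power_mult_distrib[symmetric] using \<epsilon> \<beta> N2 by (intro power_mono) auto
        finally have "(1 - 4 * \<epsilon>) / 2 * ((1 - 4 * \<epsilon>) * \<beta>\<^sup>2) \<le> (1 - 4 * \<epsilon>) / 2 * (real N)\<^sup>2"
          using \<epsilon> by (intro mult_left_mono) auto
        moreover have "(1 - 8 * \<epsilon>) / 2 * \<beta>\<^sup>2 \<le> (1 - 4 * \<epsilon>) / 2 * ((1 - 4 * \<epsilon>) * \<beta>\<^sup>2)"
          unfolding mult.assoc[symmetric] by (intro mult_right_mono) (auto simp: field_simps)
        ultimately show ?thesis by linarith
      qed
      ultimately have "v / \<beta> powr \<delta> * ((1 - 8 * \<epsilon>) / 2 * \<beta>\<^sup>2) \<le> v / \<beta> powr \<delta> * (real N * (real N - 1) / 2 - \<epsilon> * (real N)\<^sup>2)"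
        using v by (intro mult_left_mono) auto
      moreover have "v / \<beta> powr \<delta> * ((1 - 8 * \<epsilon>) / 2 * \<beta>\<^sup>2) = (1 - \<theta> / 2) * a"
        using \<beta> by (simp add: a_def powr_2_minus \<epsilon>_def)
      ultimately show ?thesis by simp
    qed
    let ?E = "exp (- ((1 - \<theta> / 2) * a))"
    have large: "ln 5 \<le> \<theta> / 2 * a"
      using elim(3) \<theta> unfolding a_def by (simp add: field_simps)
    have e2: "exp (- (2 * a)) \<le> ?E"
      using a0 \<theta> mult_right_mono[of "1 - \<theta> / 2" 2 a] by simp
    have e22: "exp (- (2 * a)) \<le> ?E\<^sup>2"
      using a0 \<theta> mult_right_mono[of "(1 - \<theta> / 2) * 2" 2 a]
      by (simp add: power2_eq_square exp_add[symmetric] algebra_simps)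
    have "?T + ?A + ?B \<le> 5 * ?E" using T A B e2 exp_ge_zero[of "- ((1 - \<theta> / 2) * a)"] by linarith
    also have "\<dots> = exp (ln 5 + - ((1 - \<theta> / 2) * a))" unfolding exp_add by simp
    also have "\<dots> \<le> exp (- ((1 - \<theta>) * a))" using large by (simp add: algebra_simps)
    finally have 1: "?T + ?A + ?B \<le> exp (- ((1 - \<theta>) * a))" .
    have "?T + ?A \<le> 2 * ?E" using T A e2 by linarith
    then have "(?T + ?A)\<^sup>2 \<le> (2 * ?E)\<^sup>2" using T0 by (intro power_mono) auto
    then have "(?T + ?A)\<^sup>2 + ?B \<le> 5 * ?E\<^sup>2" using B e22 by (simp add: power_mult_distrib)
    also have "\<dots> = exp (ln 5 + - (2 * (1 - \<theta> / 2) * a))"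
      unfolding exp_add by (simp add: power2_eq_square exp_add[symmetric])
    also have "\<dots> \<le> exp (- (2 * (1 - \<theta>) * a))"
    proof -
      have "0 \<le> \<theta> / 2 * a" using \<theta> a0 by simp
      then show ?thesis using large by (simp add: algebra_simps)
    qed
    finally have 2: "(?T + ?A)\<^sup>2 + ?B \<le> exp (- (2 * (1 - \<theta>) * a))" .
    show ?case using N\<beta> 1 2 unfolding a_def by blast
  qed
  with \<epsilon>(1) r0 r1 show ?thesis by (rule that)
qed

section \<open>From exponential rates to limits superior\<close>

lemma Limsup_variance_ratio_zero:
  fixes a m s :: "real \<Rightarrow> real"
  assumes a: "filterlim a at_top at_top"
    and lower: "\<And>\<theta>. 0 < \<theta> \<Longrightarrow> \<theta> \<le> 1 \<Longrightarrow> \<forall>\<^sub>F \<beta> in at_top. exp (- ((1 + \<theta>) * a \<beta>)) \<le> m \<beta>"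
    and upper: "\<forall>\<^sub>F \<beta> in at_top. m \<beta> \<le> 1"
    and s0: "\<forall>\<^sub>F \<beta> in at_top. 0 \<le> s \<beta>"
    and s: "\<And>\<theta>. 0 < \<theta> \<Longrightarrow> \<theta> \<le> 1 \<Longrightarrow> \<forall>\<^sub>F \<beta> in at_top. s \<beta> \<le> exp (- (2 * (1 - \<theta>) * a \<beta>))"
    and \<epsilon>: "0 < \<epsilon>"
  shows "Limsup at_top (\<lambda>\<beta>. ereal (s \<beta> / m \<beta> powr (2 - \<epsilon>))) = 0"
proof -
  \<comment> \<open>Keeps the exponent \<open>2 - e\<close> positive, so that a lower bound on
    \<open>m\<close> can be raised to it. As \<open>m \<le> 1\<close>, passing from
    \<open>2 - e\<close> to the smaller exponent \<open>2 - \<epsilon>\<close> only enlarges the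
    power.\<close>
  define e where "e = min \<epsilon> 1"
  have e: "0 < e" "e \<le> 1" "e \<le> \<epsilon>" using \<epsilon> by (auto simp: e_def)
  \<comment> \<open>Makes the exponent \<open>4 * \<theta> - e - \<theta> * e\<close> of the
    quotient at most \<open>- e / 2\<close>.\<close>
  define \<theta> where "\<theta> = e / 8"
  have \<theta>: "0 < \<theta>" "\<theta> \<le> 1" using e by (auto simp: \<theta>_def)
  have pos: "\<forall>\<^sub>F \<beta> in at_top. 0 \<le> a \<beta>" using a by (simp add: filterlim_at_top)
  have ub: "\<forall>\<^sub>F \<beta> in at_top. s \<beta> / m \<beta> powr (2 - \<epsilon>) \<le> exp (- (e / 2 * a \<beta>))"
    using lower[OF \<theta>] upper s0 s[OF \<theta>] pos
  proof eventually_elim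
    case (elim \<beta>)
    have m: "0 < m \<beta>" using elim(1) exp_gt_zero less_le_trans by blast
    have "exp (- ((1 + \<theta>) * a \<beta>)) powr (2 - e) \<le> m \<beta> powr (2 - e)"
      using elim(1) e by (intro powr_mono2) auto
    also have "\<dots> \<le> m \<beta> powr (2 - \<epsilon>)"
      using m elim(2) e by (intro powr_mono') auto
    finally have d: "exp (- ((1 + \<theta>) * a \<beta> * (2 - e))) \<le> m \<beta> powr (2 - \<epsilon>)"
      by (simp add: powr_def mult_ac)
    have "s \<beta> / m \<beta> powr (2 - \<epsilon>) \<le> exp (- (2 * (1 - \<theta>) * a \<beta>)) / exp (- ((1 + \<theta>) * a \<beta> * (2 - e)))"
      using elim(3,4) d by (intro frac_le) auto
    also have "\<dots> = exp ((4 * \<theta> - e - \<theta> * e) * a \<beta>)"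
      by (simp add: exp_diff[symmetric] algebra_simps)
    also have "\<dots> \<le> exp (- (e / 2) * a \<beta>)"
    proof -
      have "0 \<le> \<theta> * e" using \<theta> e by simp
      then have "4 * \<theta> - e - \<theta> * e \<le> - (e / 2)" by (simp add: \<theta>_def)
      then have "(4 * \<theta> - e - \<theta> * e) * a \<beta> \<le> - (e / 2) * a \<beta>" using elim(5) by (rule mult_right_mono)
      then show ?thesis by simp
    qed
    finally show ?case by simp
  qed
  have "filterlim (\<lambda>\<beta>. e / 2 * a \<beta>) at_top at_top"
    using e by (intro filterlim_tendsto_pos_mult_at_top[OF tendsto_const _ a]) simp
  then have "((\<lambda>\<beta>. exp (- (e / 2 * a \<beta>))) \<longlongrightarrow> 0) at_top"
    by (intro filterlim_compose[OF exp_at_bot] filterlim_uminus_at_top[THEN iffD1])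
  then have "((\<lambda>\<beta>. s \<beta> / m \<beta> powr (2 - \<epsilon>)) \<longlongrightarrow> 0) at_top"
    by (intro tendsto_sandwich[OF _ ub tendsto_const]) (use s0 in \<open>auto elim!: eventually_mono\<close>)
  then have "((\<lambda>\<beta>. ereal (s \<beta> / m \<beta> powr (2 - \<epsilon>))) \<longlongrightarrow> ereal 0) at_top"
    by (simp only: lim_ereal)
  then show ?thesis
    by (intro lim_imp_Limsup) (auto simp: zero_ereal_def)
qed

text \<open>With \<theta> = 1/10 the numerator is at least
  \<open>exp (- 1.1 a) - exp (- 1.8 a)\<close> and the denominator at most
  \<open>exp (- 1.35 a)\<close>, so the quotient is at least \<open>exp (a / 4) - 1\<close>. The
  threshold 3/2 covers both \<open>p = 2\<close> and an exponent of the form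
  \<open>2 - \<epsilon>\<close>.\<close>

lemma Limsup_variance_ratio_infinite:
  fixes a m s :: "real \<Rightarrow> real"
  assumes a: "filterlim a at_top at_top"
    and m0: "\<forall>\<^sub>F \<beta> in at_top. 0 < m \<beta>"
    and upper: "\<And>\<theta>. 0 < \<theta> \<Longrightarrow> \<theta> \<le> 1 \<Longrightarrow> \<forall>\<^sub>F \<beta> in at_top. m \<beta> \<le> exp (- ((1 - \<theta>) * a \<beta>))"
    and s: "\<And>\<theta>. 0 < \<theta> \<Longrightarrow> \<theta> \<le> 1 \<Longrightarrow> \<forall>\<^sub>F \<beta> in at_top. exp (- ((1 + \<theta>) * a \<beta>)) \<le> s \<beta>"
    and p: "3 / 2 \<le> p"
  shows "Limsup at_top (\<lambda>\<beta>. ereal ((s \<beta> - (m \<beta>)\<^sup>2) / m \<beta> powr p)) = \<infinity>"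
proof -
  have pos: "\<forall>\<^sub>F \<beta> in at_top. 2 \<le> a \<beta>" using a by (simp add: filterlim_at_top)
  have lb: "\<forall>\<^sub>F \<beta> in at_top. a \<beta> / 4 \<le> (s \<beta> - (m \<beta>)\<^sup>2) / m \<beta> powr p"
    using m0 upper[of "1/10", simplified] s[of "1/10", simplified] pos
  proof eventually_elim
    case (elim \<beta>)
    have m1: "m \<beta> \<le> 1" proof -
      have "exp (- (9 / 10 * a \<beta>)) \<le> exp 0" using elim(4) by (subst exp_le_cancel_iff) simp
      then show ?thesis using elim(2) by (simp del: exp_le_one_iff)
    qed
    have "(m \<beta>)\<^sup>2 \<le> (exp (- (9 / 10 * a \<beta>)))\<^sup>2" using elim by (intro power_mono) auto
    also have "\<dots> = exp (- (18 / 10 * a \<beta>))" by (simp add: power2_eq_square exp_add[symmetric])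
    finally have num: "exp (- (11 / 10 * a \<beta>)) - exp (- (18 / 10 * a \<beta>)) \<le> s \<beta> - (m \<beta>)\<^sup>2"
      using elim(3) by simp
    have "exp (- (18 / 10 * a \<beta>)) \<le> exp (- (11 / 10 * a \<beta>))" using elim(4) by simp
    then have num0: "0 \<le> exp (- (11 / 10 * a \<beta>)) - exp (- (18 / 10 * a \<beta>))" by simp
    have "m \<beta> powr p \<le> m \<beta> powr (3 / 2)" using elim(1) m1 p by (intro powr_mono') auto
    also have "\<dots> \<le> exp (- (9 / 10 * a \<beta>)) powr (3 / 2)" using elim(1,2) by (intro powr_mono2) simp_all
    also have "\<dots> = exp (- (27 / 20 * a \<beta>))" by (simp add: powr_def)
    finally have den: "m \<beta> powr p \<le> exp (- (27 / 20 * a \<beta>))" .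
    have "a \<beta> / 4 \<le> exp (1 / 4 * a \<beta>) - 1"
      using exp_ge_add_one_self[of "1 / 4 * a \<beta>"] by linarith
    also have "\<dots> \<le> exp (1 / 4 * a \<beta>) - exp (- (9 / 20 * a \<beta>))"
      using elim(4) by simp
    also have "\<dots> = (exp (- (11 / 10 * a \<beta>)) - exp (- (18 / 10 * a \<beta>))) / exp (- (27 / 20 * a \<beta>))"
      by (simp add: diff_divide_distrib exp_diff[symmetric])
    also have "\<dots> \<le> (s \<beta> - (m \<beta>)\<^sup>2) / m \<beta> powr p"
      by (rule frac_le[OF order_trans[OF num0 num] num _ den]) (use elim(1) in simp)
    finally show ?case .
  qed
  have "filterlim (\<lambda>\<beta>. 1 / 4 * a \<beta>) at_top at_top"
    by (intro filterlim_tendsto_pos_mult_at_top[OF tendsto_const _ a]) simp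
  then have "filterlim (\<lambda>\<beta>. (s \<beta> - (m \<beta>)\<^sup>2) / m \<beta> powr p) at_top at_top"
    by (rule filterlim_at_top_mono) (use lb in simp)
  then have "((\<lambda>\<beta>. ereal ((s \<beta> - (m \<beta>)\<^sup>2) / m \<beta> powr p)) \<longlongrightarrow> \<infinity>) at_top"
    by (simp add: tendsto_PInfty_eq_at_top)
  then show ?thesis by (intro lim_imp_Limsup) auto
qed

section \<open>Application to the growing windows\<close>

lemma eventually_window_conditions:
  fixes \<delta> r :: real
  assumes \<delta>: "1 < \<delta>" and r: "0 < r"
  shows "\<forall>\<^sub>F \<beta> in at_top. \<forall>N. real N \<le> \<beta> \<longrightarrow>
    2 * real N * unit_ball_vol (real DIM(real ^ 'd)) \<le> measure lborel (window \<delta> \<beta> :: (real ^ 'd) set) \<and>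
    2 * (measure lborel (window \<delta> \<beta> - inner_window \<delta> \<beta> :: (real ^ 'd) set) +
      real N * (2 ^ DIM(real ^ 'd) * unit_ball_vol (real DIM(real ^ 'd))))
    \<le> r * measure lborel (window \<delta> \<beta> :: (real ^ 'd) set)"
proof -
  define v where "v = unit_ball_vol (real DIM(real ^ 'd))"
  have v: "0 < v" by (simp add: v_def)
  define D :: real where "D = 2 ^ DIM(real ^ 'd)"
  have D: "0 < D" by (simp add: D_def)
  have side: "filterlim (\<lambda>\<beta>. \<beta> powr (\<delta> / real CARD('d))) at_top at_top"
  proof -
    have "0 < \<delta> / real CARD('d)" using \<delta> by simp
    then show ?thesis by real_asymp
  qed
  \<comment> \<open>The boundary layer is a vanishing fraction of the window because the side length
    grows. It takes one half of the budget \<open>r\<close>; the balls of radius 2 take the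
    other.\<close>
  have "((\<lambda>\<beta>. 2 * (1 - (1 - 2 / \<beta> powr (\<delta> / real CARD('d))) ^ CARD('d))) \<longlongrightarrow> 2 * (1 - (1 - 0) ^ CARD('d))) at_top"
    by (intro tendsto_intros tendsto_divide_0[OF tendsto_const] filterlim_at_top_imp_at_infinity side)
  then have E1: "\<forall>\<^sub>F \<beta> in at_top. 2 * (1 - (1 - 2 / \<beta> powr (\<delta> / real CARD('d))) ^ CARD('d)) < r / 2"
    by (rule order_tendstoD) (use r in simp)
  have E2: "\<forall>\<^sub>F \<beta> in at_top. 2 \<le> \<beta> powr (\<delta> / real CARD('d))"
    using side unfolding filterlim_at_top by blast
  have E3: "\<forall>\<^sub>F \<beta> in at_top. \<beta> powr (1 - \<delta>) < 1 / (2 * v)"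
    using v by (intro neg_exponent_small \<delta>) simp
  have E4: "\<forall>\<^sub>F \<beta> in at_top. \<beta> powr (1 - \<delta>) < r / (4 * (D * v))"
    using v D r by (intro neg_exponent_small \<delta>) simp
  have E5: "\<forall>\<^sub>F \<beta> in at_top. (0::real) < \<beta>" by (rule eventually_gt_at_top)
  from E1 E2 E3 E4 E5 show ?thesis
    unfolding v_def[symmetric] D_def[symmetric]
  proof eventually_elim
    case (elim \<beta>)
    let ?V = "\<beta> powr \<delta>"
    have V: "0 < ?V" using elim(5) by simp
    have b: "\<beta> powr (1 - \<delta>) * ?V = \<beta>"
      using elim(5) by (simp add: powr_add[symmetric])
    have "\<beta> * (2 * v) \<le> ?V"
    proof -
      have "\<beta> powr (1 - \<delta>) * (2 * v) \<le> 1"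
        using elim(3) v by (simp add: field_simps)
      then have "\<beta> powr (1 - \<delta>) * (2 * v) * ?V \<le> 1 * ?V" by (rule mult_right_mono) simp
      then show ?thesis using b by (simp add: mult_ac)
    qed
    moreover have "\<beta> * (2 * (D * v)) \<le> r / 2 * ?V"
    proof -
      have "\<beta> powr (1 - \<delta>) * (4 * (D * v)) < r"
        using elim(4) v D by (simp add: field_simps)
      then have "\<beta> powr (1 - \<delta>) * (2 * (D * v)) \<le> r / 2" by simp
      then have "\<beta> powr (1 - \<delta>) * (2 * (D * v)) * ?V \<le> r / 2 * ?V" by (rule mult_right_mono) simp
      moreover have "\<beta> powr (1 - \<delta>) * (2 * (D * v)) * ?V = \<beta> * (2 * (D * v))"
        by (subst (2) b[symmetric]) (simp add: mult_ac)
      ultimately show ?thesis by simp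
    qed
    moreover have "2 * measure lborel (window \<delta> \<beta> - inner_window \<delta> \<beta> :: (real ^ 'd) set) \<le> r / 2 * ?V"
      unfolding measure_window_boundary[OF elim(5,2)]
      using mult_right_mono[OF less_imp_le[OF elim(1)], of ?V] by (simp only: mult_ac powr_ge_zero simp_thms)
    moreover have "real N * (2 * v) \<le> \<beta> * (2 * v)" "real N * (2 * (D * v)) \<le> \<beta> * (2 * (D * v))"
      if "real N \<le> \<beta>" for N
      using that v D by (auto intro!: mult_right_mono)
    ultimately show ?case
      unfolding measure_window[OF elim(5)] by (fastforce simp: algebra_simps)
  qed
qed

definition decay_rate :: "'d::finite itself \<Rightarrow> real \<Rightarrow> real \<Rightarrow> real" where
  "decay_rate _ \<delta> \<beta> = unit_ball_vol (real DIM(real ^ 'd)) * \<beta> powr (2 - \<delta>) / 2"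

lemma sequential_sampling_window:
  assumes "0 < \<beta>"
  shows "sequential_sampling (window \<delta> \<beta> :: (real ^ 'd) set) (iid_law (window \<delta> \<beta>)) (\<lambda>_ _. uniform_measure lborel (window \<delta> \<beta>))"
    and "sequential_sampling (window \<delta> \<beta> :: (real ^ 'd) set) (sequential_law (window \<delta> \<beta>)) (sequential_kernel (window \<delta> \<beta>))"
  by (intro sequential_sampling_iid sequential_sampling_sequential window_borel emeasure_window assms)+

context
  fixes \<delta> \<theta> :: real and W :: "real \<Rightarrow> (real ^ 'd) set"
  assumes \<delta>: "1 < \<delta>" "\<delta> < 2" and \<theta>: "0 < \<theta>" "\<theta> \<le> 1"
  defines "W \<equiv> window \<delta>"
begin

lemma eventually_moments_ge:
  "\<forall>\<^sub>F \<beta> in at_top. exp (- ((1 + \<theta>) * decay_rate TYPE('d) \<delta> \<beta>)) \<le>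
    prob_space.expectation (iid_law (W \<beta>)) (\<lambda>x. (cmc_estimator (W \<beta>) \<beta> x)\<^sup>2)"
  "\<forall>\<^sub>F \<beta> in at_top. exp (- ((1 + \<theta>) * decay_rate TYPE('d) \<delta> \<beta>)) \<le>
    prob_space.expectation (sequential_law (W \<beta>)) (blocking_estimator (W \<beta>) \<beta>)"
proof -
  let ?v = "unit_ball_vol (real DIM(real ^ 'd))"
  have "\<forall>\<^sub>F \<beta> in at_top. (0::real) < \<beta>" by (rule eventually_gt_at_top)
  then have "\<forall>\<^sub>F \<beta> in at_top. exp (- ((1 + \<theta>) * decay_rate TYPE('d) \<delta> \<beta>)) \<le>
      prob_space.expectation (iid_law (W \<beta>)) (\<lambda>x. (cmc_estimator (W \<beta>) \<beta> x)\<^sup>2) \<and>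
    exp (- ((1 + \<theta>) * decay_rate TYPE('d) \<delta> \<beta>)) \<le>
      prob_space.expectation (sequential_law (W \<beta>)) (blocking_estimator (W \<beta>) \<beta>)"
    using lower_rate[OF \<delta> _ \<theta>(1), of ?v, simplified]
  proof eventually_elim
    case (elim \<beta>)
    have \<beta>: "0 < \<beta>" "0 \<le> \<beta>" using elim(1) by auto
    interpret R: sequential_sampling "W \<beta>" "iid_law (W \<beta>)" "\<lambda>_ _. uniform_measure lborel (W \<beta>)"
      unfolding W_def by (rule sequential_sampling_window[OF \<beta>(1)])
    interpret Q: sequential_sampling "W \<beta>" "sequential_law (W \<beta>)" "sequential_kernel (W \<beta>)"
      unfolding W_def by (rule sequential_sampling_window[OF \<beta>(1)])
    have V: "measure lborel (W \<beta>) = \<beta> powr \<delta>" unfolding W_def by (rule measure_window[OF \<beta>(1)])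
    obtain N where N: "real N * ?v < measure lborel (W \<beta>)"
      and le: "exp (- ((1 + \<theta>) * decay_rate TYPE('d) \<delta> \<beta>)) \<le>
        (\<Sum>n<N. poisson_weight \<beta> n)\<^sup>2 * (\<Prod>i<N. 1 - real i * ?v / measure lborel (W \<beta>))"
      using elim(2) unfolding V decay_rate_def by auto
    let ?T = "\<Sum>n<N. poisson_weight \<beta> n" and ?p = "\<Prod>i<N. 1 - real i * ?v / measure lborel (W \<beta>)"
    note le
    also have "?T\<^sup>2 * ?p \<le> R.expectation (\<lambda>x. (cmc_estimator (W \<beta>) \<beta> x)\<^sup>2)"
      by (rule R.cmc_second_moment_ge[OF refl less_imp_le[OF N] \<beta>(2)])
    finally have 1: "exp (- ((1 + \<theta>) * decay_rate TYPE('d) \<delta> \<beta>)) \<le> R.expectation (\<lambda>x. (cmc_estimator (W \<beta>) \<beta> x)\<^sup>2)" .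
    have T: "0 \<le> ?T" using \<beta> by (intro sum_nonneg poisson_weight_nonneg)
    have "0 \<le> ?p"
    proof (intro prod_nonneg ballI)
      fix i assume "i \<in> {..<N}"
      then have "real i * ?v \<le> real N * ?v" by (intro mult_right_mono) auto
      with N have "real i * ?v \<le> measure lborel (W \<beta>)" by linarith
      then show "0 \<le> 1 - real i * ?v / measure lborel (W \<beta>)" using R.measure_W_pos by simp
    qed
    \<comment> \<open>The rate is stated with the squared Poisson mass; as that mass is at most 1,
      the same \<open>N\<close> also bounds the mean, where the mass enters to the first
      power.\<close>
    moreover have "?T\<^sup>2 \<le> ?T"
      using T poisson_weight_sum_le_1[OF \<beta>(2), of N] by (simp add: power2_eq_square mult_left_le)
    ultimately have "?T\<^sup>2 * ?p \<le> ?T * ?p" by (intro mult_right_mono)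
    also have "\<dots> \<le> Q.expectation (blocking_estimator (W \<beta>) \<beta>)"
      by (rule Q.blocking_mean_ge[OF refl N \<beta>(2)])
    finally show ?case using 1 le by simp
  qed
  then show "\<forall>\<^sub>F \<beta> in at_top. exp (- ((1 + \<theta>) * decay_rate TYPE('d) \<delta> \<beta>)) \<le>
    prob_space.expectation (iid_law (W \<beta>)) (\<lambda>x. (cmc_estimator (W \<beta>) \<beta> x)\<^sup>2)"
    "\<forall>\<^sub>F \<beta> in at_top. exp (- ((1 + \<theta>) * decay_rate TYPE('d) \<delta> \<beta>)) \<le>
    prob_space.expectation (sequential_law (W \<beta>)) (blocking_estimator (W \<beta>) \<beta>)"
    by (auto elim: eventually_mono)
qed

lemma eventually_moments_le:
  "\<forall>\<^sub>F \<beta> in at_top. prob_space.expectation (iid_law (W \<beta>)) (cmc_estimator (W \<beta>) \<beta>) \<le>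
    exp (- ((1 - \<theta>) * decay_rate TYPE('d) \<delta> \<beta>))"
  "\<forall>\<^sub>F \<beta> in at_top. prob_space.expectation (sequential_law (W \<beta>)) (\<lambda>x. (blocking_estimator (W \<beta>) \<beta> x)\<^sup>2) \<le>
    exp (- (2 * (1 - \<theta>) * decay_rate TYPE('d) \<delta> \<beta>))"
proof -
  let ?v = "unit_ball_vol (real DIM(real ^ 'd))"
  have v: "0 < ?v" by simp
  obtain \<epsilon> r where \<epsilon>r: "0 < \<epsilon>" "0 < r" "r \<le> 1" and
    rate: "\<forall>\<^sub>F \<beta> in at_top. \<exists>N. real N \<le> \<beta> \<and>
      (\<Sum>n<N. poisson_weight \<beta> n) + exp (- (?v / \<beta> powr \<delta> * (real N * (real N - 1) / 2 - \<epsilon> * (real N)\<^sup>2))) + (2 * r powr \<epsilon>) ^ N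
        \<le> exp (- ((1 - \<theta>) * (?v * \<beta> powr (2 - \<delta>) / 2))) \<and>
      ((\<Sum>n<N. poisson_weight \<beta> n) + exp (- (?v / \<beta> powr \<delta> * (real N * (real N - 1) / 2 - \<epsilon> * (real N)\<^sup>2))))\<^sup>2 + (2 * r powr \<epsilon>) ^ N
        \<le> exp (- (2 * (1 - \<theta>) * (?v * \<beta> powr (2 - \<delta>) / 2)))"
    by (rule upper_rate[OF \<delta> v \<theta>])
  have "\<forall>\<^sub>F \<beta> in at_top. (0::real) < \<beta>" by (rule eventually_gt_at_top)
  then have "\<forall>\<^sub>F \<beta> in at_top. prob_space.expectation (iid_law (W \<beta>)) (cmc_estimator (W \<beta>) \<beta>) \<le>
      exp (- ((1 - \<theta>) * decay_rate TYPE('d) \<delta> \<beta>)) \<and>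
    prob_space.expectation (sequential_law (W \<beta>)) (\<lambda>x. (blocking_estimator (W \<beta>) \<beta> x)\<^sup>2) \<le>
      exp (- (2 * (1 - \<theta>) * decay_rate TYPE('d) \<delta> \<beta>))"
    using rate eventually_window_conditions[OF \<delta>(1) \<epsilon>r(2), where 'd='d]
  proof eventually_elim
    case (elim \<beta>)
    have \<beta>: "0 < \<beta>" "0 \<le> \<beta>" using elim(1) by auto
    interpret R: sequential_sampling "W \<beta>" "iid_law (W \<beta>)" "\<lambda>_ _. uniform_measure lborel (W \<beta>)"
      unfolding W_def by (rule sequential_sampling_window[OF \<beta>(1)])
    interpret Q: sequential_sampling "W \<beta>" "sequential_law (W \<beta>)" "sequential_kernel (W \<beta>)"
      unfolding W_def by (rule sequential_sampling_window[OF \<beta>(1)])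
    let ?U = "inner_window \<delta> \<beta> :: (real ^ 'd) set"
    have V: "measure lborel (W \<beta>) = \<beta> powr \<delta>" unfolding W_def by (rule measure_window[OF \<beta>(1)])
    have U: "y \<in> ?U \<Longrightarrow> cball y 1 \<subseteq> W \<beta>" for y
      unfolding W_def by (rule cball_inner_window)
    obtain N where "real N \<le> \<beta>" and
      le: "(\<Sum>n<N. poisson_weight \<beta> n) + exp (- (?v / measure lborel (W \<beta>) * (real N * (real N - 1) / 2 - \<epsilon> * (real N)\<^sup>2))) + (2 * r powr \<epsilon>) ^ N
        \<le> exp (- ((1 - \<theta>) * decay_rate TYPE('d) \<delta> \<beta>))"
      "((\<Sum>n<N. poisson_weight \<beta> n) + exp (- (?v / measure lborel (W \<beta>) * (real N * (real N - 1) / 2 - \<epsilon> * (real N)\<^sup>2))))\<^sup>2 + (2 * r powr \<epsilon>) ^ N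
        \<le> exp (- (2 * (1 - \<theta>) * decay_rate TYPE('d) \<delta> \<beta>))"
      using elim(2) unfolding V decay_rate_def by auto
    with elim(3) have half: "2 * real N * ?v \<le> measure lborel (W \<beta>)"
      and bad: "2 * (measure lborel (W \<beta> - ?U) + real N * (2 ^ DIM(real ^ 'd) * ?v)) \<le> r * measure lborel (W \<beta>)"
      unfolding W_def by blast+
    note R.cmc_mean_le[OF U window_borel(2) \<epsilon>r(2,3) half bad \<beta>(2) refl, of \<epsilon>]
    also note le(1)
    finally have 1: "R.expectation (cmc_estimator (W \<beta>) \<beta>) \<le> exp (- ((1 - \<theta>) * decay_rate TYPE('d) \<delta> \<beta>))" .
    note Q.blocking_second_moment_le[OF U window_borel(2) \<epsilon>r(2,3) half bad \<beta>(2) refl, of \<epsilon>]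
    also note le(2)
    finally show ?case using 1 by blast
  qed
  then show "\<forall>\<^sub>F \<beta> in at_top. prob_space.expectation (iid_law (W \<beta>)) (cmc_estimator (W \<beta>) \<beta>) \<le>
      exp (- ((1 - \<theta>) * decay_rate TYPE('d) \<delta> \<beta>))"
    "\<forall>\<^sub>F \<beta> in at_top. prob_space.expectation (sequential_law (W \<beta>)) (\<lambda>x. (blocking_estimator (W \<beta>) \<beta> x)\<^sup>2) \<le>
      exp (- (2 * (1 - \<theta>) * decay_rate TYPE('d) \<delta> \<beta>))"
    by (auto elim: eventually_mono)
qed

end

lemma Limsup_ereal_cong_eventually:
  assumes "\<forall>\<^sub>F x in F. f x = g x"
  shows "Limsup F (\<lambda>x. ereal (f x)) = Limsup F (\<lambda>x. ereal (g x))"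
  by (rule Limsup_eq) (use assms in \<open>auto elim: eventually_mono\<close>)

theorem theorem4:
  fixes \<delta> :: real
    and P :: "real \<Rightarrow> 'w measure"
    and X :: "real \<Rightarrow> 'w \<Rightarrow> (real ^ 'd) set"
    and W :: "real \<Rightarrow> (real ^ 'd) set"
    and \<kappa> pstar :: "real \<Rightarrow> real"
    and \<rho> \<mu> :: "real \<Rightarrow> (nat \<Rightarrow> real ^ 'd) measure"
    and Yhat Ytilde :: "real \<Rightarrow> (nat \<Rightarrow> real ^ 'd) \<Rightarrow> real"
  assumes "1 < \<delta>" "\<delta> < 2"
  defines "W \<equiv> window \<delta>"
    and "\<kappa> \<equiv> (\<lambda>\<beta>. \<beta> powr (1 - \<delta>))"
  assumes "\<And>\<beta>. \<beta> > 0 \<Longrightarrow> poisson_process (P \<beta>) (X \<beta>) (W \<beta>) (\<kappa> \<beta>)"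
  defines "pstar \<equiv> (\<lambda>\<beta>. measure (P \<beta>) {\<omega> \<in> space (P \<beta>). X \<beta> \<omega> \<in> hard_sphere (W \<beta>)})"
    and "\<rho> \<equiv> (\<lambda>\<beta>. iid_law (W \<beta>))"
    and "\<mu> \<equiv> (\<lambda>\<beta>. sequential_law (W \<beta>))"
    and "Yhat \<equiv> (\<lambda>\<beta>. cmc_estimator (W \<beta>) \<beta>)"
    and "Ytilde \<equiv> (\<lambda>\<beta>. blocking_estimator (W \<beta>) \<beta>)"
  shows
    "(vanishing_mean \<mu> Ytilde \<and>
      logarithmically_efficient \<mu> Ytilde \<and>
      (\<forall>\<epsilon>>0. Limsup at_top (\<lambda>\<beta>. ereal (prob_space.variance (\<mu> \<beta>) (Ytilde \<beta>) /
                 pstar \<beta> powr (2 - \<epsilon>))) = 0))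
     \<and>
     (vanishing_mean \<rho> Yhat \<and>
      \<not> bounded_relative_error \<rho> Yhat \<and>
      Limsup at_top (\<lambda>\<beta>. ereal (prob_space.variance (\<rho> \<beta>) (Yhat \<beta>) / (pstar \<beta>)\<^sup>2)) = \<infinity> \<and>
      \<not> logarithmically_efficient \<rho> Yhat \<and>
      \<not> (\<forall>\<epsilon>>0. Limsup at_top (\<lambda>\<beta>. ereal (prob_space.variance (\<rho> \<beta>) (Yhat \<beta>) /
                 pstar \<beta> powr (2 - \<epsilon>))) = 0))"
proof -
  define a where "a = decay_rate TYPE('d) \<delta>"
  define m1 where "m1 \<beta> = prob_space.expectation (\<rho> \<beta>) (Yhat \<beta>)" for \<beta>
  define m2 where "m2 \<beta> = prob_space.expectation (\<mu> \<beta>) (Ytilde \<beta>)" for \<beta>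
  define s1 where "s1 \<beta> = prob_space.expectation (\<rho> \<beta>) (\<lambda>x. (Yhat \<beta> x)\<^sup>2)" for \<beta>
  define s2 where "s2 \<beta> = prob_space.expectation (\<mu> \<beta>) (\<lambda>x. (Ytilde \<beta> x)\<^sup>2)" for \<beta>
  define var1 where "var1 \<beta> = prob_space.variance (\<rho> \<beta>) (Yhat \<beta>)" for \<beta>
  define var2 where "var2 \<beta> = prob_space.variance (\<mu> \<beta>) (Ytilde \<beta>)" for \<beta>
  have a: "filterlim a at_top at_top"
    unfolding a_def decay_rate_def by (rule rate_at_top[OF \<open>\<delta> < 2\<close>]) simp
  have ev0: "\<forall>\<^sub>F \<beta> in at_top. (0::real) < \<beta>" by (rule eventually_gt_at_top)
  have basics: "pstar \<beta> = m1 \<beta> \<and> var1 \<beta> = s1 \<beta> - (m1 \<beta>)\<^sup>2 \<and> s1 \<beta> \<le> m1 \<beta> \<and>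
      (m2 \<beta>)\<^sup>2 \<le> s2 \<beta> \<and> 0 \<le> m2 \<beta> \<and> 0 \<le> var2 \<beta> \<and> var2 \<beta> \<le> s2 \<beta>" if \<beta>: "0 < \<beta>" for \<beta>
  proof -
    interpret R: sequential_sampling "W \<beta>" "\<rho> \<beta>" "\<lambda>_ _. uniform_measure lborel (W \<beta>)"
      unfolding W_def \<rho>_def by (rule sequential_sampling_window[OF \<beta>])
    interpret Q: sequential_sampling "W \<beta>" "\<mu> \<beta>" "sequential_kernel (W \<beta>)"
      unfolding W_def \<mu>_def by (rule sequential_sampling_window[OF \<beta>])
    have b: "0 \<le> \<beta>" using \<beta> by simp
    have "\<beta> = \<kappa> \<beta> * measure lborel (W \<beta>)"
      unfolding W_def \<kappa>_def measure_window[OF \<beta>] using \<beta> by (simp add: powr_add[symmetric])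
    then have "pstar \<beta> = m1 \<beta>"
      unfolding pstar_def m1_def \<rho>_def Yhat_def
      by (intro poisson_hard_sphere_eq_expectation[OF assms(5)[OF \<beta>]] \<beta>)
        (simp_all only: W_def window_borel bounded_window emeasure_window[OF \<beta>] not_False_eq_True)
    then show ?thesis
      using R.cmc_moments(1,2)[OF b b] Q.blocking_moments(3-6)[OF b b]
      unfolding m1_def m2_def s1_def s2_def var1_def var2_def Yhat_def Ytilde_def
      by (intro conjI)
  qed
  have ev_basics: "\<forall>\<^sub>F \<beta> in at_top. pstar \<beta> = m1 \<beta> \<and> var1 \<beta> = s1 \<beta> - (m1 \<beta>)\<^sup>2 \<and> s1 \<beta> \<le> m1 \<beta> \<and>
      (m2 \<beta>)\<^sup>2 \<le> s2 \<beta> \<and> 0 \<le> m2 \<beta> \<and> 0 \<le> var2 \<beta> \<and> var2 \<beta> \<le> s2 \<beta>"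
    using ev0 by eventually_elim (rule basics)
  have s1_ge: "\<forall>\<^sub>F \<beta> in at_top. exp (- ((1 + \<theta>) * a \<beta>)) \<le> s1 \<beta>"
    and m2_ge: "\<forall>\<^sub>F \<beta> in at_top. exp (- ((1 + \<theta>) * a \<beta>)) \<le> m2 \<beta>"
    and m1_le: "\<forall>\<^sub>F \<beta> in at_top. m1 \<beta> \<le> exp (- ((1 - \<theta>) * a \<beta>))"
    and s2_le: "\<forall>\<^sub>F \<beta> in at_top. s2 \<beta> \<le> exp (- (2 * (1 - \<theta>) * a \<beta>))"
    if "0 < \<theta>" "\<theta> \<le> 1" for \<theta>
    using eventually_moments_ge[OF \<open>1 < \<delta>\<close> \<open>\<delta> < 2\<close> that, where 'd='d]
      eventually_moments_le[OF \<open>1 < \<delta>\<close> \<open>\<delta> < 2\<close> that, where 'd='d]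
    unfolding a_def m1_def m2_def s1_def s2_def W_def \<rho>_def \<mu>_def Yhat_def Ytilde_def by blast+
  \<comment> \<open>\<open>Yhat\<close> takes values in the unit interval, so its second moment is a
    lower bound for its mean.\<close>
  have m1_ge: "\<forall>\<^sub>F \<beta> in at_top. exp (- ((1 + \<theta>) * a \<beta>)) \<le> m1 \<beta>" if "0 < \<theta>" "\<theta> \<le> 1" for \<theta>
    using s1_ge[OF that] ev_basics by eventually_elim linarith
  have var2_le: "\<forall>\<^sub>F \<beta> in at_top. var2 \<beta> \<le> exp (- (2 * (1 - \<theta>) * a \<beta>))" if "0 < \<theta>" "\<theta> \<le> 1" for \<theta>
    using s2_le[OF that] ev_basics by eventually_elim linarith
  \<comment> \<open>Here the bound on the mean comes from the second moment: its rate at \<theta> =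
    1/2 is \<open>exp (- a)\<close>, and the square root is taken.\<close>
  have m2_le: "\<forall>\<^sub>F \<beta> in at_top. m2 \<beta> \<le> exp (- (1 / 2 * a \<beta>))"
    using s2_le[of "1 / 2", simplified] ev_basics
  proof eventually_elim
    case (elim \<beta>)
    then have "(m2 \<beta>)\<^sup>2 \<le> (exp (- (1 / 2 * a \<beta>)))\<^sup>2"
      by (simp add: power2_eq_square exp_add[symmetric])
    then show ?case by (rule power2_le_imp_le) simp
  qed
  have m1_le': "\<forall>\<^sub>F \<beta> in at_top. m1 \<beta> \<le> exp (- (1 / 2 * a \<beta>))"
    using m1_le[of "1 / 2"] by simp
  have decay: "((\<lambda>\<beta>. exp (- (1 / 2 * a \<beta>))) \<longlongrightarrow> 0) at_top"
  proof -
    have "filterlim (\<lambda>\<beta>. 1 / 2 * a \<beta>) at_top at_top"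
      by (intro filterlim_tendsto_pos_mult_at_top[OF tendsto_const _ a]) simp
    then show ?thesis
      by (intro filterlim_compose[OF exp_at_bot] filterlim_uminus_at_top[THEN iffD1])
  qed
  have le1: "\<forall>\<^sub>F \<beta> in at_top. m \<beta> \<le> 1" if "\<forall>\<^sub>F \<beta> in at_top. m \<beta> \<le> exp (- (1 / 2 * a \<beta>))" for m
    using eventually_conj[OF that order_tendstoD(2)[OF decay zero_less_one]]
    by (rule eventually_mono) linarith
  have m1_pos: "\<forall>\<^sub>F \<beta> in at_top. 0 < m1 \<beta>"
    using m1_ge[of 1] by (rule eventually_mono) (auto intro: less_le_trans[OF exp_gt_zero])
  have m1_lim: "(m1 \<longlongrightarrow> 0) at_top"
    by (rule tendsto_sandwich[OF _ m1_le' tendsto_const decay])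
      (use m1_pos in \<open>auto elim: eventually_mono\<close>)
  have m2_lim: "(m2 \<longlongrightarrow> 0) at_top"
    by (rule tendsto_sandwich[OF _ m2_le tendsto_const decay])
      (use ev_basics in \<open>auto elim: eventually_mono\<close>)
  have var2_pos: "\<forall>\<^sub>F \<beta> in at_top. 0 \<le> var2 \<beta>"
    using ev_basics by (rule eventually_mono) blast
  have eff2: "Limsup at_top (\<lambda>\<beta>. ereal (var2 \<beta> / m2 \<beta> powr (2 - \<epsilon>))) = 0" if "0 < \<epsilon>" for \<epsilon>
    by (rule Limsup_variance_ratio_zero[OF a m2_ge le1[OF m2_le] var2_pos var2_le that])
  \<comment> \<open>The variance of one estimator is set against the mean of the other; this works
    because both means have the rate \<open>a\<close>.\<close>
  have eff1: "Limsup at_top (\<lambda>\<beta>. ereal (var2 \<beta> / m1 \<beta> powr (2 - \<epsilon>))) = 0" if "0 < \<epsilon>" for \<epsilon>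
    by (rule Limsup_variance_ratio_zero[OF a m1_ge le1[OF m1_le'] var2_pos var2_le that])
  have eff1': "Limsup at_top (\<lambda>\<beta>. ereal (var2 \<beta> / pstar \<beta> powr (2 - \<epsilon>))) = 0" if "0 < \<epsilon>" for \<epsilon>
    by (rule trans[OF Limsup_ereal_cong_eventually eff1[OF that]]) (use ev_basics in \<open>auto elim: eventually_mono\<close>)
  have inf: "Limsup at_top (\<lambda>\<beta>. ereal (var1 \<beta> / m1 \<beta> powr p)) = \<infinity>" if "3 / 2 \<le> p" for p
    by (rule trans[OF Limsup_ereal_cong_eventually Limsup_variance_ratio_infinite[OF a m1_pos m1_le s1_ge that]]) (use ev_basics in \<open>auto elim: eventually_mono\<close>)
  have inf': "Limsup at_top (\<lambda>\<beta>. ereal (var1 \<beta> / pstar \<beta> powr p)) = \<infinity>" if "3 / 2 \<le> p" for p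
    by (rule trans[OF Limsup_ereal_cong_eventually inf[OF that]]) (use ev_basics in \<open>auto elim: eventually_mono\<close>)
  have inf2: "Limsup at_top (\<lambda>\<beta>. ereal (var1 \<beta> / (m1 \<beta>)\<^sup>2)) = \<infinity>"
    by (rule trans[OF Limsup_ereal_cong_eventually inf[of 2]]) (use m1_pos in \<open>auto elim!: eventually_mono simp: powr_numeral\<close>)
  have inf2': "Limsup at_top (\<lambda>\<beta>. ereal (var1 \<beta> / (pstar \<beta>)\<^sup>2)) = \<infinity>"
    by (rule trans[OF Limsup_ereal_cong_eventually inf2]) (use ev_basics in \<open>auto elim: eventually_mono\<close>)
  \<comment> \<open>The choice \<epsilon> = 1/2 refutes logarithmic efficiency.\<close>
  have half: "3 / 2 \<le> 2 - (1 / 2 :: real)" "0 < (1 / 2 :: real)" by auto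
  have "vanishing_mean \<mu> Ytilde" "vanishing_mean \<rho> Yhat"
    using m2_lim m1_lim unfolding vanishing_mean_def m1_def[abs_def] m2_def[abs_def] .
  moreover have "logarithmically_efficient \<mu> Ytilde"
    using eff2 unfolding logarithmically_efficient_def m2_def var2_def by blast
  moreover have "\<not> bounded_relative_error \<rho> Yhat"
    using inf2 unfolding bounded_relative_error_def m1_def var1_def by simp
  moreover have "\<not> logarithmically_efficient \<rho> Yhat"
  proof
    assume "logarithmically_efficient \<rho> Yhat"
    then have "Limsup at_top (\<lambda>\<beta>. ereal (var1 \<beta> / m1 \<beta> powr (2 - 1 / 2))) = 0"
      using half(2) unfolding logarithmically_efficient_def m1_def var1_def by blast
    then show False unfolding inf[OF half(1)] by simp
  qed
  moreover have "\<not> (\<forall>\<epsilon>>0. Limsup at_top (\<lambda>\<beta>. ereal (var1 \<beta> / pstar \<beta> powr (2 - \<epsilon>))) = 0)"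
  proof
    assume "\<forall>\<epsilon>>0. Limsup at_top (\<lambda>\<beta>. ereal (var1 \<beta> / pstar \<beta> powr (2 - \<epsilon>))) = 0"
    then have "Limsup at_top (\<lambda>\<beta>. ereal (var1 \<beta> / pstar \<beta> powr (2 - 1 / 2))) = 0"
      using half(2) by blast
    then show False unfolding inf'[OF half(1)] by simp
  qed
  ultimately show ?thesis
    using eff1' inf2' unfolding var1_def var2_def by blast
qed

end
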